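(* If $d,n$ are nonnegative integers with $d\le 9.36\times 10^{20}$, then $J^{d,n}(X)$ is hyperbolic.
   Context: Let $\zeta(s)$ be the Riemann zeta function and let $\xi(s):=\frac12 s(s-1)\pi^{-s/2}\Gamma(\frac s2)\zeta(s)$, an entire function. Define real numbers $\gamma(j)$, $j\ge 0$, by $\xi\big(\tfrac12+z\big)=\sum_{j=0}^{\infty}\frac{\gamma(j)}{j!}z^{2j}$; it is known that $\gamma(j)>0$ for all $j\ge 0$. For integers $d,n\ge 0$ define $J^{d,n}(X):=\sum_{j=0}^{d}\binom dj\gamma(n+j)X^j$. A polynomial with real coefficients is hyperbolic if all of its complex zeros are real. The following known result (Platt's rigorous numerical verification) may be assumed: every zero $\rho$ of $\xi(s)$ with $|\mathrm{Im}(\rho)|\le 3.06\times 10^{10}$ satisfies $\mathrm{Re}(\rho)=\frac12$. *)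

theory Defs
  imports
    "HOL-Complex_Analysis.Complex_Analysis"
    "HOL-Computational_Algebra.Polynomial"
begin

(* The analytic continuation of the Dirichlet series.  The description is unique by the
   identity theorem on the connected set - {1}; the value at the pole 1 is fixed as 0 only
   to pin down a total function. *)
definition riemann_zeta :: "complex \<Rightarrow> complex" where
  "riemann_zeta = (THE f. f holomorphic_on (- {1}) \<and>
     (\<forall>s. Re s > 1 \<longrightarrow> (\<lambda>n. 1 / of_nat (Suc n) powr s) sums f s) \<and> f 1 = 0)"

(* The product has removable singularities at 0, 1 and the negative even integers.  There the
   bare HOL expression evaluates to 0 (Gamma is 0 at its poles), which is not the value of the
   entire function xi, hence remove_sings. *)
definition riemann_xi :: "complex \<Rightarrow> complex" where
  "riemann_xi = remove_sings
     (\<lambda>s. 1 / 2 * s * (s - 1) * of_real pi powr (- s / 2) * Gamma (s / 2) * riemann_zeta s)"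

definition xi_coeff :: "nat \<Rightarrow> real" where
  "xi_coeff = (THE g. \<forall>z::complex.
     (\<lambda>j. of_real (g j) / fact j * z ^ (2 * j)) sums riemann_xi (1 / 2 + z))"

definition jensen_poly :: "nat \<Rightarrow> nat \<Rightarrow> real poly" where
  "jensen_poly d n = (\<Sum>j\<le>d. monom (of_nat (d choose j) * xi_coeff (n + j)) j)"

definition hyperbolic :: "real poly \<Rightarrow> bool" where
  "hyperbolic p \<longleftrightarrow> (\<forall>z::complex. poly (map_poly of_real p) z = 0 \<longrightarrow> z \<in> \<real>)"

end

theory Submission
  imports Defs "HOL-Computational_Algebra.Fundamental_Theorem_Algebra" "HOL-Real_Asymp.Real_Asymp"
begin

text \<open>
  Write \<open>\<xi>(1/2 + z) = F(z\<^sup>2)\<close>, so that \<open>F(w) = \<Sum>\<gamma>(j)/j! w\<^sup>j\<close>. A zero \<open>1/2 + a + b i\<close> of \<open>\<xi>\<close> yields the zero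
  \<open>a\<^sup>2 - b\<^sup>2 + 2 a b i\<close> of \<open>F\<close>; since \<open>\<bar>a\<bar> \<le> 1/2\<close>, and \<open>a = 0\<close> unless \<open>\<bar>b\<bar> > T\<close>, all zeros of \<open>F\<close> lie in the
  convex sector \<open>(T - 1) \<bar>Im w\<bar> \<le> - Re w\<close>, \<open>Re w < 0\<close>. As \<open>F\<close> has order \<open>1/2\<close>, it is a limit of real
  polynomials with zeros among those of \<open>F\<close>, and by Gauss-Lucas the derivatives \<open>F\<^sup>(\<^sup>n\<^sup>)\<close> are limits of
  polynomials \<open>q\<close> with zeros in the same sector. The reversed Jensen polynomial is \<open>F\<^sup>(\<^sup>n\<^sup>)(D) x\<^sup>d\<close>, and a
  real quadratic factor \<open>(D - w)(D - cnj w)\<close> of \<open>q(D)\<close> preserves real-rootedness in degree at most \<open>d\<close> as soon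
  as \<open>(d - 1) (Im w)\<^sup>2 \<le> (Re w)\<^sup>2\<close>.

  The function \<open>\<xi>\<close> and the positivity of its Taylor coefficients come from the Mellin transform of the
  theta function in the variable \<open>x = e\<^sup>2\<^sup>u\<close>, where the theta transformation becomes the reflection
  \<open>u \<mapsto> - u\<close>.
\<close>

section \<open>Differential operators preserving real-rootedness\<close>

text \<open>Nothing is known about zeros above height T, so F may have non-real zeros and need not
  lie in the Laguerre-Polya class. A bounded degree is saved by a comparison of apertures: the
  quadratic operator tolerates about 1/sqrt(d), and possible zeros off the negative axis have at
  most about 1/T. Hence the condition d <= (T - 1)^2, where T - 1 in place of T absorbs the term a^2
  <= 1/4. Growth enters only as an upper bound exp(eps |w|) for every eps > 0: once all zeros in a
  disc are divided out, the logarithm of the cofactor is small near 0, so no infinite product over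
  zeros is formed. \<open>riemann_zeta\<close> and \<open>xi_coeff\<close> are definite
  descriptions, so the functions have to be constructed before anything can be said of them. The
  construction starts with nonnegative quantities in \<open>ennreal\<close>, where sums and
  integrals exchange freely and finiteness can be settled afterwards. The theta transformation comes
  from a finite identity between cosines and binomial coefficients, passed to the limit with
  explicit majorants.\<close>

lemma poly_pderiv_prod_linear:
  fixes x :: "nat \<Rightarrow> complex"
  assumes "\<And>i. i < m \<Longrightarrow> z \<noteq> x i"
  shows "poly (pderiv (\<Prod>i<m. [:-x i, 1:])) z = poly (\<Prod>i<m. [:-x i, 1:]) z * (\<Sum>i<m. 1 / (z - x i))"
    and "poly (pderiv (pderiv (\<Prod>i<m. [:-x i, 1:]))) z =
      poly (\<Prod>i<m. [:-x i, 1:]) z * ((\<Sum>i<m. 1 / (z - x i))\<^sup>2 - (\<Sum>i<m. (1 / (z - x i))\<^sup>2))"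
proof -
  have *: "poly (pderiv (\<Prod>i<m. [:-x i, 1:])) z = poly (\<Prod>i<m. [:-x i, 1:]) z * (\<Sum>i<m. 1 / (z - x i)) \<and>
    poly (pderiv (pderiv (\<Prod>i<m. [:-x i, 1:]))) z =
      poly (\<Prod>i<m. [:-x i, 1:]) z * ((\<Sum>i<m. 1 / (z - x i))\<^sup>2 - (\<Sum>i<m. (1 / (z - x i))\<^sup>2))"
    using assms
  proof (induction m)
    case (Suc m)
    define P where "P = (\<Prod>i<m. [:-x i, 1:])"
    have [simp]: "pderiv [:-x m, 1:] = 1" "pderiv 1 = (0::complex poly)"
      by (simp_all add: pderiv_pCons one_pCons)
    have eq: "(\<Prod>i<Suc m. [:-x i, 1:]) = P * [:-x m, 1:]" by (simp add: P_def)
    have nz: "z - x m \<noteq> 0" using Suc.prems[of m] by auto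
    have 1: "poly (pderiv P) z = poly P z * (\<Sum>i<m. 1 / (z - x i))"
      and 2: "poly (pderiv (pderiv P)) z = poly P z * ((\<Sum>i<m. 1 / (z - x i))\<^sup>2 - (\<Sum>i<m. (1 / (z - x i))\<^sup>2))"
      using Suc by (simp_all add: P_def)
    have "poly (pderiv (P * [:-x m, 1:])) z = poly P z + (z - x m) * poly (pderiv P) z"
      unfolding pderiv_mult by (simp add: algebra_simps)
    moreover have "poly (pderiv (pderiv (P * [:-x m, 1:]))) z = 2 * poly (pderiv P) z + (z - x m) * poly (pderiv (pderiv P)) z"
      unfolding pderiv_mult pderiv_add by (simp add: pderiv_mult algebra_simps)
    ultimately have 3: "poly (pderiv (P * [:-x m, 1:])) z = poly P z + (z - x m) * (poly P z * (\<Sum>i<m. 1 / (z - x i)))"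
      "poly (pderiv (pderiv (P * [:-x m, 1:]))) z = 2 * (poly P z * (\<Sum>i<m. 1 / (z - x i))) +
        (z - x m) * (poly P z * ((\<Sum>i<m. 1 / (z - x i))\<^sup>2 - (\<Sum>i<m. (1 / (z - x i))\<^sup>2)))"
      by (simp_all only: 1 2)
    have 4: "poly (P * [:-x m, 1:]) z = poly P z * (z - x m)" by (simp add: algebra_simps)
    have r: "(z - x m) * (1 / (z - x m)) = 1" using nz by simp
    show ?case unfolding eq 3 4 sum.lessThan_Suc using r by algebra
  qed simp
  from * show "poly (pderiv (\<Prod>i<m. [:-x i, 1:])) z = poly (\<Prod>i<m. [:-x i, 1:]) z * (\<Sum>i<m. 1 / (z - x i))"
    and "poly (pderiv (pderiv (\<Prod>i<m. [:-x i, 1:]))) z =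
      poly (\<Prod>i<m. [:-x i, 1:]) z * ((\<Sum>i<m. 1 / (z - x i))\<^sup>2 - (\<Sum>i<m. (1 / (z - x i))\<^sup>2))"
    by blast+
qed

text \<open>With u i = 1 / (z - x i) over the zeros with multiplicity, p'/p is linear and p''/p =
  (p'/p)^2 + (p'/p)' is quadratic in u. For real zeros and non-real z all Im (u i) have the same
  sign, which is what the two operator lemmas exploit.\<close>

lemma complex_poly_log_deriv:
  fixes p :: "complex poly"
  obtains x where "\<And>z. poly p z = lead_coeff p * (\<Prod>i<degree p. z - x i)"
    "\<And>z. poly p z \<noteq> 0 \<Longrightarrow> poly (pderiv p) z = poly p z * (\<Sum>i<degree p. 1 / (z - x i))"
    "\<And>z. poly p z \<noteq> 0 \<Longrightarrow> poly (pderiv (pderiv p)) z =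
      poly p z * ((\<Sum>i<degree p. 1 / (z - x i))\<^sup>2 - (\<Sum>i<degree p. (1 / (z - x i))\<^sup>2))"
proof -
  obtain x where x: "smult (lead_coeff p) (\<Prod>i<degree p. [:-x i, 1:]) = p"
    using complex_poly_decompose' by blast
  let ?P = "\<Prod>i<degree p. [:-x i, 1:]"
  have p: "poly p z = lead_coeff p * poly ?P z" for z by (subst x[symmetric]) (simp only: poly_smult)
  have d: "pderiv p = smult (lead_coeff p) (pderiv ?P)"
    by (subst x[symmetric]) (simp only: pderiv_smult)
  show ?thesis
  proof (rule that[of x])
    show "poly p z = lead_coeff p * (\<Prod>i<degree p. z - x i)" for z
      unfolding p by (simp add: poly_prod)
  next
    fix z assume nz: "poly p z \<noteq> 0"
    have ne: "z \<noteq> x i" if "i < degree p" for i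
    proof
      assume "z = x i"
      hence "poly ?P z = 0" using that by (auto simp: poly_prod)
      thus False using nz p by simp
    qed
    show "poly (pderiv p) z = poly p z * (\<Sum>i<degree p. 1 / (z - x i))"
      unfolding d p poly_smult using poly_pderiv_prod_linear(1)[of "degree p" z x, OF ne] by simp
    show "poly (pderiv (pderiv p)) z =
      poly p z * ((\<Sum>i<degree p. 1 / (z - x i))\<^sup>2 - (\<Sum>i<degree p. (1 / (z - x i))\<^sup>2))"
      unfolding d p poly_smult pderiv_smult using poly_pderiv_prod_linear(2)[of "degree p" z x, OF ne] by simp
  qed
qed

text \<open>The form \<open>(\<Sum>u)\<^sup>2 - \<Sum>u\<^sup>2\<close> is Lorentzian on \<open>\<real>\<^sup>m\<close>, and a vector orthogonal to a time-like one is
  not time-like.\<close>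
lemma sum_square_minus_sum_squares_not_nonneg:
  fixes u :: "nat \<Rightarrow> complex"
  assumes m: "2 \<le> m" and pos: "\<And>i. i < m \<Longrightarrow> 0 < Im (u i)"
    and re: "(\<Sum>i<m. u i)\<^sup>2 - (\<Sum>i<m. (u i)\<^sup>2) = of_real K" and K: "0 \<le> K"
  shows False
proof -
  define R where "R = (\<Sum>i<m. Re (u i))"
  define S where "S = (\<Sum>i<m. Im (u i))"
  define R2 where "R2 = (\<Sum>i<m. (Re (u i))\<^sup>2)"
  define S2 where "S2 = (\<Sum>i<m. (Im (u i))\<^sup>2)"
  define RS where "RS = (\<Sum>i<m. Re (u i) * Im (u i))"
  have "Im ((\<Sum>i<m. u i)\<^sup>2 - (\<Sum>i<m. (u i)\<^sup>2)) = 2 * R * S - 2 * RS"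
    by (simp add: R_def S_def RS_def Im_power2 sum_distrib_left mult.assoc)
  hence 1: "R * S = RS" using re by simp
  have "Re ((\<Sum>i<m. u i)\<^sup>2 - (\<Sum>i<m. (u i)\<^sup>2)) = R\<^sup>2 - S\<^sup>2 - (R2 - S2)"
    by (simp add: R_def S_def R2_def S2_def Re_power2 sum_subtractf)
  hence 2: "R\<^sup>2 - S\<^sup>2 - (R2 - S2) \<ge> 0" using re K by simp
  have cs: "RS\<^sup>2 \<le> R2 * S2" unfolding RS_def R2_def S2_def by (rule Cauchy_Schwarz_ineq_sum)
  have S2pos: "S2 > 0" unfolding S2_def
  proof (intro sum_pos)
    show "{..<m} \<noteq> {}" using m by (metis lessThan_empty_iff bot_nat_0.extremum_unique not_numeral_le_zero bot_nat_def)
    show "0 < (Im (u i))\<^sup>2" if "i \<in> {..<m}" for i using pos[of i] that by simp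
  qed auto
  \<comment> \<open>Since m >= 2 and all entries are positive, each one is strictly below the total
    S; so the vector of imaginary parts is time-like.\<close>
  have "S2 < (\<Sum>i<m. Im (u i) * S)" unfolding S2_def
  proof (rule sum_strict_mono)
    fix i assume i: "i \<in> {..<m}"
    obtain j where j: "j < m" "j \<noteq> i" using m by (metis One_nat_def Suc_1 Suc_le_lessD less_trans zero_less_one less_numeral_extra(4) lessI)
    have "Im (u i) + Im (u j) = (\<Sum>l\<in>{i,j}. Im (u l))" using j by simp
    also have "\<dots> \<le> S" unfolding S_def using i j pos by (intro sum_mono2) (auto intro: less_imp_le)
    finally have "Im (u i) < S" using pos[OF j(1)] by simp
    thus "(Im (u i))\<^sup>2 < Im (u i) * S" using pos i by (simp add: power2_eq_square)
  next
    show "{..<m} \<noteq> {}" using m by (metis lessThan_empty_iff bot_nat_0.extremum_unique not_numeral_le_zero bot_nat_def)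
  qed auto
  hence 3: "S2 < S\<^sup>2" by (simp add: S_def sum_distrib_right power2_eq_square)
  \<comment> \<open>R * S = RS says that real and imaginary parts are orthogonal for the form. Then
    R^2 S2 <= R^2 S^2 = RS^2 <= R2 S2, so R^2 <= R2, and fact 2 forces S^2 <= S2 against fact
    3.\<close>
  have "R\<^sup>2 * S2 \<le> R\<^sup>2 * S\<^sup>2" using 3 by (intro mult_left_mono) auto
  also have "\<dots> \<le> R2 * S2" using cs 1 by (metis power_mult_distrib)
  finally have "R\<^sup>2 \<le> R2" using S2pos by simp
  with 2 3 show False by simp
qed

definition real_rooted :: "complex poly \<Rightarrow> bool" where
  "real_rooted p \<longleftrightarrow> p \<noteq> 0 \<and> (\<forall>z. poly p z = 0 \<longrightarrow> z \<in> \<real>)"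

text \<open>A zero z with Im z nonzero would give p'/p = a at z, a real number; but the terms 1 / (z
  - x i) all have imaginary part of the sign of - Im z. Only an empty sum escapes this, and it would
  give a = 0.\<close>

lemma real_rooted_linear_op:
  assumes p: "real_rooted p" and a: "a \<noteq> 0"
  shows "real_rooted (pderiv p - smult (of_real a) p)"
proof -
  let ?q = "pderiv p - smult (of_real a) p"
  have p0: "p \<noteq> 0" using p by (simp add: real_rooted_def)
  have "z \<in> \<real>" if z: "poly ?q z = 0" for z
  proof (rule ccontr)
    assume nr: "z \<notin> \<real>"
    hence nz: "poly p z \<noteq> 0" using p by (auto simp: real_rooted_def)
    obtain x where x: "\<And>z. poly p z = lead_coeff p * (\<Prod>i<degree p. z - x i)"
      "poly (pderiv p) z = poly p z * (\<Sum>i<degree p. 1 / (z - x i))"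
      using complex_poly_log_deriv[of p] nz by metis
    have xr: "Im (x i) = 0" if "i < degree p" for i
    proof -
      have "poly p (x i) = 0" using x(1)[of "x i"] that by auto
      thus ?thesis using p by (auto simp: real_rooted_def complex_is_Real_iff)
    qed
    have "(\<Sum>i<degree p. 1 / (z - x i)) = of_real a" using z nz x(2) by (simp add: algebra_simps)
    hence *: "(\<Sum>i<degree p. Im (1 / (z - x i))) = 0" "degree p \<noteq> 0"
      using a by (auto simp flip: Im_sum intro!: Nat.gr0I)
    have "(\<Sum>i<degree p. Im (1 / (z - x i))) = - Im z * (\<Sum>i<degree p. 1 / (cmod (z - x i))\<^sup>2)"
      unfolding sum_distrib_left by (intro sum.cong) (auto simp: Im_divide cmod_power2 xr)
    moreover have "(\<Sum>i<degree p. 1 / (cmod (z - x i))\<^sup>2) > 0"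
    proof (intro sum_pos)
      fix i assume "i \<in> {..<degree p}"
      hence "z \<noteq> x i" using xr nr by (auto simp: complex_is_Real_iff)
      thus "0 < 1 / (cmod (z - x i))\<^sup>2" by simp
    qed (use * in auto)
    ultimately show False using * nr by (auto simp: complex_is_Real_iff)
  qed
  moreover have "?q \<noteq> 0"
  proof
    assume "?q = 0"
    hence "coeff ?q (degree p) = 0" by simp
    thus False using p0 a by (simp add: coeff_pderiv coeff_eq_0)
  qed
  ultimately show ?thesis by (auto simp: real_rooted_def)
qed

text \<open>Dividing by p z turns the equation into a quadratic relation for the numbers v i = 1 /
  (z - x i). A real shift of all v i absorbs the linear term and leaves the constant (Re w)^2 / (m -
  1) - (Im w)^2. The sector condition makes it nonnegative, which the Lorentzian form
  excludes.\<close>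

lemma real_rooted_quadratic_op:
  assumes p: "real_rooted p" and deg: "real (degree p) \<le> k\<^sup>2"
    and w: "Re w < 0" "k * \<bar>Im w\<bar> \<le> - Re w" "0 \<le> k"
  shows "real_rooted (pderiv (pderiv p) - smult (2 * of_real (Re w)) (pderiv p) + smult (of_real ((cmod w)\<^sup>2)) p)"
proof -
  let ?q = "pderiv (pderiv p) - smult (2 * of_real (Re w)) (pderiv p) + smult (of_real ((cmod w)\<^sup>2)) p"
  define m where "m = degree p"
  have p0: "p \<noteq> 0" using p by (simp add: real_rooted_def)
  have w0: "w \<noteq> 0" using w by auto
  have "z \<in> \<real>" if z: "poly ?q z = 0" for z
  proof (rule ccontr)
    assume nr: "z \<notin> \<real>"
    hence nz: "poly p z \<noteq> 0" using p by (auto simp: real_rooted_def)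
    obtain x where x: "\<And>z. poly p z = lead_coeff p * (\<Prod>i<m. z - x i)"
      "poly (pderiv p) z = poly p z * (\<Sum>i<m. 1 / (z - x i))"
      "poly (pderiv (pderiv p)) z = poly p z * ((\<Sum>i<m. 1 / (z - x i))\<^sup>2 - (\<Sum>i<m. (1 / (z - x i))\<^sup>2))"
      using complex_poly_log_deriv[of p] nz unfolding m_def by metis
    have xr: "Im (x i) = 0" if "i < m" for i
    proof -
      have "poly p (x i) = 0" using x(1)[of "x i"] that by auto
      thus ?thesis using p by (auto simp: real_rooted_def complex_is_Real_iff)
    qed
    have zx: "z \<noteq> x i" if "i < m" for i using that xr nr by (auto simp: complex_is_Real_iff)
    \<comment> \<open>A global sign makes all imaginary parts positive; as s^2 = 1, the quadratic
      form does not change.\<close>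
    define s where "s = - sgn (Im z)"
    have s: "s = 1 \<or> s = -1" using nr by (auto simp: s_def sgn_if complex_is_Real_iff)
    define v where "v i = 1 / (z - x i)" for i
    have v: "Im (of_real s * v i) > 0" if i: "i < m" for i
    proof -
      have "Im (of_real s * v i) = \<bar>Im z\<bar> / (cmod (z - x i))\<^sup>2"
        using s by (auto simp: v_def Im_divide cmod_power2 xr i s_def sgn_if split: if_splits)
      thus ?thesis using zx[OF i] nr by (auto simp: complex_is_Real_iff)
    qed
    have eq: "(\<Sum>i<m. v i)\<^sup>2 - (\<Sum>i<m. (v i)\<^sup>2) - 2 * of_real (Re w) * (\<Sum>i<m. v i) + of_real ((cmod w)\<^sup>2) = 0"
    proof -
      have "poly p z * ((\<Sum>i<m. v i)\<^sup>2 - (\<Sum>i<m. (v i)\<^sup>2) - 2 * of_real (Re w) * (\<Sum>i<m. v i) + of_real ((cmod w)\<^sup>2)) = poly ?q z"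
        unfolding poly_add poly_diff poly_smult x(2,3) v_def by (simp add: algebra_simps)
      thus ?thesis using z nz by simp
    qed
    show False
    \<comment> \<open>For m <= 1 the quadratic form vanishes: m = 0 leaves |w|^2 = 0, and m = 1 a
      real linear equation for the non-real v 0.\<close>
    proof (cases "m \<le> 1")
      case True
      then consider "m = 0" | "m = 1" by linarith
      thus False
      proof cases
        case 2
        hence "Im (of_real s * (2 * of_real (Re w) * v 0)) = 0" using arg_cong[OF eq, of Im] by (auto simp: algebra_simps)
        hence "Re w * Im (of_real s * v 0) = 0" by (simp add: algebra_simps)
        thus False using v[of 0] 2 w by (auto simp del: times_complex.sel)
      qed (use eq w0 in auto)
    next
      case False
      define M where "M = real m"
      have M: "M \<ge> 2" using False by (simp add: M_def)
      \<comment> \<open>Shifting every v i by t adds 2 t (M - 1) times their sum to the form; this t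
        makes that equal to the term with - 2 Re w.\<close>
      define t where "t = - Re w / (M - 1)"
      have tm: "t * (M - 1) = - Re w" using M by (simp add: t_def)
      define K where "K = (Re w)\<^sup>2 / (M - 1) - (Im w)\<^sup>2"
      have Kt: "K = M * t * (- Re w) - (cmod w)\<^sup>2"
        unfolding cmod_power2 using M by (simp add: K_def t_def field_simps power2_eq_square)
      have s1: "(\<Sum>i<m. v i + of_real t) = (\<Sum>i<m. v i) + of_real (M * t)"
        by (simp add: sum.distrib M_def)
      have s2: "(\<Sum>i<m. (v i + of_real t)\<^sup>2) = (\<Sum>i<m. (v i)\<^sup>2) + 2 * of_real t * (\<Sum>i<m. v i) + of_real (M * t\<^sup>2)"
        by (simp add: power2_sum sum.distrib M_def sum_distrib_left algebra_simps)
      have "(\<Sum>i<m. v i + of_real t)\<^sup>2 - (\<Sum>i<m. (v i + of_real t)\<^sup>2)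
        = (\<Sum>i<m. v i)\<^sup>2 - (\<Sum>i<m. (v i)\<^sup>2) + 2 * of_real (t * (M - 1)) * (\<Sum>i<m. v i) + of_real (M * t * (t * (M - 1)))"
        unfolding s1 s2 by (simp add: power2_eq_square algebra_simps)
      also have "\<dots> = of_real K" using eq unfolding tm Kt by (simp add: algebra_simps)
      finally have E: "(\<Sum>i<m. v i + of_real t)\<^sup>2 - (\<Sum>i<m. (v i + of_real t)\<^sup>2) = of_real K" .
      have "(k * \<bar>Im w\<bar>)\<^sup>2 \<le> (- Re w)\<^sup>2" using w by (intro power_mono) auto
      hence "k\<^sup>2 * (Im w)\<^sup>2 \<le> (Re w)\<^sup>2" by (simp add: power_mult_distrib)
      moreover have "(M - 1) * (Im w)\<^sup>2 \<le> k\<^sup>2 * (Im w)\<^sup>2" using deg by (intro mult_right_mono) (auto simp: M_def m_def)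
      ultimately have K: "K \<ge> 0" using M by (simp add: K_def field_simps)
      show False
      proof (rule sum_square_minus_sum_squares_not_nonneg[of m "\<lambda>i. of_real s * (v i + of_real t)" K])
        show "2 \<le> m" using False by simp
        show "0 < Im (of_real s * (v i + of_real t))" if "i < m" for i using v[OF that] by simp
        have "of_real s * of_real s = (1 :: complex)" using s by auto
        hence "(of_real s * y)\<^sup>2 = y\<^sup>2" for y :: complex
          by (simp add: power_mult_distrib power2_eq_square)
        hence "(\<Sum>i<m. of_real s * (v i + of_real t))\<^sup>2 = (\<Sum>i<m. v i + of_real t)\<^sup>2"
          "(\<Sum>i<m. (of_real s * (v i + of_real t))\<^sup>2) = (\<Sum>i<m. (v i + of_real t)\<^sup>2)"
          by (simp_all flip: sum_distrib_left)
        thus "(\<Sum>i<m. of_real s * (v i + of_real t))\<^sup>2 - (\<Sum>i<m. (of_real s * (v i + of_real t))\<^sup>2) = of_real K"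
          using E by simp
      qed (rule K)
    qed
  qed
  moreover have "?q \<noteq> 0"
  proof
    assume "?q = 0"
    hence "coeff ?q (degree p) = 0" by simp
    thus False using p0 w0 by (simp add: coeff_pderiv coeff_eq_0)
  qed
  ultimately show ?thesis by (auto simp: real_rooted_def)
qed

section \<open>Constant-coefficient differential operators q(D)\<close>

definition diff_op :: "complex poly \<Rightarrow> complex poly \<Rightarrow> complex poly" where
  "diff_op q p = (\<Sum>i\<le>degree q. smult (coeff q i) ((pderiv ^^ i) p))"

lemma smult_sum_right: "smult c (sum f A) = (\<Sum>x\<in>A. smult c (f x))"
  by (induction A rule: infinite_finite_induct) (simp_all add: smult_add_right)

lemma diff_op_altdef:
  assumes "degree q \<le> n"
  shows "diff_op q p = (\<Sum>i\<le>n. smult (coeff q i) ((pderiv ^^ i) p))"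
  unfolding diff_op_def using assms by (intro sum.mono_neutral_left) (auto simp: coeff_eq_0)

lemma diff_op_0_left [simp]: "diff_op 0 p = 0"
  by (simp add: diff_op_def)

lemma diff_op_add_left: "diff_op (q + r) p = diff_op q p + diff_op r p"
proof -
  define n where "n = max (degree q) (degree r)"
  have "degree q \<le> n" "degree r \<le> n" "degree (q + r) \<le> n" by (auto simp: n_def degree_add_le_max)
  thus ?thesis by (simp add: diff_op_altdef smult_add_left sum.distrib)
qed

lemma diff_op_smult_left: "diff_op (smult c q) p = smult c (diff_op q p)"
  by (simp add: diff_op_altdef[of "smult c q" "degree q"] diff_op_def smult_sum_right)

lemma diff_op_pCons_0: "diff_op (pCons 0 q) p = diff_op q (pderiv p)"
proof -
  have "diff_op (pCons 0 q) p = (\<Sum>i\<le>Suc (degree q). smult (coeff (pCons 0 q) i) ((pderiv ^^ i) p))"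
    by (intro diff_op_altdef) (simp add: degree_pCons_le)
  also have "\<dots> = diff_op q (pderiv p)"
    by (subst sum.atMost_Suc_shift) (simp add: diff_op_def funpow_swap1 del: funpow.simps add: funpow_Suc_right)
  finally show ?thesis .
qed

lemma diff_op_add_right: "diff_op q (p + r) = diff_op q p + diff_op q r"
  by (simp add: diff_op_def higher_pderiv_add smult_add_right sum.distrib)

lemma diff_op_smult_right: "diff_op q (smult c p) = smult c (diff_op q p)"
  by (simp add: diff_op_def higher_pderiv_smult smult_sum_right mult.commute)

lemma diff_op_pCons: "diff_op (pCons a q) p = smult a p + diff_op q (pderiv p)"
proof -
  have "pCons a q = [:a:] + pCons 0 q" by simp
  thus ?thesis by (simp only: diff_op_add_left diff_op_pCons_0) (simp add: diff_op_def)
qed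

text \<open>Products of symbols become compositions of operators, so the roots of q can be processed
  one real root or one conjugate pair at a time.\<close>

lemma diff_op_mult: "diff_op (q * r) p = diff_op r (diff_op q p)"
proof (induction q arbitrary: p)
  case (pCons a q)
  show ?case
    by (simp add: diff_op_add_left diff_op_smult_left diff_op_pCons diff_op_pCons_0 pCons
        diff_op_add_right diff_op_smult_right)
qed (simp add: diff_op_def[of r])

lemma map_poly_cnj_mult: "map_poly cnj (p * q) = map_poly cnj p * map_poly cnj q"
  by (subst poly_eq_poly_eq_iff [symmetric]) (auto simp: fun_eq_iff)

text \<open>Realness of coefficients is encoded as invariance under \<open>map_poly cnj\<close>;
  this lemma keeps it when a real factor is split off.\<close>

lemma map_poly_cnj_cancel_left:
  assumes "map_poly cnj (a * q) = a * q" "map_poly cnj a = a" "a \<noteq> 0"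
  shows "map_poly cnj q = q"
  using assms by (metis map_poly_cnj_mult mult_left_cancel)

lemma map_poly_cnj_pderiv: "map_poly cnj (pderiv p) = pderiv (map_poly cnj p)"
  by (intro poly_eqI) (simp add: coeff_map_poly coeff_pderiv)

lemma map_poly_cnj_higher_pderiv: "map_poly cnj ((pderiv ^^ n) p) = (pderiv ^^ n) (map_poly cnj p)"
  by (induction n) (simp_all add: map_poly_cnj_pderiv)

text \<open>For k >= 0 this is an intersection of three half-planes, hence convex, as Gauss-Lucas
  requires. The strict inequality excludes the apex 0.\<close>

definition neg_sector :: "real \<Rightarrow> complex set" where
  "neg_sector k = {w. Re w < 0 \<and> k * \<bar>Im w\<bar> \<le> - Re w}"

text \<open>Induction on the degree of q, removing a real root or a conjugate pair. Neither kind of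
  factor raises the degree of p, so the bound \<open>degree p\<close> <= k^2 remains valid at every
  stage.\<close>

theorem diff_op_real_rooted:
  assumes "map_poly cnj q = q" "q \<noteq> 0" "\<And>r. poly q r = 0 \<Longrightarrow> r \<in> neg_sector k"
    and "real_rooted p" "real (degree p) \<le> k\<^sup>2" "0 \<le> k"
  shows "real_rooted (diff_op q p)"
  using assms(1-5)
proof (induction "degree q" arbitrary: q p rule: less_induct)
  case less
  note q = less.prems(1-3) and p = less.prems(4,5)
  show ?case
  proof (cases "degree q = 0")
    case True
    then obtain c where "q = [:c:]" by (rule degree_eq_zeroE)
    thus ?thesis using q p by (auto simp: diff_op_def real_rooted_def)
  next
    case False
    hence "\<not> constant (poly q)" by (simp add: constant_degree)
    then obtain r where r: "poly q r = 0" using fundamental_theorem_of_algebra by blast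
    have rc: "Re r < 0" "k * \<bar>Im r\<bar> \<le> - Re r" using q(3)[OF r] by (auto simp: neg_sector_def)
    from r obtain q1 where q1: "q = [:-r, 1:] * q1" by (auto simp: poly_eq_0_iff_dvd)
    have q10: "q1 \<noteq> 0" using q q1 by auto
    show ?thesis
    proof (cases "Im r = 0")
      case True
      hence rr: "r = of_real (Re r)" by (simp add: complex_eq_iff)
      have *: "map_poly cnj [:-r, 1:] = [:-r, 1:]" using True by (simp add: map_poly_pCons complex_eq_iff)
      have "map_poly cnj q1 = q1" by (rule map_poly_cnj_cancel_left[OF _ *]) (use q(1) q1 in auto)
      moreover have "degree q1 < degree q" using q10 by (simp add: q1 degree_mult_eq del: mult_pCons_left)
      moreover have "r' \<in> neg_sector k" if "poly q1 r' = 0" for r' using q(3)[of r'] that by (simp add: q1)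
      moreover have "diff_op [:-r, 1:] p = pderiv p - smult (of_real (Re r)) p"
        by (subst (1) rr) (simp add: diff_op_pCons diff_op_def[of 1])
      moreover have "real_rooted (pderiv p - smult (of_real (Re r)) p)"
        using p rc by (intro real_rooted_linear_op) auto
      moreover have "degree (pderiv p - smult (of_real (Re r)) p) \<le> degree p"
        by (intro degree_diff_le) (auto simp: degree_pderiv)
      ultimately show ?thesis
        unfolding q1 diff_op_mult using less.hyps[of q1] q10 p
        by (metis (no_types, lifting) of_nat_mono order_trans q1)
    next
      case False
      \<comment> \<open>The conjugate of r is a root of q by realness, and differs from r, so it is
        still a root of the quotient \<open>q1\<close>.\<close>
      have "cnj (poly q r) = poly q (cnj r)" using poly_map_poly_cnj[of q "cnj r"] q(1) by simp
      hence "poly q1 (cnj r) = 0" using r False by (auto simp: q1 complex_eq_iff)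
      then obtain q2 where q2: "q1 = [:-cnj r, 1:] * q2" by (auto simp: poly_eq_0_iff_dvd)
      define w where "w = [:of_real ((cmod r)\<^sup>2), - (2 * of_real (Re r)), 1::complex:]"
      have "w = [:-r, 1:] * [:-cnj r, 1:]"
        by (simp add: w_def complex_eq_iff power2_eq_square flip: cmod_power2[unfolded power2_eq_square])
      hence qw: "q = w * q2" by (simp only: q1 q2 mult.assoc)
      have w0: "w \<noteq> 0" "degree w = 2" by (simp_all add: w_def)
      have q20: "q2 \<noteq> 0" using q10 q2 by auto
      have *: "map_poly cnj w = w" by (simp add: map_poly_pCons w_def)
      have "map_poly cnj q2 = q2" by (rule map_poly_cnj_cancel_left[OF _ *]) (use q(1) qw w0 in auto)
      moreover have "degree q2 < degree q" using q20 w0 by (simp add: qw degree_mult_eq)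
      moreover have "r' \<in> neg_sector k" if "poly q2 r' = 0" for r' using q(3)[of r'] that by (simp add: qw)
      moreover have "diff_op w p = pderiv (pderiv p) - smult (2 * of_real (Re r)) (pderiv p) + smult (of_real ((cmod r)\<^sup>2)) p"
        by (simp add: w_def diff_op_pCons diff_op_def[of 1])
      moreover have "real_rooted (pderiv (pderiv p) - smult (2 * of_real (Re r)) (pderiv p) + smult (of_real ((cmod r)\<^sup>2)) p)"
        using p rc assms(6) by (intro real_rooted_quadratic_op) auto
      moreover have "degree (pderiv (pderiv p) - smult (2 * of_real (Re r)) (pderiv p) + smult (of_real ((cmod r)\<^sup>2)) p) \<le> degree p"
        by (intro degree_add_le degree_diff_le) (auto simp: degree_pderiv intro: order_trans[OF degree_smult_le])
      ultimately show ?thesis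
        unfolding qw diff_op_mult using less.hyps[of q2] q20 p
        by (metis (no_types, lifting) of_nat_mono order_trans qw)
    qed
  qed
qed

text \<open>All v (z - x i) have positive real part, hence so do their reciprocals, whose sum is
  p'(z) / (v p(z)). The factor v encodes the direction of the half-plane.\<close>

lemma gauss_lucas_halfplane:
  assumes deg: "degree p > 0" and r: "\<And>r. poly p r = 0 \<Longrightarrow> Re (v * r) < Re (v * z)"
  shows "poly (pderiv p) z \<noteq> 0"
proof -
  have nz: "poly p z \<noteq> 0" using r[of z] by auto
  obtain x where x: "\<And>z. poly p z = lead_coeff p * (\<Prod>i<degree p. z - x i)"
    "poly (pderiv p) z = poly p z * (\<Sum>i<degree p. 1 / (z - x i))"
    using complex_poly_log_deriv[of p] nz by metis
  have *: "0 < Re (v * (z - x i))" if "i < degree p" for i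
  proof -
    have "poly p (x i) = 0" using x(1)[of "x i"] that by auto
    from r[OF this] show ?thesis by (simp add: algebra_simps)
  qed
  have v: "v \<noteq> 0" using *[of 0] deg by auto
  have "0 < (\<Sum>i<degree p. Re (1 / (v * (z - x i))))"
  proof (intro sum_pos)
    show "0 < Re (1 / (v * (z - x i)))" if "i \<in> {..<degree p}" for i
    proof -
      have "v * (z - x i) \<noteq> 0" "0 < Re (v * (z - x i))" using *[of i] that by force+
      hence "Re (v * (z - x i)) / (cmod (v * (z - x i)))\<^sup>2 > 0" by (simp only: zero_less_divide_iff) simp
      thus ?thesis by (simp add: Re_divide cmod_power2 del: times_complex.sel)
    qed
  qed (use deg in auto)
  also have "\<dots> = Re ((\<Sum>i<degree p. 1 / (z - x i)) / v)"
    by (simp add: sum_divide_distrib mult.commute)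
  finally show ?thesis using nz x(2) by auto
qed

text \<open>A point outside the sector violates one of its three linear inequalities, and the
  half-plane of that inequality contains all roots of p but not the point.\<close>

lemma neg_sector_pderiv:
  assumes k: "0 \<le> k" and p: "\<And>r. poly p r = 0 \<Longrightarrow> r \<in> neg_sector k" and d: "pderiv p \<noteq> 0" and z: "poly (pderiv p) z = 0"
  shows "z \<in> neg_sector k"
proof (rule ccontr)
  assume "z \<notin> neg_sector k"
  moreover have deg: "degree p > 0" using d by (auto simp: pderiv_eq_0_iff)
  ultimately consider "Re z \<ge> 0" | "- Re z < k * Im z" | "- Re z < k * (- Im z)"
    by (cases "Im z < 0") (auto simp: neg_sector_def not_le)
  then obtain v where "\<And>r. r \<in> neg_sector k \<Longrightarrow> Re (v * r) < Re (v * z)"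
  proof cases
    case 1
    thus thesis using that[of 1] by (auto simp: neg_sector_def)
  next
    case 2
    \<comment> \<open>Multiplication by 1 - i k reads off Re r + k Im r, which is at most 0 on the
      sector and positive at z; 1 + i k serves the other side.\<close>
    have "Re (Complex 1 (-k) * r) < Re (Complex 1 (-k) * z)" if r: "r \<in> neg_sector k" for r
    proof -
      have "k * Im r \<le> k * \<bar>Im r\<bar>" using k by (intro mult_left_mono) auto
      hence "Re r + k * Im r \<le> 0" using r by (auto simp: neg_sector_def)
      thus ?thesis using 2 by simp
    qed
    thus thesis using that by blast
  next
    case 3
    have "Re (Complex 1 k * r) < Re (Complex 1 k * z)" if r: "r \<in> neg_sector k" for r
    proof -
      have "k * (- Im r) \<le> k * \<bar>Im r\<bar>" using k by (intro mult_left_mono) auto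
      hence "Re r - k * Im r \<le> 0" using r by (auto simp: neg_sector_def)
      thus ?thesis using 3 by simp
    qed
    thus thesis using that by blast
  qed
  thus False using gauss_lucas_halfplane[OF deg, of v z] p z by blast
qed

lemma neg_sector_higher_pderiv:
  assumes k: "0 \<le> k" and p: "\<And>r. poly p r = 0 \<Longrightarrow> r \<in> neg_sector k" and d: "(pderiv ^^ n) p \<noteq> 0" and z: "poly ((pderiv ^^ n) p) z = 0"
  shows "z \<in> neg_sector k"
  using d z
proof (induction n arbitrary: z)
  case (Suc n)
  have "(pderiv ^^ n) p \<noteq> 0" using Suc.prems by auto
  thus ?case using Suc neg_sector_pderiv[OF k, of "(pderiv ^^ n) p"] by auto
qed (use p in auto)

text \<open>Each factor satisfies |z - x i| >= |Im z| because x i is real. Using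
  \<open>coeff p d\<close> in place of the leading coefficient makes both sides continuous in the
  coefficients, so the inequality survives limits in which the degree may vary.\<close>

lemma real_rooted_lower_bound:
  assumes p: "real_rooted p" "degree p \<le> d"
  shows "cmod (coeff p d) * \<bar>Im z\<bar> ^ d \<le> cmod (poly p z)"
proof (cases "degree p = d")
  case True
  obtain x where x: "\<And>z. poly p z = lead_coeff p * (\<Prod>i<degree p. z - x i)"
    using complex_poly_log_deriv[of p] by metis
  have "\<bar>Im z\<bar> ^ d \<le> (\<Prod>i<d. cmod (z - x i))"
  proof -
    have "\<bar>Im z\<bar> ^ d = (\<Prod>i<d. \<bar>Im z\<bar>)" by simp
    also have "\<dots> \<le> (\<Prod>i<d. cmod (z - x i))"
    proof (intro prod_mono conjI)
      fix i assume "i \<in> {..<d}"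
      hence "poly p (x i) = 0" using x[of "x i"] True by auto
      hence "Im (x i) = 0" using p by (auto simp: real_rooted_def complex_is_Real_iff)
      thus "\<bar>Im z\<bar> \<le> cmod (z - x i)" using abs_Im_le_cmod[of "z - x i"] by simp
    qed auto
    finally show ?thesis .
  qed
  thus ?thesis unfolding x[of z] norm_mult using True by (auto simp: prod_norm intro!: mult_left_mono)
next
  case False
  hence "coeff p d = 0" using p by (intro coeff_eq_0) auto
  thus ?thesis by simp
qed

lemma poly_eq_sum_atMost:
  fixes p :: "complex poly"
  assumes "degree p \<le> d"
  shows "poly p z = (\<Sum>i\<le>d. coeff p i * z ^ i)"
proof -
  have "(\<Sum>i\<le>degree p. coeff p i * z ^ i) = (\<Sum>i\<le>d. coeff p i * z ^ i)"
    by (intro sum.mono_neutral_left) (use assms in \<open>auto simp: coeff_eq_0\<close>)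
  thus ?thesis by (simp add: poly_altdef)
qed

text \<open>The lower bound passes to the limit and, at a zero of Q, forces Im z = 0; the nonzero
  coefficient of degree d keeps it from degenerating.\<close>

lemma real_rooted_limit:
  fixes P :: "nat \<Rightarrow> complex poly"
  assumes P: "eventually (\<lambda>N. real_rooted (P N) \<and> degree (P N) \<le> d) sequentially"
    and lim: "\<And>i. i \<le> d \<Longrightarrow> (\<lambda>N. coeff (P N) i) \<longlonglongrightarrow> coeff Q i"
    and Q: "degree Q \<le> d" "coeff Q d \<noteq> 0"
  shows "real_rooted Q"
proof -
  have "z \<in> \<real>" if z: "poly Q z = 0" for z
  proof -
    have ev: "eventually (\<lambda>N. cmod (coeff (P N) d) * \<bar>Im z\<bar> ^ d \<le> cmod (\<Sum>i\<le>d. coeff (P N) i * z ^ i)) sequentially"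
      using P by eventually_elim (use real_rooted_lower_bound poly_eq_sum_atMost in metis)
    have "(\<lambda>N. cmod (coeff (P N) d) * \<bar>Im z\<bar> ^ d) \<longlonglongrightarrow> cmod (coeff Q d) * \<bar>Im z\<bar> ^ d"
      by (intro tendsto_intros lim) auto
    moreover have "(\<lambda>N. cmod (\<Sum>i\<le>d. coeff (P N) i * z ^ i)) \<longlonglongrightarrow> cmod (\<Sum>i\<le>d. coeff Q i * z ^ i)"
      by (intro tendsto_intros lim) auto
    ultimately have "cmod (coeff Q d) * \<bar>Im z\<bar> ^ d \<le> cmod (\<Sum>i\<le>d. coeff Q i * z ^ i)"
      by (rule tendsto_le[OF sequentially_bot _ _ ev, rotated])
    also have "(\<Sum>i\<le>d. coeff Q i * z ^ i) = 0" using z poly_eq_sum_atMost[OF Q(1), of z] by simp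
    finally have "\<bar>Im z\<bar> ^ d \<le> 0" using Q(2) by (simp add: mult_le_0_iff)
    hence "Im z = 0" using zero_less_power[of "\<bar>Im z\<bar>" d] by linarith
    thus ?thesis by (simp add: complex_is_Real_iff)
  qed
  moreover have "Q \<noteq> 0" using Q by auto
  ultimately show ?thesis by (auto simp: real_rooted_def)
qed

text \<open>Up to the order of its coefficients, the polynomial below is the Jensen polynomial of degree
  \<open>d\<close> and shift \<open>n\<close> of \<open>\<Sum>a\<^sub>j x\<^sup>j\<close>.\<close>
theorem real_rooted_reversed_jensen:
  fixes P :: "nat \<Rightarrow> complex poly"
  assumes real: "\<And>N. map_poly cnj (P N) = P N"
    and cone: "\<And>N r. poly (P N) r = 0 \<Longrightarrow> r \<in> neg_sector k"
    and lim: "\<And>j. (\<lambda>N. coeff (P N) j) \<longlonglongrightarrow> a j"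
    and an: "a n \<noteq> 0" and k: "real d \<le> k\<^sup>2" "0 \<le> k"
  shows "real_rooted (\<Sum>j\<le>d. monom (of_nat (d choose j) * (fact (n + j) * a (n + j))) (d - j))"
proof -
  define q where "q N = (pderiv ^^ n) (P N)" for N
  define Q where "Q N = diff_op (q N) (monom 1 d)" for N
  define L where "L = (\<Sum>j\<le>d. monom (of_nat (d choose j) * (fact (n + j) * a (n + j))) (d - j))"
  \<comment> \<open>The denominator i! cancels below against D^i x^d = i! (d choose i) x^(d - i),
    which leaves exactly the Jensen coefficients.\<close>
  have cq: "coeff (q N) i = fact (n + i) / fact i * coeff (P N) (n + i)" for N i
  proof -
    have "fact (n + i) = (fact i * pochhammer (of_nat (Suc i)) n :: complex)"
      using pochhammer_product[of i "i + n" "1::complex"] by (simp add: pochhammer_fact add.commute)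
    thus ?thesis unfolding q_def coeff_higher_pderiv by (simp add: add.commute)
  qed
  have Q: "Q N = (\<Sum>j\<le>d. monom (of_nat (d choose j) * (fact (n + j) * coeff (P N) (n + j))) (d - j))" for N
  proof -
    have "Q N = (\<Sum>i\<le>max d (degree (q N)). smult (coeff (q N) i) ((pderiv ^^ i) (monom 1 d)))"
      unfolding Q_def by (intro diff_op_altdef) auto
    also have "\<dots> = (\<Sum>i\<le>d. smult (coeff (q N) i) ((pderiv ^^ i) (monom 1 d)))"
      by (intro sum.mono_neutral_right) (auto simp: poly_eq_iff coeff_higher_pderiv)
    also have "\<dots> = (\<Sum>j\<le>d. monom (of_nat (d choose j) * (fact (n + j) * coeff (P N) (n + j))) (d - j))"
    proof (intro sum.cong refl)
      fix i assume "i \<in> {..d}"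
      hence i: "i \<le> d" by simp
      have "pochhammer (of_nat (Suc (d - i))) i = (fact d / fact (d - i) :: complex)"
        using i pochhammer_product[of "d - i" d "1::complex"]
        by (simp add: of_nat_diff add.commute nonzero_eq_divide_eq mult.commute flip: pochhammer_fact)
      hence "(pderiv ^^ i) (monom 1 d) = monom (fact d / fact (d - i) :: complex) (d - i)"
        using i by (intro poly_eqI) (auto simp: coeff_higher_pderiv)
      moreover have "of_nat (d choose i) = (fact d / (fact i * fact (d - i)) :: complex)"
        using binomial_fact i by blast
      ultimately show "smult (coeff (q N) i) ((pderiv ^^ i) (monom 1 d)) =
        monom (of_nat (d choose i) * (fact (n + i) * coeff (P N) (n + i))) (d - i)"
        by (simp add: smult_monom cq)
    qed
    finally show ?thesis .
  qed
  have cs: "coeff (\<Sum>j\<le>d. monom (b j) (d - j)) i = b (d - i)" if "i \<le> d" for b :: "nat \<Rightarrow> complex" and i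
  proof -
    have "coeff (\<Sum>j\<le>d. monom (b j) (d - j)) i = (\<Sum>j\<le>d. if j = d - i then b j else 0)"
      unfolding coeff_sum using that by (intro sum.cong) auto
    thus ?thesis by simp
  qed
  have deg: "degree (\<Sum>j\<le>d. monom (b j) (d - j)) \<le> d" for b :: "nat \<Rightarrow> complex"
    by (intro degree_sum_le) (auto intro: order_trans[OF degree_monom_le])
  have "real_rooted L"
  proof (rule real_rooted_limit[of Q d])
    \<comment> \<open>As a n is nonzero, the n-th derivative of P N eventually has nonzero constant
      term; in particular it is not the zero polynomial.\<close>
    have "(\<lambda>N. coeff (q N) 0) \<longlonglongrightarrow> fact n * a n"
      unfolding cq using lim[of n] by (auto intro!: tendsto_intros)
    hence "eventually (\<lambda>N. coeff (q N) 0 \<noteq> 0) sequentially"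
      by (rule tendsto_imp_eventually_ne) (use an in auto)
    thus "\<forall>\<^sub>F N in sequentially. real_rooted (Q N) \<and> degree (Q N) \<le> d"
    proof eventually_elim
      case (elim N)
      hence q0: "q N \<noteq> 0" by auto
      have "real_rooted (Q N)" unfolding Q_def
      proof (rule diff_op_real_rooted)
        show "map_poly cnj (q N) = q N" by (simp add: q_def map_poly_cnj_higher_pderiv real)
        show "r \<in> neg_sector k" if "poly (q N) r = 0" for r
          using neg_sector_higher_pderiv[of k "P N" n r] k(2) cone[of N] q0 that by (auto simp: q_def)
        show "real_rooted (monom 1 d)" by (auto simp: real_rooted_def poly_monom)
      qed (use q0 k in \<open>auto simp: degree_monom_eq\<close>)
      thus ?case using deg by (simp add: Q)
    qed
    show "(\<lambda>N. coeff (Q N) i) \<longlonglongrightarrow> coeff L i" if "i \<le> d" for i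
      unfolding Q L_def cs[OF that] by (intro tendsto_intros lim)
    show "degree L \<le> d" unfolding L_def by (rule deg)
    show "coeff L d \<noteq> 0" unfolding L_def by (subst cs) (use an in auto)
  qed
  thus ?thesis by (simp add: L_def)
qed

section \<open>Polynomial approximation of entire functions of order less than one\<close>

lemma entire_power_series:
  fixes b :: "nat \<Rightarrow> complex"
  assumes "\<And>z. (\<lambda>j. b j * z ^ j) sums f z"
  shows "f holomorphic_on A"
proof -
  have "f field_differentiable at z within A" for z
  proof -
    have "f holomorphic_on ball 0 (cmod z + 1)" by (rule power_series_holomorphic[of _ _ b]) (use assms in simp)
    hence "f field_differentiable at z" by (rule holomorphic_on_imp_differentiable_at) auto
    thus ?thesis by (rule field_differentiable_at_within)
  qed
  thus ?thesis by (simp add: holomorphic_on_def)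
qed

lemma power_series_coeff_bound:
  fixes b :: "nat \<Rightarrow> complex"
  assumes "\<And>z. (\<lambda>j. b j * z ^ j) sums f z" and "\<And>z. cmod z = 1 \<Longrightarrow> cmod (f z) \<le> B"
  shows "cmod (b n) \<le> B"
proof -
  have "f has_fps_expansion Abs_fps b" by (rule has_fps_expansionI) (use assms in simp)
  hence bn: "b n = (deriv ^^ n) f 0 / fact n" using fps_nth_fps_expansion by fastforce
  have hol: "f holomorphic_on A" for A using assms(1) by (rule entire_power_series)
  have "norm ((deriv ^^ n) f 0) \<le> fact n * B / 1 ^ n"
    by (rule Cauchy_inequality) (use assms(2) in \<open>auto intro!: hol holomorphic_on_imp_continuous_on\<close>)
  thus ?thesis by (simp add: bn norm_divide field_simps)
qed

text \<open>Away from the finitely many zeros of p this is division; at the zeros it follows by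
  continuity.\<close>

lemma mult_poly_cancel:
  fixes g h :: "complex \<Rightarrow> complex"
  assumes p: "p \<noteq> 0" and g: "continuous_on UNIV g" "continuous_on UNIV h"
    and eq: "\<And>z. poly p z * g z = poly p z * h z"
  shows "g z = h z"
proof -
  have "finite {z. poly p z = 0}" using p by (rule poly_roots_finite)
  hence "eventually (\<lambda>w. poly p w \<noteq> 0) (at z)"
    using islimpt_finite[of "{z. poly p z = 0}" z] by (simp add: islimpt_conv_frequently_at frequently_def)
  hence ev: "eventually (\<lambda>w. g w - h w = 0) (at z)" by eventually_elim (use eq in auto)
  have "((\<lambda>w. g w - h w) \<longlongrightarrow> g z - h z) (at z)"
    using g by (intro tendsto_intros) (auto simp: continuous_on_def)
  moreover have "((\<lambda>w. g w - h w) \<longlongrightarrow> 0) (at z)" using ev by (rule tendsto_eventually)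
  ultimately have "g z - h z = 0" by (intro LIM_unique)
  thus ?thesis by simp
qed

lemma entire_divide_zero:
  assumes "G holomorphic_on UNIV" "G a = 0"
  obtains G1 where "G1 holomorphic_on UNIV" "\<And>z. G z = (z - a) * G1 z"
proof -
  have "(\<lambda>z. if z = a then deriv G a else (G z - G a) / (z - a)) holomorphic_on UNIV"
    by (rule pole_lemma_open) (use assms in auto)
  thus ?thesis by (rule that) (use assms in auto)
qed

text \<open>A real polynomial p collecting some zeros of F in the disc of radius R, with entire
  cofactor G. The normalisation p(0) = 1 means p = prod (1 - z / r), the form in which p can
  approximate F / F(0).\<close>

definition poly_factor :: "(complex \<Rightarrow> complex) \<Rightarrow> real \<Rightarrow> complex poly \<Rightarrow> (complex \<Rightarrow> complex) \<Rightarrow> bool" where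
  "poly_factor F R p G \<longleftrightarrow> poly p 0 = 1 \<and> map_poly cnj p = p \<and> (\<forall>r. poly p r = 0 \<longrightarrow> cmod r \<le> R \<and> F r = 0) \<and>
     G holomorphic_on UNIV \<and> (\<forall>z. F z = poly p z * G z)"

text \<open>For a zero x i of modulus at most R and |z| = 3 R one has |z - x i| >= 2 R >= 2 |x i|,
  and |lead coefficient| times the product of all |x i| is |p(0)| = 1.\<close>

lemma poly_factor_lower_bound:
  assumes "poly_factor F R p G" "cmod z = 3 * R"
  shows "2 ^ degree p \<le> cmod (poly p z)"
proof -
  obtain x where x: "\<And>z. poly p z = lead_coeff p * (\<Prod>i<degree p. z - x i)"
    using complex_poly_log_deriv[of p] by metis
  have "cmod (lead_coeff p) * (\<Prod>i<degree p. cmod (x i)) = cmod (poly p 0)"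
    unfolding x by (simp add: norm_mult prod_norm [symmetric])
  hence 1: "cmod (lead_coeff p) * (\<Prod>i<degree p. cmod (x i)) = 1" using assms by (simp add: poly_factor_def)
  have "2 ^ degree p = (cmod (lead_coeff p) * (\<Prod>i<degree p. cmod (x i))) * (\<Prod>i<degree p. 2)"
    unfolding 1 by simp
  also have "\<dots> = cmod (lead_coeff p) * (\<Prod>i<degree p. 2 * cmod (x i))"
    by (simp add: prod.distrib)
  also have "\<dots> \<le> cmod (lead_coeff p) * (\<Prod>i<degree p. cmod (z - x i))"
  proof (intro mult_left_mono prod_mono conjI)
    fix i assume "i \<in> {..<degree p}"
    hence "poly p (x i) = 0" using x[of "x i"] by auto
    hence "cmod (x i) \<le> R" using assms by (auto simp: poly_factor_def)
    thus "2 * cmod (x i) \<le> cmod (z - x i)" using norm_triangle_ineq2[of z "x i"] assms by linarith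
  qed auto
  also have "\<dots> = cmod (poly p z)" unfolding x by (simp add: norm_mult prod_norm)
  finally show ?thesis .
qed

lemma poly_factor_cofactor_bound:
  assumes pf: "poly_factor F R p G" and R: "R > 0" and B: "\<And>z. cmod z = 3 * R \<Longrightarrow> cmod (F z) \<le> B"
    and z: "cmod z \<le> 3 * R"
  shows "cmod (G z) \<le> B / 2 ^ degree p"
proof (rule maximum_modulus_frontier[of G "cball 0 (3 * R)"])
  show "G holomorphic_on interior (cball 0 (3 * R))"
    using pf holomorphic_on_subset by (auto simp: poly_factor_def)
  show "continuous_on (closure (cball 0 (3 * R))) G"
    using pf by (auto simp: poly_factor_def intro!: holomorphic_on_imp_continuous_on intro: holomorphic_on_subset)
  fix w assume "w \<in> frontier (cball (0::complex) (3 * R))"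
  hence w: "cmod w = 3 * R" using R by (simp add: dist_norm)
  have "2 ^ degree p * cmod (G w) \<le> cmod (poly p w) * cmod (G w)"
    using poly_factor_lower_bound[OF pf w] by (intro mult_right_mono) auto
  also have "\<dots> = cmod (F w)" using pf by (simp add: poly_factor_def norm_mult)
  also have "\<dots> \<le> B" using w by (rule B)
  finally show "cmod (G w) \<le> B / 2 ^ degree p" by (simp add: field_simps)
qed (use z in auto)

text \<open>Evaluating the cofactor bound at 0 gives 2^(degree p) <= B / |F 0|, a crude form of
  Jensen's zero count, so a factor of maximal degree exists. A zero of its cofactor in the disc
  could be moved into p, alone if real and with its conjugate otherwise.\<close>

lemma ex_poly_factor_nonvanishing:
  assumes F: "F holomorphic_on UNIV" "F 0 \<noteq> 0" "\<And>z. F (cnj z) = cnj (F z)" and R: "R > 0"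
    and B: "\<And>z. cmod z = 3 * R \<Longrightarrow> cmod (F z) \<le> B"
  obtains p G where "poly_factor F R p G" "\<And>z. cmod z \<le> R \<Longrightarrow> G z \<noteq> 0"
proof -
  define Q where "Q n \<longleftrightarrow> (\<exists>p G. poly_factor F R p G \<and> degree p = n)" for n
  have G0: "G 0 = F 0" if "poly_factor F R p G" for p G using that by (simp add: poly_factor_def)
  have bound: "n \<le> nat \<lceil>B / cmod (F 0)\<rceil>" if "Q n" for n
  proof -
    from that obtain p G where pG: "poly_factor F R p G" "degree p = n" by (auto simp: Q_def)
    have "cmod (G 0) \<le> B / 2 ^ degree p" by (rule poly_factor_cofactor_bound[OF pG(1) R B]) (use R in auto)
    hence "2 ^ n \<le> B / cmod (F 0)" using F(2) G0[OF pG(1)] pG(2) by (simp add: field_simps)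
    moreover have "real n \<le> 2 ^ n" by (rule of_nat_less_two_power[THEN less_imp_le])
    ultimately show ?thesis by linarith
  qed
  have "poly_factor F R 1 F" using F by (auto simp: poly_factor_def)
  hence "Q 0" by (auto simp: Q_def intro!: exI[of _ 1])
  hence "Q (Greatest Q)" and max: "\<And>n. Q n \<Longrightarrow> n \<le> Greatest Q"
    using GreatestI_nat[of Q 0] Greatest_le_nat[of Q] bound by blast+
  then obtain p G where pG: "poly_factor F R p G" and deg: "degree p = Greatest Q" by (auto simp: Q_def)
  have p: "poly p 0 = 1" "map_poly cnj p = p" "\<And>r. poly p r = 0 \<Longrightarrow> cmod r \<le> R \<and> F r = 0"
    and G: "G holomorphic_on UNIV" "\<And>z. F z = poly p z * G z" using pG by (auto simp: poly_factor_def)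
  have p0: "p \<noteq> 0" using p by auto
  have cG: "continuous_on A G" for A using G holomorphic_on_imp_continuous_on continuous_on_subset by blast
  have "G z \<noteq> 0" if z: "cmod z \<le> R" for z
  proof
    assume Gz: "G z = 0"
    have z0: "z \<noteq> 0" using Gz G0[OF pG] F by auto
    have Fz: "F z = 0" "F (cnj z) = 0" using Gz G F(3) by auto
    obtain G1 where G1: "G1 holomorphic_on UNIV" "\<And>w. G w = (w - z) * G1 w"
      using entire_divide_zero[OF G(1) Gz] by blast
    show False
    proof (cases "cnj z = z")
      case True
      have "poly_factor F R (p * [:1, -1/z:]) (\<lambda>w. - z * G1 w)"
        unfolding poly_factor_def
      proof (intro conjI allI impI)
        show "map_poly cnj (p * [:1, - 1 / z:]) = p * [:1, - 1 / z:]"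
          using True p by (simp only: map_poly_cnj_mult) (simp add: map_poly_pCons)
        show "(\<lambda>w. - z * G1 w) holomorphic_on UNIV" using G1 by (intro holomorphic_intros)
        fix r assume "poly (p * [:1, - 1 / z:]) r = 0"
        hence "poly p r = 0 \<or> r = z" using z0 by (auto simp: field_simps)
        thus "cmod r \<le> R" "F r = 0" using p(3) Fz z by auto
      next
        fix w
        have "poly [:1, -1/z:] w * - z = w - z" using z0 by (simp add: field_simps)
        thus "F w = poly (p * [:1, - 1 / z:]) w * (- z * G1 w)" using G G1
          by (simp only: poly_mult mult.assoc) (simp only: mult.assoc [symmetric])
      qed (use p in auto)
      hence "Q (degree (p * [:1, -1/z:]))" by (auto simp: Q_def)
      moreover have "degree (p * [:1, -1/z:]) = degree p + 1"
        using p0 z0 by (subst degree_mult_eq) auto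
      ultimately show False using max deg by fastforce
    next
      case False
      \<comment> \<open>F and p commute with conjugation, hence so does the cofactor, and the
        conjugate of z is a zero of G as well.\<close>
      have "cnj (G (cnj w)) = G w" for w
      proof (rule mult_poly_cancel[OF p0, of "\<lambda>w. cnj (G (cnj w))" G])
        show "continuous_on UNIV (\<lambda>w. cnj (G (cnj w)))"
          by (rule continuous_on_cnj, rule continuous_on_compose2[OF cG[of UNIV]]) (auto intro: continuous_intros)
        show "poly p w * cnj (G (cnj w)) = poly p w * G w" for w
        proof -
          have "cnj (poly p (cnj w)) = poly p w" using poly_map_poly_cnj[of p w] p(2) by simp
          hence "poly p w * cnj (G (cnj w)) = cnj (F (cnj w))" using G(2)[of "cnj w"] by simp
          also have "\<dots> = F w" by (simp add: F)
          finally show ?thesis using G by simp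
        qed
      qed (rule cG)
      from this[of "cnj z"] Gz have "G (cnj z) = 0" by (metis complex_cnj_cnj complex_cnj_zero_iff)
      hence "G1 (cnj z) = 0" using G1 False by simp
      then obtain G2 where G2: "G2 holomorphic_on UNIV" "\<And>w. G1 w = (w - cnj z) * G2 w"
        using entire_divide_zero[OF G1(1)] by blast
      define q where "q = [:1, -1/z:] * [:1, -1/cnj z:]"
      have "poly_factor F R (p * q) (\<lambda>w. z * cnj z * G2 w)"
        unfolding poly_factor_def
      proof (intro conjI allI impI)
        show "map_poly cnj (p * q) = p * q"
          using p by (simp only: map_poly_cnj_mult q_def) (simp add: map_poly_pCons mult.commute)
        show "(\<lambda>w. z * cnj z * G2 w) holomorphic_on UNIV" using G2 by (intro holomorphic_intros)
        fix r assume "poly (p * q) r = 0"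
        hence "poly p r = 0 \<or> poly [:1, -1/z:] r = 0 \<or> poly [:1, -1/cnj z:] r = 0"
          unfolding q_def poly_mult mult_eq_0_iff by blast
        hence "poly p r = 0 \<or> r = z \<or> r = cnj z" using z0 by auto
        thus "cmod r \<le> R" "F r = 0" using p(3) Fz z by auto
      next
        fix w
        have "poly q w * (z * cnj z) = (w - z) * (w - cnj z)" using z0 by (simp add: q_def field_simps)
        thus "F w = poly (p * q) w * (z * cnj z * G2 w)" using G G1 G2 by (simp add: mult_ac)
      qed (use p in \<open>auto simp: q_def\<close>)
      hence "Q (degree (p * q))" by (auto simp: Q_def)
      moreover have "degree (p * q) = degree p + 2"
      proof -
        have "degree q = 2" "q \<noteq> 0" using z0 by (simp_all add: q_def)
        thus ?thesis using p0 by (simp add: degree_mult_eq)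
      qed
      ultimately show False using max deg by fastforce
    qed
  qed
  thus ?thesis using that pG by blast
qed

text \<open>The map u / (2 L - u) sends the half-plane Re u < L into the unit disc and fixes 0, so
  Schwarz's lemma applies after rescaling.\<close>

lemma borel_caratheodory:
  assumes h: "h holomorphic_on ball 0 R" "h 0 = 0" "\<And>z. cmod z < R \<Longrightarrow> Re (h z) < L" and z: "cmod z < R"
  shows "cmod (h z) * (R - cmod z) \<le> 2 * L * cmod z"
proof -
  have R: "R > 0" using z by (smt (verit) norm_ge_zero)
  have L: "L > 0" using h(3)[of 0] h(2) R by simp
  define \<phi> where "\<phi> w = h (of_real R * w) / (2 * of_real L - h (of_real R * w))" for w
  have in_ball: "cmod (of_real R * w) < R" if "cmod w < 1" for w :: complex
    using that R by (simp add: norm_mult)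
  have ne: "2 * of_real L - h (of_real R * w) \<noteq> 0" if "cmod w < 1" for w
  proof
    assume "2 * of_real L - h (of_real R * w) = 0"
    hence "Re (h (of_real R * w)) = 2 * L" by (metis Re_complex_of_real eq_iff_diff_eq_0 of_real_mult of_real_numeral)
    thus False using h(3)[OF in_ball[OF that]] L by simp
  qed
  have "cmod (\<phi> (z / of_real R)) \<le> cmod (z / of_real R)"
  proof (rule Schwarz_Lemma(1))
    show "\<phi> holomorphic_on ball 0 1" unfolding \<phi>_def
      by (intro holomorphic_intros holomorphic_on_compose_gen[OF _ h(1), unfolded o_def])
        (use ne in_ball in auto)
    show "\<phi> 0 = 0" by (simp add: \<phi>_def h)
    show "cmod (\<phi> w) < 1" if w: "cmod w < 1" for w
    proof -
      let ?u = "h (of_real R * w)"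
      have "(cmod ?u)\<^sup>2 < (cmod (2 * of_real L - ?u))\<^sup>2"
      proof -
        have "(cmod (2 * of_real L - ?u))\<^sup>2 - (cmod ?u)\<^sup>2 = 4 * L * (L - Re ?u)"
          unfolding cmod_power2 by (simp add: power2_eq_square algebra_simps)
        also have "\<dots> > 0" using h(3)[OF in_ball[OF w]] L by simp
        finally show ?thesis by simp
      qed
      hence "cmod ?u < cmod (2 * of_real L - ?u)" by (rule power_less_imp_less_base) auto
      thus ?thesis using ne[OF w] by (simp add: \<phi>_def norm_divide)
    qed
    show "cmod (z / of_real R) < 1" using z R by (simp add: norm_divide)
  qed
  moreover have "cmod (z / of_real R) < 1" using z R by (simp add: norm_divide)
  ultimately have "cmod (h z) \<le> cmod z / R * cmod (2 * of_real L - h z)"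
    using ne[of "z / of_real R"] R by (simp add: \<phi>_def norm_divide field_simps)
  also have "\<dots> \<le> cmod z / R * (2 * L + cmod (h z))"
    using norm_triangle_ineq4[of "2 * of_real L" "h z"] L R by (intro mult_left_mono) (auto simp: norm_mult)
  finally show ?thesis using R by (simp add: field_simps)
qed

text \<open>With all zeros in the disc of radius N + 1 divided out, the cofactor is F(0) exp h
  there, and Re h is at most about 3 eps N. Borel-Caratheodory at |z| = 1 then makes h small, so P N
  tends to F / F(0) on the unit circle, and Cauchy's estimate transfers this to
  coefficients.\<close>

theorem polynomial_approximation_of_entire:
  fixes F :: "complex \<Rightarrow> complex"
  assumes ser: "\<And>z. (\<lambda>j. a j * z ^ j) sums F z" and a0: "a 0 \<noteq> 0" and real: "\<And>j. a j \<in> \<real>"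
    and growth: "\<And>\<epsilon>. \<epsilon> > 0 \<Longrightarrow> \<exists>C. \<forall>z. cmod (F z) \<le> C * exp (\<epsilon> * cmod z)"
  obtains P :: "nat \<Rightarrow> complex poly"
    where "\<And>N. map_poly cnj (P N) = P N" "\<And>N r. poly (P N) r = 0 \<Longrightarrow> F r = 0"
      "\<And>j. (\<lambda>N. coeff (P N) j) \<longlonglongrightarrow> a j / a 0"
proof -
  have F0: "F 0 = a 0" using ser[of 0] by (metis powser_sums_zero_iff)
  have hol: "F holomorphic_on UNIV" using ser by (rule entire_power_series)
  have sym: "F (cnj z) = cnj (F z)" for z
  proof -
    have "(\<lambda>j. cnj (a j * z ^ j)) sums cnj (F z)" using ser[of z] by (simp only: sums_cnj)
    hence "(\<lambda>j. cnj (a j) * cnj z ^ j) sums cnj (F z)" by simp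
    moreover have "cnj (a j) = a j" for j using real[of j] Reals_cnj_iff by blast
    ultimately have "(\<lambda>j. a j * cnj z ^ j) sums cnj (F z)" by simp
    with ser[of "cnj z"] show ?thesis by (rule sums_unique2)
  qed
  have "\<exists>p G. poly_factor F (real N + 1) p G \<and> (\<forall>z. cmod z \<le> real N + 1 \<longrightarrow> G z \<noteq> 0)" for N
  proof -
    obtain C where C: "\<And>z. cmod (F z) \<le> C * exp (1 * cmod z)" using growth[of 1] by auto
    have B: "cmod (F z) \<le> C * exp (3 * (real N + 1))" if "cmod z = 3 * (real N + 1)" for z
      using C[of z] that by simp
    have F00: "F 0 \<noteq> 0" using F0 a0 by simp
    have R: "real N + 1 > 0" by simp
    obtain p G where "poly_factor F (real N + 1) p G" "\<And>z. cmod z \<le> real N + 1 \<Longrightarrow> G z \<noteq> 0"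
      using ex_poly_factor_nonvanishing[OF hol F00 sym R B] by blast
    thus ?thesis by blast
  qed
  then obtain P G where PG: "\<And>N. poly_factor F (real N + 1) (P N) (G N)"
    and G: "\<And>N z. cmod z \<le> real N + 1 \<Longrightarrow> G N z \<noteq> 0" by metis
  have P: "map_poly cnj (P N) = P N" "poly (P N) r = 0 \<Longrightarrow> F r = 0" "F z = poly (P N) z * G N z"
    and Ghol: "G N holomorphic_on UNIV" for N r z using PG[of N] by (auto simp: poly_factor_def)
  have G0: "G N 0 = F 0" for N using PG[of N] by (simp add: poly_factor_def)
  obtain K where K: "\<And>z. cmod z \<le> 1 \<Longrightarrow> cmod (F z / F 0) \<le> K" "K > 0"
  proof -
    have "compact ((\<lambda>z. F z / F 0) ` cball 0 1)"
      using hol by (intro compact_continuous_image continuous_intros holomorphic_on_imp_continuous_on)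
        (auto intro: holomorphic_on_subset simp: F0 a0)
    hence "bounded ((\<lambda>z. F z / F 0) ` cball 0 1)" by (rule compact_imp_bounded)
    then obtain b where b: "b > 0" "\<forall>x\<in>cball 0 1. cmod (F x / F 0) \<le> b" unfolding bounded_pos by blast
    show thesis by (rule that[of b]) (use b in auto)
  qed
  have "(\<lambda>N. coeff (P N) j) \<longlonglongrightarrow> a j / a 0" for j
  proof (rule LIMSEQ_I)
    fix \<delta> :: real assume \<delta>: "\<delta> > 0"
    \<comment> \<open>The bound 1/2 is the range of the estimate for exp (- h) - 1; the other one
      makes the final error 2 K \<eta> at most \<delta> / 2.\<close>
    define \<eta> where "\<eta> = min (1/2) (\<delta> / (4 * K))"
    have \<eta>: "\<eta> > 0" "\<eta> \<le> 1/2" "K * (2 * \<eta>) < \<delta>" using \<delta> K(2) by (auto simp: \<eta>_def min_def field_simps)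
    \<comment> \<open>The bound L N on Re h grows like 3 \<epsilon> N, so 2 L N grows like \<eta> N
      / 2 and is eventually below \<eta> N. The final + 1 in L N makes the bound strict.\<close>
    define \<epsilon> where "\<epsilon> = \<eta> / 12"
    obtain C where C: "\<And>z. cmod (F z) \<le> C * exp (\<epsilon> * cmod z)" using growth[of \<epsilon>] \<eta> by (auto simp: \<epsilon>_def)
    have "cmod (F 0) > 0" using F0 a0 by simp
    moreover have "cmod (F 0) \<le> C" using C[of 0] by simp
    ultimately have Cpos: "C > 0" by linarith
    define L where "L N = ln C + 3 * \<epsilon> * (real N + 1) - ln (cmod (F 0)) + 1" for N
    have "eventually (\<lambda>N. 2 * L N \<le> \<eta> * real N) sequentially"
      unfolding L_def \<epsilon>_def using \<eta>(1) by real_asymp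
    hence "eventually (\<lambda>N. 2 * L N \<le> \<eta> * real N \<and> N \<ge> 1) sequentially"
      using eventually_ge_at_top by (rule eventually_conj)
    then obtain N0 where N0: "\<And>N. N \<ge> N0 \<Longrightarrow> 2 * L N \<le> \<eta> * real N \<and> N \<ge> 1"
      by (auto simp: eventually_sequentially)
    have "norm (coeff (P N) j - a j / a 0) < \<delta>" if N: "N \<ge> N0" for N
    proof -
      have N1: "real N > 0" using N0[OF N] by simp
      obtain g where g: "g holomorphic_on ball 0 (real N + 1)" "\<And>z. z \<in> ball 0 (real N + 1) \<Longrightarrow> exp (g z) = G N z"
        by (rule holomorphic_logarithm_exists[of "ball 0 (real N + 1)" "G N" 0])
          (use G holomorphic_on_subset[OF Ghol] in auto)
      define h where "h z = g z - g 0" for z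
      have eh: "exp (h z) = G N z / F 0" if "cmod z < real N + 1" for z
        using g(2)[of z] g(2)[of 0] that by (simp add: h_def exp_diff G0)
      have "Re (h z) < L N" if z: "cmod z < real N + 1" for z
      proof -
        have "cmod (G N z) \<le> C * exp (\<epsilon> * (3 * (real N + 1))) / 2 ^ degree (P N)"
        proof (rule poly_factor_cofactor_bound[OF PG])
          show "cmod (F w) \<le> C * exp (\<epsilon> * (3 * (real N + 1)))" if "cmod w = 3 * (real N + 1)" for w
            using C[of w] that by simp
        qed (use z in auto)
        also have "\<dots> \<le> C * exp (\<epsilon> * (3 * (real N + 1)))"
          using Cpos by (simp add: divide_le_eq mult_le_cancel_left)
        finally have "exp (Re (h z)) \<le> C * exp (\<epsilon> * (3 * (real N + 1))) / cmod (F 0)"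
          using eh[OF z] by (simp add: norm_divide divide_right_mono flip: norm_exp_eq_Re)
        also have "\<dots> = exp (L N - 1)"
          using Cpos F0 a0 by (simp add: L_def exp_add exp_diff field_simps)
        finally show ?thesis by simp
      qed
      hence bc: "cmod (h z) * (real N + 1 - cmod z) \<le> 2 * L N * cmod z" if "cmod z < real N + 1" for z
        by (intro borel_caratheodory) (use that g in \<open>auto simp: h_def intro!: holomorphic_intros\<close>)
      have small: "cmod (poly (P N) z - F z / F 0) \<le> K * (2 * \<eta>)" if z: "cmod z = 1" for z
      proof -
        \<comment> \<open>The radius N + 1 is used so that its distance to the unit circle is
          exactly N.\<close>
        have "cmod (h z) * real N \<le> 2 * L N" using bc[of z] z N1 by simp
        also have "\<dots> \<le> \<eta> * real N" using N0[OF N] by simp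
        finally have hz: "cmod (h z) \<le> \<eta>" using N1 by simp
        have "norm (exp (- h z) - 1 - (- h z)) \<le> norm (- h z) / 2"
          by (rule norm_exp_bounds_lemma) (use hz \<eta> in auto)
        hence "cmod (exp (- h z) - 1) \<le> 2 * \<eta>"
          using hz norm_triangle_ineq2[of "exp (- h z) - 1" "- h z"] \<eta> by simp
        moreover have "poly (P N) z - F z / F 0 = F z / F 0 * (exp (- h z) - 1)"
          using eh[of z] P(3)[of z N] G[of z N] F0 a0 z N1 by (simp add: exp_minus field_simps)
        ultimately show ?thesis
          unfolding norm_mult using K(1)[of z] z K(2) by (simp only: norm_mult) (intro mult_mono, auto)
      qed
      have "cmod (coeff (P N) j - a j / a 0) \<le> K * (2 * \<eta>)"
      proof (rule power_series_coeff_bound[where f = "\<lambda>z. poly (P N) z - F z / F 0"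
          and b = "\<lambda>i. coeff (P N) i - a i / a 0"])
        fix z
        have "(\<lambda>i. coeff (P N) i * z ^ i) sums (\<Sum>i\<le>degree (P N). coeff (P N) i * z ^ i)"
          by (rule sums_finite) (auto simp: coeff_eq_0)
        moreover have "(\<lambda>i. a i * z ^ i / a 0) sums (F z / a 0)" by (intro sums_divide ser)
        ultimately show "(\<lambda>i. (coeff (P N) i - a i / a 0) * z ^ i) sums (poly (P N) z - F z / F 0)"
          using sums_diff by (fastforce simp: poly_altdef F0 algebra_simps)
      qed (rule small)
      thus ?thesis using \<eta> by simp
    qed
    thus "\<exists>no. \<forall>n\<ge>no. norm (coeff (P n) j - a j / a 0) < \<delta>" by blast
  qed
  thus ?thesis using that[of P] P by blast
qed

section \<open>The theta transformation\<close>

lemma dirichlet_kernel: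
  "sin (\<theta> / 2) * (1 + 2 * (\<Sum>\<nu>=1..h. cos (real \<nu> * \<theta>))) = sin ((2 * real h + 1) * \<theta> / 2)"
proof (induction h)
  case (Suc h)
  have "2 * sin (\<theta> / 2) * cos (real (Suc h) * \<theta>) = sin ((2 * real (Suc h) + 1) * \<theta> / 2) - sin ((2 * real h + 1) * \<theta> / 2)"
  proof -
    have "2 * sin b * cos a = sin (a + b) - sin (a - b)" for a b :: real by (simp add: sin_add sin_diff)
    from this[of "\<theta> / 2" "real (Suc h) * \<theta>"] show ?thesis by (simp add: algebra_simps add_divide_distrib)
  qed
  with Suc show ?case by (simp add: algebra_simps)
qed simp

text \<open>This is the sum of exp (2 pi i \<nu> / l) over the l-th roots of unity in cosine form: l
  is odd, so the nonzero residues pair off under negation.\<close>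

lemma dirichlet_kernel_rational:
  assumes l: "l = 2 * h + 1"
  shows "1 + 2 * (\<Sum>\<nu>=1..h. cos (real \<nu> * (2 * pi * real i / real l))) = (if l dvd i then real l else 0)"
proof (cases "l dvd i")
  case True
  then obtain j where "i = l * j" by auto
  hence "real \<nu> * (2 * pi * real i / real l) = 2 * pi * real (\<nu> * j)" for \<nu> using l by (simp add: field_simps)
  hence "cos (real \<nu> * (2 * pi * real i / real l)) = 1" for \<nu> using cos_2npi[of "\<nu> * j"]
    by (metis mult.commute mult.left_commute)
  thus ?thesis using True l by simp
next
  case False
  let ?\<theta> = "2 * pi * real i / real l"
  have l0: "real l > 0" using l by simp
  have "sin (?\<theta> / 2) \<noteq> 0"
  proof
    assume "sin (?\<theta> / 2) = 0"
    then obtain k :: int where "?\<theta> / 2 = of_int k * pi" by (auto simp: sin_zero_iff_int2)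
    hence "real i = of_int k * real l" using l0 by (simp add: field_simps)
    hence "int i = k * int l" by (metis of_int_eq_iff of_int_mult of_int_of_nat_eq)
    hence "int l dvd int i" by simp
    thus False using False by simp
  qed
  moreover have "sin ((2 * real h + 1) * ?\<theta> / 2) = 0"
  proof -
    have "(2 * real h + 1) * ?\<theta> / 2 = real i * pi" using l0 l by (simp add: field_simps)
    thus ?thesis by simp
  qed
  ultimately show ?thesis using False dirichlet_kernel[of ?\<theta> h] by simp
qed

lemma sum_symmetric:
  fixes g :: "nat \<Rightarrow> real"
  assumes "\<And>k. k \<le> 2 * m \<Longrightarrow> g (2 * m - k) = g k"
  shows "(\<Sum>k\<le>2 * m. g k) = g m + 2 * (\<Sum>i=1..m. g (m + i))"
proof -
  have g: "g (m + (m - k)) = g k" if "k < m" for k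
    using assms[of k] that by (simp add: mult_2)
  have "(\<Sum>k<m. g k) = (\<Sum>i=1..m. g (m + i))"
    by (rule sum.reindex_bij_witness[of _ "\<lambda>i. m - i" "\<lambda>k. m - k"])
      (use g in auto)
  moreover have "(\<Sum>k\<in>{m<..2*m}. g k) = (\<Sum>i=1..m. g (m + i))"
    by (rule sum.reindex_bij_witness[of _ "\<lambda>i. m + i" "\<lambda>k. k - m"]) auto
  moreover have "{..2*m} = {..<m} \<union> {m} \<union> {m<..2*m}" by auto
  hence "(\<Sum>k\<le>2*m. g k) = (\<Sum>k<m. g k) + g m + (\<Sum>k\<in>{m<..2*m}. g k)"
    by (simp only:) (subst sum.union_disjoint; (subst sum.union_disjoint)?; auto)
  ultimately show ?thesis by simp
qed

lemma two_cos_even_power: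
  "(2 * cos y) ^ (2 * m) = real (2 * m choose m) + 2 * (\<Sum>i=1..m. real (2 * m choose (m + i)) * cos (real i * (2 * y)))"
proof -
  have "complex_of_real ((2 * cos y) ^ (2 * m)) = (cis y + cis (-y)) ^ (2 * m)"
  proof -
    have "cis y + cis (-y) = of_real (2 * cos y)" by (simp add: complex_eq_iff)
    thus ?thesis by simp
  qed
  also have "\<dots> = (\<Sum>k\<le>2*m. of_nat (2 * m choose k) * cis ((2 * real k - 2 * real m) * y))"
  proof (subst binomial_ring, intro sum.cong refl)
    fix k assume "k \<in> {..2 * m}"
    hence "real k * y + real (2 * m - k) * (-y) = (2 * real k - 2 * real m) * y"
      by (simp add: of_nat_diff algebra_simps)
    moreover have "cis y ^ k * cis (-y) ^ (2 * m - k) = cis (real k * y + real (2 * m - k) * (-y))"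
      by (simp only: Complex.DeMoivre cis_mult)
    ultimately have "cis y ^ k * cis (-y) ^ (2 * m - k) = cis ((2 * real k - 2 * real m) * y)" by simp
    thus "of_nat (2 * m choose k) * cis y ^ k * cis (-y) ^ (2 * m - k) = of_nat (2 * m choose k) * cis ((2 * real k - 2 * real m) * y)"
      by (simp add: mult.assoc)
  qed
  finally have "(2 * cos y) ^ (2 * m) = Re (\<Sum>k\<le>2*m. of_nat (2 * m choose k) * cis ((2 * real k - 2 * real m) * y))"
    by (metis Re_complex_of_real)
  also have "\<dots> = (\<Sum>k\<le>2*m. real (2 * m choose k) * cos ((2 * real k - 2 * real m) * y))" by simp
  also have "\<dots> = real (2 * m choose m) * cos ((2 * real m - 2 * real m) * y) +
     2 * (\<Sum>i=1..m. real (2 * m choose (m + i)) * cos ((2 * real (m + i) - 2 * real m) * y))"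
  proof (rule sum_symmetric)
    fix k assume k: "k \<le> 2 * m"
    have "(2 * real (2 * m - k) - 2 * real m) * y = - ((2 * real k - 2 * real m) * y)"
      using k by (simp add: of_nat_diff algebra_simps)
    thus "real (2 * m choose (2 * m - k)) * cos ((2 * real (2 * m - k) - 2 * real m) * y) =
      real (2 * m choose k) * cos ((2 * real k - 2 * real m) * y)"
      using k by (simp add: binomial_symmetric[of k])
  qed
  finally show ?thesis by (simp add: algebra_simps)
qed

text \<open>Writing the finite sum as a series with vanishing tail prepares the termwise limit,
  where l and m both vary.\<close>

lemma sum_multiples:
  fixes f :: "nat \<Rightarrow> real"
  assumes l: "l > 0" and f: "\<And>i. i > m \<Longrightarrow> f i = 0"
  shows "(\<Sum>i=1..m. if l dvd i then f i else 0) = (\<Sum>j. f (Suc j * l))"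
proof -
  have "(\<Sum>i=1..m. if l dvd i then f i else 0) = (\<Sum>i | i \<in> {1..m} \<and> l dvd i. f i)"
    by (subst sum.inter_filter) auto
  also have "\<dots> = (\<Sum>j<m div l. f (Suc j * l))"
  proof (rule sum.reindex_bij_witness[of _ "\<lambda>j. Suc j * l" "\<lambda>i. i div l - 1"])
    fix j assume "j \<in> {..<m div l}"
    hence "Suc j \<le> m div l" by simp
    hence "Suc j * l \<le> m" by (metis div_le_mono le_trans mult_le_mono1 times_div_less_eq_dividend mult.commute)
    thus "Suc j * l \<in> {i \<in> {1..m}. l dvd i}" using l by auto
    show "Suc j * l div l - 1 = j" using l by simp
  next
    fix i assume i: "i \<in> {i \<in> {1..m}. l dvd i}"
    then obtain j where j: "i = l * j" "j > 0" by (auto elim!: dvdE intro!: Nat.gr0I)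
    show "Suc (i div l - 1) * l = i" using j l by simp
    show "i div l - 1 \<in> {..<m div l}" using i j l div_le_mono[of i m l] by auto
    show "f (Suc (i div l - 1) * l) = f i" using j l by (simp add: mult.commute)
  qed
  also have "\<dots> = (\<Sum>j. f (Suc j * l))"
  proof (rule suminf_finite[symmetric])
    fix j assume "j \<notin> {..<m div l}"
    hence "m div l < Suc j" by simp
    hence "m < Suc j * l" using l by (simp only: div_less_iff_less_mult)
    thus "f (Suc j * l) = 0" by (rule f)
  qed simp
  finally show ?thesis .
qed

text \<open>Polya's finite form of the theta transformation: \<open>(2 cos y)\<^sup>2\<^sup>m\<close> is averaged over the \<open>l\<close>-division
  points of the circle.\<close>
lemma finite_theta_identity:
  assumes l: "l = 2 * h + 1"
  shows "1 + 2 * (\<Sum>\<nu>. if \<nu> < h then cos (pi * real (Suc \<nu>) / real l) ^ (2 * m) else 0) =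
    real l * real (2 * m choose m) / 4 ^ m * (1 + 2 * (\<Sum>j. real (2 * m choose (m + Suc j * l)) / real (2 * m choose m)))"
proof -
  have l0: "l > 0" using l by simp
  have b0: "real (2 * m choose m) > 0" by simp
  define b where "b i = real (2 * m choose (m + i))" for i
  have sb: "(\<Sum>i=1..m. if l dvd i then b i else 0) = (\<Sum>j. b (Suc j * l))"
    by (rule sum_multiples[OF l0]) (auto simp: b_def)
  \<comment> \<open>The division point y = 0 of the circle, which supplies the leading 1 on the
    left-hand side.\<close>
  have p4: "(4::real) ^ m = b 0 + 2 * (\<Sum>i=1..m. b i)"
    using two_cos_even_power[of 0 m] by (simp add: b_def power_mult)
  have "4 ^ m * (1 + 2 * (\<Sum>\<nu>. if \<nu> < h then cos (pi * real (Suc \<nu>) / real l) ^ (2 * m) else 0))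
    = 4 ^ m * (1 + 2 * (\<Sum>\<nu>=1..h. cos (pi * real \<nu> / real l) ^ (2 * m)))"
  proof -
    have "(\<Sum>\<nu>. if \<nu> < h then cos (pi * real (Suc \<nu>) / real l) ^ (2 * m) else 0)
      = (\<Sum>\<nu><h. cos (pi * real (Suc \<nu>) / real l) ^ (2 * m))"
      by (subst suminf_finite[of "{..<h}"]) auto
    thus ?thesis by (simp only: sum.atLeast1_atMost_eq One_nat_def)
  qed
  also have "\<dots> = 4 ^ m + 2 * (\<Sum>\<nu>=1..h. (2 * cos (pi * real \<nu> / real l)) ^ (2 * m))"
  proof -
    have "(2 * c) ^ (2 * m) = 4 ^ m * c ^ (2 * m)" for c :: real by (simp add: power_mult_distrib power_mult)
    thus ?thesis by (simp only: distrib_left sum_distrib_left mult.left_commute mult_1_right)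
  qed
  also have "\<dots> = 4 ^ m + 2 * (\<Sum>\<nu>=1..h. b 0 + 2 * (\<Sum>i=1..m. b i * cos (real i * (2 * (pi * real \<nu> / real l)))))"
    by (simp only: two_cos_even_power b_def add_0_right)
  also have "(\<Sum>\<nu>=1..h. b 0 + 2 * (\<Sum>i=1..m. b i * cos (real i * (2 * (pi * real \<nu> / real l)))))
    = real h * b 0 + 2 * (\<Sum>i=1..m. b i * (\<Sum>\<nu>=1..h. cos (real \<nu> * (2 * pi * real i / real l))))"
    (is "?l = ?r")
  proof -
    have "(\<Sum>\<nu>=1..h. \<Sum>i=1..m. b i * cos (real i * (2 * (pi * real \<nu> / real l))))
      = (\<Sum>i=1..m. b i * (\<Sum>\<nu>=1..h. cos (real \<nu> * (2 * pi * real i / real l))))"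
      by (subst sum.swap) (simp add: sum_distrib_left mult_ac)
    thus ?thesis by (simp only: sum.distrib sum_distrib_left[symmetric] sum_constant) simp
  qed
  also have "4 ^ m + 2 * \<dots> = b 0 * real l + 2 * (\<Sum>i=1..m. b i * (1 + 2 * (\<Sum>\<nu>=1..h. cos (real \<nu> * (2 * pi * real i / real l)))))"
    unfolding p4 using l by (simp add: algebra_simps sum.distrib sum_distrib_left)
  also have "\<dots> = real l * (b 0 + 2 * (\<Sum>i=1..m. if l dvd i then b i else 0))"
    unfolding dirichlet_kernel_rational[OF l] by (simp add: algebra_simps sum_distrib_left if_distrib cong: if_cong)
  also have "\<dots> = real l * b 0 * (1 + 2 * (\<Sum>j. b (Suc j * l) / b 0))"
  proof -
    have "(\<Sum>j. b (Suc j * l) / b 0) = (\<Sum>j. b (Suc j * l)) / b 0"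
    proof (rule suminf_divide)
      have "b (Suc j * l) = 0" if "j \<notin> {..<m}" for j
      proof -
        have "Suc j * 1 \<le> Suc j * l" using l0 by (intro mult_le_mono2) simp
        hence "Suc j * l > m" using that by simp
        thus ?thesis by (simp add: b_def)
      qed
      thus "summable (\<lambda>j. b (Suc j * l))" by (intro summable_finite[of "{..<m}"]) auto
    qed
    thus ?thesis unfolding sb using b0 by (simp add: b_def field_simps)
  qed
  finally show ?thesis by (simp add: b_def field_simps)
qed

section \<open>Asymptotics of central binomial coefficients and their neighbours\<close>

lemma wallis_product_eq:
  "(\<Prod>k=1..n. (4 * real k ^ 2) / (4 * real k ^ 2 - 1)) * ((real (2 * n choose n) / 4 ^ n)\<^sup>2 * (2 * real n + 1)) = 1"
proof (induction n)
  case (Suc n)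
  define c where "c n = real (2 * n choose n) / 4 ^ n" for n
  have "real (Suc n) * real (2 * Suc n choose Suc n) = 2 * (2 * real n + 1) * real (2 * n choose n)"
  proof -
    have "Suc n * (2 * Suc n choose Suc n) = (2 * Suc n) * (Suc (2 * n) choose n)"
      using Suc_times_binomial_eq[of "Suc (2 * n)" n] by (simp add: mult.commute)
    moreover have "Suc n * (Suc (2 * n) choose n) = Suc (2 * n) * (2 * n choose n)"
    proof -
      have "Suc (2 * n) choose n = Suc (2 * n) choose Suc n" using binomial_symmetric[of n "Suc (2 * n)"] by simp
      thus ?thesis using Suc_times_binomial_eq[of "2 * n" n] by (simp add: mult.commute)
    qed
    ultimately have "Suc n * (Suc n * (2 * Suc n choose Suc n)) = Suc n * (2 * (Suc (2 * n) * (2 * n choose n)))"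
      by (metis mult.assoc mult.commute)
    hence "Suc n * (2 * Suc n choose Suc n) = 2 * (Suc (2 * n) * (2 * n choose n))" by (metis mult_cancel1 nat.distinct(1))
    hence "real (Suc n * (2 * Suc n choose Suc n)) = real (2 * (Suc (2 * n) * (2 * n choose n)))" by (rule arg_cong)
    thus ?thesis unfolding of_nat_mult by (simp only: of_nat_Suc of_nat_mult of_nat_numeral mult.assoc add.commute)
  qed
  hence "real (2 * Suc n choose Suc n) = 2 * (2 * real n + 1) * real (2 * n choose n) / (real n + 1)"
    by (metis eq_divide_eq mult.commute of_nat_Suc of_nat_neq_0 add.commute)
  hence c: "c (Suc n) = c n * (2 * real n + 1) / (2 * (real n + 1))"
    unfolding c_def by (simp only:) (simp add: divide_simps, simp add: algebra_simps)
  have IH: "(\<Prod>k=1..n. (4 * real k ^ 2) / (4 * real k ^ 2 - 1)) * ((c n)\<^sup>2 * (2 * real n + 1)) = 1"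
    using Suc by (simp add: c_def)
  have "(4 * real (Suc n) ^ 2) / (4 * real (Suc n) ^ 2 - 1) * ((c (Suc n))\<^sup>2 * (2 * real (Suc n) + 1)) = (c n)\<^sup>2 * (2 * real n + 1)"
  proof -
    have "4 * (real n + 1) ^ 2 - 1 = (2 * real n + 1) * (2 * real n + 3)" by (simp add: power2_eq_square algebra_simps)
    moreover have "(4 * x ^ 2) / (a * b) * ((y * a / (2 * x))\<^sup>2 * b) = y\<^sup>2 * a" if "a > 0" "b > 0" "x > 0" for x y a b :: real
      using that by (simp add: field_simps power2_eq_square)
    hence "(4 * (real n + 1) ^ 2) / ((2 * real n + 1) * (2 * real n + 3)) *
        ((c n * (2 * real n + 1) / (2 * (real n + 1)))\<^sup>2 * (2 * real n + 3)) = (c n)\<^sup>2 * (2 * real n + 1)"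
      by (metis add_pos_nonneg mult_nonneg_nonneg of_nat_0_le_iff zero_le_numeral zero_less_numeral zero_less_one add_nonneg_pos)
    moreover have "2 * real (Suc n) + 1 = 2 * real n + 3" "real (Suc n) = real n + 1" by simp_all
    ultimately show ?thesis unfolding c by (simp only:)
  qed
  moreover have "(\<Prod>k=1..Suc n. (4 * real k ^ 2) / (4 * real k ^ 2 - 1)) =
      (\<Prod>k=1..n. (4 * real k ^ 2) / (4 * real k ^ 2 - 1)) * ((4 * real (Suc n) ^ 2) / (4 * real (Suc n) ^ 2 - 1))"
    by (subst prod.nat_ivl_Suc') (simp, rule mult.commute)
  ultimately show ?case using IH unfolding c_def by (simp only: mult.assoc)
qed simp

text \<open>For c n = (2n choose n) / 4^n the Wallis product is 1 / (c n ^ 2 (2 n + 1)), so its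
  limit pi / 2 determines the limit of sqrt n times c n.\<close>

lemma central_binomial_asymptotics:
  "(\<lambda>n. sqrt (real n) * real (2 * n choose n) / 4 ^ n) \<longlonglongrightarrow> 1 / sqrt pi"
proof -
  define W where "W n = (\<Prod>k=1..n. (4 * real k ^ 2) / (4 * real k ^ 2 - 1))" for n
  have W: "(\<lambda>n. W n) \<longlonglongrightarrow> pi / 2" unfolding W_def by (rule wallis)
  have "(\<lambda>n. real n / (2 * real n + 1)) \<longlonglongrightarrow> 1 / 2" by real_asymp
  from tendsto_mult[OF tendsto_inverse[OF W] this]
  have "(\<lambda>n. sqrt (inverse (W n) * (real n / (2 * real n + 1)))) \<longlonglongrightarrow> sqrt (inverse (pi / 2) * (1 / 2))"
    by (intro tendsto_real_sqrt) auto
  moreover have "sqrt (inverse (W n) * (real n / (2 * real n + 1))) = sqrt (real n) * real (2 * n choose n) / 4 ^ n" for n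
  proof -
    have *: "W n * ((real (2 * n choose n) / 4 ^ n)\<^sup>2 * (2 * real n + 1)) = 1"
      unfolding W_def by (rule wallis_product_eq)
    hence "inverse (W n) = (real (2 * n choose n) / 4 ^ n)\<^sup>2 * (2 * real n + 1)"
      by (rule inverse_unique)
    hence "inverse (W n) * (real n / (2 * real n + 1)) = (real (2 * n choose n) / 4 ^ n)\<^sup>2 * real n" by simp
    thus ?thesis by (simp add: real_sqrt_mult real_sqrt_abs)
  qed
  ultimately show ?thesis by (simp add: real_sqrt_inverse real_sqrt_divide inverse_eq_divide)
qed

text \<open>Taylor to order four gives 1 - y^2/2 + y^4/24, and y^4 <= 4 y^2 turns this into 1 -
  y^2/3. The range covers [0, pi/2], where it is applied.\<close>

lemma cos_le_exp:
  fixes y :: real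
  assumes "\<bar>y\<bar> \<le> 2"
  shows "cos y \<le> exp (- (y\<^sup>2 / 3))"
proof -
  obtain t where t: "cos y = (\<Sum>m<4. cos_coeff m * y ^ m) + (cos (t + 1 / 2 * real 4 * pi) / fact 4) * y ^ 4"
    using Maclaurin_cos_expansion[of y 4] by blast
  have "cos y \<le> 1 - y\<^sup>2 / 2 + y ^ 4 / 24"
  proof -
    have "cos (t + 1 / 2 * real 4 * pi) / fact 4 * y ^ 4 \<le> 1 / 24 * y ^ 4"
      by (intro mult_right_mono) (auto simp: fact_numeral)
    moreover have "(\<Sum>m<4. cos_coeff m * y ^ m) = 1 - y\<^sup>2 / 2"
      by (simp add: lessThan_nat_numeral lessThan_Suc cos_coeff_def power2_eq_square)
    ultimately show ?thesis using t by simp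
  qed
  also have "y ^ 4 \<le> 4 * y\<^sup>2"
  proof -
    have "y\<^sup>2 \<le> 2\<^sup>2" using assms by (intro abs_le_square_iff[THEN iffD1]) auto
    hence "y\<^sup>2 * y\<^sup>2 \<le> 4 * y\<^sup>2" by (intro mult_right_mono) auto
    thus ?thesis by (simp flip: power_add)
  qed
  hence "1 - y\<^sup>2 / 2 + y ^ 4 / 24 \<le> 1 + - (y\<^sup>2 / 3)" by simp
  also have "\<dots> \<le> exp (- (y\<^sup>2 / 3))" by (rule exp_ge_add_one_self)
  finally show ?thesis .
qed

text \<open>Consecutive ratios are 1 - (2k + 1) / (m + k + 1), with reciprocal 1 + (2k + 1) / (m -
  k). Applying 1 + x <= exp x to both and summing the odd numbers to k^2 gives the bounds; the fixed
  K makes the denominators uniform along the induction.\<close>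

lemma binomial_ratio_bounds:
  assumes "k \<le> K" "K < m"
  shows "exp (- ((real k)\<^sup>2 / (real m - real K))) \<le> real (2 * m choose (m + k)) / real (2 * m choose m)"
    and "real (2 * m choose (m + k)) / real (2 * m choose m) \<le> exp (- ((real k)\<^sup>2 / (real m + real K)))"
proof -
  define r where "r k = real (2 * m choose (m + k)) / real (2 * m choose m)" for k
  have step: "r (Suc k) = r k * ((real m - real k) / (real m + real k + 1))" if "k < m" for k
  proof -
    have "real (2 * m choose Suc (m + k)) * real (Suc (m + k)) = real (2 * m choose (m + k)) * real (2 * m - (m + k))"
      using choose_mult_lemma binomial_absorb_comp[of "2 * m" "m + k"] binomial_absorption[of "m + k" "2 * m"]
      by (metis (no_types, lifting) mult.commute of_nat_mult Suc_times_binomial_eq binomial_absorb_comp binomial_absorption)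
    moreover have "real (2 * m - (m + k)) = real m - real k" using that by (simp add: of_nat_diff)
    moreover have "real (Suc (m + k)) = real m + real k + 1" by simp
    moreover have "real m + real k + 1 \<noteq> 0" by linarith
    ultimately have "real (2 * m choose (m + Suc k)) = real (2 * m choose (m + k)) * (real m - real k) / (real m + real k + 1)"
      by (metis add_Suc_right eq_divide_eq)
    thus ?thesis by (simp add: r_def)
  qed
  have "exp (- ((real k)\<^sup>2 / (real m - real K))) \<le> r k \<and> r k \<le> exp (- ((real k)\<^sup>2 / (real m + real K)))"
    using assms
  proof (induction k)
    case (Suc k)
    hence IH: "exp (- ((real k)\<^sup>2 / (real m - real K))) \<le> r k" "r k \<le> exp (- ((real k)\<^sup>2 / (real m + real K)))"
      and k: "real k + 1 \<le> real K" "real K < real m" by auto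
    define q where "q = (real m - real k) / (real m + real k + 1)"
    have e: "exp (- ((real (Suc k))\<^sup>2 / D)) = exp (- ((real k)\<^sup>2 / D)) * exp (- ((2 * real k + 1) / D))" for D :: real
      by (simp add: exp_add[symmetric] add_divide_distrib[symmetric] power2_eq_square algebra_simps)
    have "q = 1 + - ((2 * real k + 1) / (real m + real k + 1))" using k by (simp add: q_def field_simps)
    also have "\<dots> \<le> 1 + - ((2 * real k + 1) / (real m + real K))"
      using k by (simp add: divide_left_mono)
    also have "\<dots> \<le> exp (- ((2 * real k + 1) / (real m + real K)))" by (rule exp_ge_add_one_self)
    finally have q1: "q \<le> exp (- ((2 * real k + 1) / (real m + real K)))" .
    have "1 / q = 1 + (2 * real k + 1) / (real m - real k)" using k by (simp add: q_def field_simps)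
    also have "\<dots> \<le> exp ((2 * real k + 1) / (real m - real k))" by (rule exp_ge_add_one_self)
    also have "\<dots> \<le> exp ((2 * real k + 1) / (real m - real K))"
      using k by (simp add: divide_left_mono)
    finally have "1 / q \<le> exp ((2 * real k + 1) / (real m - real K))" .
    moreover have q0: "q > 0" using k by (simp add: q_def)
    ultimately have q2: "exp (- ((2 * real k + 1) / (real m - real K))) \<le> q"
      by (simp add: exp_minus inverse_eq_divide field_simps)
    have "r (Suc k) = r k * q" unfolding q_def by (rule step) (use Suc in auto)
    moreover have "exp (- ((real (Suc k))\<^sup>2 / (real m - real K))) \<le> r k * q"
      unfolding e by (intro mult_mono IH q2) (auto simp: r_def)
    moreover have "r k * q \<le> exp (- ((real (Suc k))\<^sup>2 / (real m + real K)))"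
      unfolding e by (intro mult_mono IH q1) (use q0 in auto)
    ultimately show ?case by simp
  qed (simp add: r_def)
  thus "exp (- ((real k)\<^sup>2 / (real m - real K))) \<le> real (2 * m choose (m + k)) / real (2 * m choose m)"
    "real (2 * m choose (m + k)) / real (2 * m choose m) \<le> exp (- ((real k)\<^sup>2 / (real m + real K)))"
    by (simp_all add: r_def)
qed

section \<open>Jacobi's theta function as a limit\<close>

lemma summable_exp_neg_linear:
  assumes "c > 0"
  shows "summable (\<lambda>n. exp (- c * real (Suc n)))"
proof -
  have "summable (\<lambda>n. exp (-c) * exp (-c) ^ n)" using assms by (intro summable_mult summable_geometric) auto
  thus ?thesis by (simp add: exp_of_nat_mult[symmetric] exp_add[symmetric] algebra_simps)
qed

definition theta :: "real \<Rightarrow> real" where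
  "theta x = 1 + 2 * (\<Sum>n. exp (- (pi * (real (Suc n))\<^sup>2 * x)))"

lemma filterlim_odd: "filterlim (\<lambda>h. 2 * real h + 1) at_top sequentially"
  by real_asymp

text \<open>In the finite identity take l = L h and m close to t l^2 with t = x / pi. The cosine
  powers tend to exp (- pi \<nu>^2 x), the binomial ratios to exp (- j^2 / t) = exp (- pi j^2 / x),
  and the prefactor, about l / sqrt (pi m), to 1 / sqrt x. Both series have summable majorants, so
  Tannery's theorem applies.\<close>

theorem theta_transform:
  assumes x: "x > 0"
  shows "theta (1 / x) = sqrt x * theta x"
proof -
  define t where "t = x / pi"
  have t: "t > 0" using x by (simp add: t_def)
  define L where "L h = 2 * real h + 1" for h
  define m where "m h = nat \<lfloor>t * (L h)\<^sup>2\<rfloor>" for h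
  have L1: "L h \<ge> 1" for h by (simp add: L_def)
  have Llim: "filterlim L at_top sequentially" unfolding L_def by (rule filterlim_odd)
  have inv0: "(\<lambda>h. c / L h) \<longlonglongrightarrow> 0" for c by (rule tendsto_divide_0[OF tendsto_const]) (rule filterlim_at_top_imp_at_infinity[OF Llim])
  have m_le: "real (m h) \<le> t * (L h)\<^sup>2" for h using t by (simp add: m_def)
  have m_ge: "t * (L h)\<^sup>2 - 1 \<le> real (m h)" for h using t unfolding m_def by linarith
  have mL: "(\<lambda>h. real (m h) / (L h)\<^sup>2) \<longlonglongrightarrow> t"
  proof (rule tendsto_sandwich)
    show "\<forall>\<^sub>F h in sequentially. t - (1 / L h)\<^sup>2 \<le> real (m h) / (L h)\<^sup>2"
      using m_ge L1 by (intro always_eventually allI) (smt (verit, ccfv_SIG) divide_diff_eq_iff divide_right_mono power_one_over zero_le_power2 zero_less_power nonzero_mult_div_cancel_right diff_divide_distrib power2_eq_square mult_eq_0_iff)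
    show "\<forall>\<^sub>F h in sequentially. real (m h) / (L h)\<^sup>2 \<le> t"
      using m_le L1 by (intro always_eventually allI) (simp add: divide_le_eq, smt (verit) L1 zero_less_power)
    have "(\<lambda>h. t - (1 / L h)\<^sup>2) \<longlonglongrightarrow> t - 0\<^sup>2" by (intro tendsto_intros inv0)
    thus "(\<lambda>h. t - (1 / L h)\<^sup>2) \<longlonglongrightarrow> t" by simp
  qed auto
  have mbig: "eventually (\<lambda>h. t / 2 < real (m h) / (L h)\<^sup>2) sequentially"
    by (rule order_tendstoD[OF mL]) (use t in auto)

  define a where "a \<nu> h = (if \<nu> < h then cos (pi * real (Suc \<nu>) / L h) ^ (2 * m h) else 0)" for \<nu> h
  define b where "b j h = real (2 * m h choose (m h + Suc j * (2 * h + 1))) / real (2 * m h choose m h)" for j h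
  have id: "1 + 2 * (\<Sum>\<nu>. a \<nu> h) = L h * real (2 * m h choose m h) / 4 ^ m h * (1 + 2 * (\<Sum>j. b j h))" for h
  proof -
    have "L h = real (2 * h + 1)" by (simp add: L_def)
    thus ?thesis unfolding a_def b_def by (simp only: finite_theta_identity[OF refl])
  qed

  have a_lim: "(a \<nu>) \<longlonglongrightarrow> exp (- (pi * (real (Suc \<nu>))\<^sup>2 * x))" for \<nu>
  proof -
    define c where "c = pi * real (Suc \<nu>)"
    \<comment> \<open>The second-order expansion of ln cos at 0; multiplied by 2 m / (L h)^2, which
      tends to 2 t, it gives the exponent.\<close>
    have "((\<lambda>y. y\<^sup>2 * ln (cos (c / y))) \<longlongrightarrow> - (c * c / 2)) at_top"
      by real_asymp
    hence "(\<lambda>h. (L h)\<^sup>2 * ln (cos (c / L h))) \<longlonglongrightarrow> - (c\<^sup>2 / 2)"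
      using Llim unfolding power2_eq_square[of c] by (rule filterlim_compose)
    note l = tendsto_mult[OF mL this]
    have "(\<lambda>h. exp (2 * (real (m h) / (L h)\<^sup>2 * ((L h)\<^sup>2 * ln (cos (c / L h)))))) \<longlonglongrightarrow> exp (2 * (t * - (c\<^sup>2 / 2)))"
      by (intro tendsto_exp tendsto_mult[OF tendsto_const] l)
    also have "2 * (t * - (c\<^sup>2 / 2)) = - (pi * (real (Suc \<nu>))\<^sup>2 * x)"
      by (simp add: t_def c_def power2_eq_square)
    finally show ?thesis
    proof (rule Lim_transform_eventually)
      have "(\<lambda>h. cos (c / L h)) \<longlonglongrightarrow> cos 0" by (intro tendsto_intros inv0)
      hence "eventually (\<lambda>h. cos (c / L h) > 0) sequentially" by (rule order_tendstoD) auto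
      with eventually_gt_at_top[of \<nu>]
      show "\<forall>\<^sub>F h in sequentially. exp (2 * (real (m h) / (L h)\<^sup>2 * ((L h)\<^sup>2 * ln (cos (c / L h))))) = a \<nu> h"
      proof eventually_elim
        case (elim h)
        have "2 * (real (m h) / (L h)\<^sup>2 * ((L h)\<^sup>2 * ln (cos (c / L h)))) = real (2 * m h) * ln (cos (c / L h))"
          using L1[of h] by simp
        hence "exp (2 * (real (m h) / (L h)\<^sup>2 * ((L h)\<^sup>2 * ln (cos (c / L h))))) = cos (c / L h) ^ (2 * m h)"
          using elim by (simp only: exp_of_nat_mult) simp
        thus ?case using elim by (simp add: a_def c_def)
      qed
    qed
  qed
  have a_bound: "eventually (\<lambda>h. \<forall>\<nu>. norm (a \<nu> h) \<le> exp (- t * real (Suc \<nu>))) sequentially"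
    using mbig
  proof eventually_elim
    case (elim h)
    show ?case
    proof
      fix \<nu>
      show "norm (a \<nu> h) \<le> exp (- t * real (Suc \<nu>))"
      proof (cases "\<nu> < h")
        case True
        define y where "y = pi * real (Suc \<nu>) / L h"
        have yl: "y \<le> pi / 2" "y \<ge> 0"
        proof -
          \<comment> \<open>Only \<nu> < h occurs, so the angle stays in [0, pi/2], where the cosine
            is nonnegative.\<close>
          have "2 * real (Suc \<nu>) \<le> L h" using True by (simp add: L_def)
          hence "pi * (2 * real (Suc \<nu>)) \<le> pi * L h" by (intro mult_left_mono) auto
          thus "y \<le> pi / 2" "y \<ge> 0" using L1[of h] by (simp_all add: y_def field_simps)
        qed
        have "cos y \<ge> 0" using yl by (intro cos_ge_zero) auto
        moreover have "cos y \<le> exp (- (y\<^sup>2 / 3))" using yl pi_less_4 by (intro cos_le_exp) auto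
        ultimately have "cos y ^ (2 * m h) \<le> exp (- (y\<^sup>2 / 3)) ^ (2 * m h)" by (intro power_mono)
        also have "\<dots> = exp (- (2 * (pi\<^sup>2 / 3) * (real (Suc \<nu>))\<^sup>2 * (real (m h) / (L h)\<^sup>2)))"
        proof -
          have "real (2 * m h) * - (y\<^sup>2 / 3) = - (2 * (pi\<^sup>2 / 3) * (real (Suc \<nu>))\<^sup>2 * (real (m h) / (L h)\<^sup>2))"
            unfolding y_def power_divide power_mult_distrib by (simp add: mult_ac)
          thus ?thesis by (simp only: exp_of_nat_mult [symmetric])
        qed
        also have "\<dots> \<le> exp (- t * real (Suc \<nu>))"
        proof -
          have "t * real (Suc \<nu>) \<le> 2 * real (Suc \<nu>) * (real (m h) / (L h)\<^sup>2)"
          proof -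
            have "t * real (Suc \<nu>) \<le> (2 * (real (m h) / (L h)\<^sup>2)) * real (Suc \<nu>)"
              by (intro mult_right_mono) (use elim in linarith, simp)
            thus ?thesis by (simp only: mult_ac)
          qed
          also have "\<dots> \<le> 2 * (pi\<^sup>2 / 3) * (real (Suc \<nu>))\<^sup>2 * (real (m h) / (L h)\<^sup>2)"
          proof (intro mult_right_mono)
            have "3\<^sup>2 \<le> pi\<^sup>2" using pi_gt3 by (intro power_mono) auto
            hence "1 \<le> pi\<^sup>2 / 3" by simp
            moreover have "real (Suc \<nu>) \<le> (real (Suc \<nu>))\<^sup>2" by (intro self_le_power) auto
            ultimately have "1 * real (Suc \<nu>) \<le> (pi\<^sup>2 / 3) * (real (Suc \<nu>))\<^sup>2" by (intro mult_mono) auto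
            thus "2 * real (Suc \<nu>) \<le> 2 * (pi\<^sup>2 / 3) * (real (Suc \<nu>))\<^sup>2" by simp
          qed simp
          finally show ?thesis by simp
        qed
        finally show ?thesis using True \<open>cos y \<ge> 0\<close> by (simp add: a_def y_def)
      qed (simp add: a_def)
    qed
  qed
  have S1: "(\<lambda>h. \<Sum>\<nu>. a \<nu> h) \<longlonglongrightarrow> (\<Sum>\<nu>. exp (- (pi * (real (Suc \<nu>))\<^sup>2 * x)))"
  proof -
    have "eventually (\<lambda>(k, n). norm (a k n) \<le> exp (- t * real (Suc k))) (at_top \<times>\<^sub>F sequentially)"
      unfolding eventually_prod_filter using a_bound by (intro exI[of _ "\<lambda>_. True"] exI conjI) auto
    from tannerys_theorem[OF a_lim this summable_exp_neg_linear[OF t]] show ?thesis by simp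
  qed

  have b_lim: "(b j) \<longlonglongrightarrow> exp (- (pi * (real (Suc j))\<^sup>2 * (1 / x)))" for j
  proof -
    define J where "J = real (Suc j)"
    have lim: "(\<lambda>h. exp (- (J\<^sup>2 / (real (m h) / (L h)\<^sup>2 + s * J / L h)))) \<longlonglongrightarrow> exp (- (pi * J\<^sup>2 * (1 / x)))" for s
    proof -
      have "(\<lambda>h. exp (- (J\<^sup>2 / (real (m h) / (L h)\<^sup>2 + s * J / L h)))) \<longlonglongrightarrow> exp (- (J\<^sup>2 / (t + 0)))"
        using t by (intro tendsto_intros mL inv0) auto
      thus ?thesis using x by (simp add: t_def mult.commute)
    qed
    have JL: "real (Suc j * (2 * h + 1)) = J * L h" for h
      by (simp only: J_def L_def of_nat_mult) simp
    have eq: "J\<^sup>2 / (real (m h) / (L h)\<^sup>2 + s * J / L h) = (real (Suc j * (2 * h + 1)))\<^sup>2 / (real (m h) + s * real (Suc j * (2 * h + 1)))" for s h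
    proof -
      have "(real (Suc j * (2 * h + 1)))\<^sup>2 = J\<^sup>2 * (L h)\<^sup>2"
        by (simp only: JL power_mult_distrib)
      moreover have "real (m h) + s * real (Suc j * (2 * h + 1)) = (real (m h) / (L h)\<^sup>2 + s * J / L h) * (L h)\<^sup>2"
        unfolding JL using L1[of h] by (simp add: field_simps power2_eq_square)
      ultimately show ?thesis using L1[of h] by simp
    qed
    have "(\<lambda>h. real (m h) / (L h)\<^sup>2 - J / L h) \<longlonglongrightarrow> t - 0" by (intro tendsto_intros mL inv0)
    hence "eventually (\<lambda>h. real (m h) / (L h)\<^sup>2 - J / L h > 0) sequentially" by (rule order_tendstoD) (use t in auto)
    hence ev: "eventually (\<lambda>h. Suc j * (2 * h + 1) < m h) sequentially"
    proof eventually_elim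
      case (elim h)
      have "0 < (real (m h) / (L h)\<^sup>2 - J / L h) * (L h)\<^sup>2" using elim L1[of h] by (intro mult_pos_pos) auto
      also have "\<dots> = real (m h) - real (Suc j * (2 * h + 1))"
        unfolding JL using L1[of h] by (simp add: field_simps power2_eq_square)
      finally show ?case by linarith
    qed
    show ?thesis
    proof (rule tendsto_sandwich)
      show "(\<lambda>h. exp (- (J\<^sup>2 / (real (m h) / (L h)\<^sup>2 + (- 1) * J / L h)))) \<longlonglongrightarrow> exp (- (pi * (real (Suc j))\<^sup>2 * (1 / x)))"
        using lim[of "-1"] by (simp only: J_def)
      show "(\<lambda>h. exp (- (J\<^sup>2 / (real (m h) / (L h)\<^sup>2 + 1 * J / L h)))) \<longlonglongrightarrow> exp (- (pi * (real (Suc j))\<^sup>2 * (1 / x)))"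
        using lim[of 1] by (simp only: J_def)
      show "\<forall>\<^sub>F h in sequentially. exp (- (J\<^sup>2 / (real (m h) / (L h)\<^sup>2 + - 1 * J / L h))) \<le> b j h"
        using ev
      proof eventually_elim
        case (elim h)
        show ?case unfolding eq b_def using binomial_ratio_bounds(1)[OF order_refl elim]
          by (simp only: mult_minus1 add_uminus_conv_diff)
      qed
      show "\<forall>\<^sub>F h in sequentially. b j h \<le> exp (- (J\<^sup>2 / (real (m h) / (L h)\<^sup>2 + 1 * J / L h)))"
        using ev
      proof eventually_elim
        case (elim h)
        show ?case unfolding eq b_def using binomial_ratio_bounds(2)[OF order_refl elim]
          by (simp only: mult_1)
      qed
    qed
  qed
  have b_bound: "norm (b j h) \<le> exp (- (1 / (2 * t)) * real (Suc j))" if h: "m h > 0" for j h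
  proof -
    define k where "k = Suc j * (2 * h + 1)"
    have kL: "real k = real (Suc j) * L h" by (simp only: k_def of_nat_mult L_def) simp
    \<comment> \<open>The ratio bound needs k < m. At k = m the numerator is 1 and (2m choose m) >=
      2^m suffices; beyond m the binomial coefficient is 0.\<close>
    consider "k < m h" | "k = m h" | "k > m h" by linarith
    hence "b j h \<le> exp (- ((real k)\<^sup>2 / (2 * real (m h))))"
    proof cases
      case 1
      have "b j h \<le> exp (- ((real k)\<^sup>2 / (real (m h) + real k)))"
        unfolding b_def k_def[symmetric] by (rule binomial_ratio_bounds) (use 1 in auto)
      also have "\<dots> \<le> exp (- ((real k)\<^sup>2 / (2 * real (m h))))"
        using 1 h by (simp add: divide_left_mono)
      finally show ?thesis .
    next
      case 2
      have "b j h = 1 / real (2 * m h choose m h)" unfolding b_def k_def[symmetric] using 2 by (simp add: mult_2)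
      also have "\<dots> \<le> 1 / 2 ^ m h"
      proof (intro divide_left_mono)
        have "(\<Prod>i<m h. (2::real)) \<le> (\<Prod>i<m h. (real (2 * m h) - real i) / (real (m h) - real i))"
          by (intro prod_mono) (auto simp: field_simps)
        also have "\<dots> = real (2 * m h choose m h)"
          by (simp add: binomial_altdef_of_nat[of "m h" "2 * m h"] atLeast0LessThan of_nat_diff)
        finally show "2 ^ m h \<le> real (2 * m h choose m h)" by simp
      qed auto
      also have "\<dots> \<le> exp (- ((real k)\<^sup>2 / (2 * real (m h))))"
      proof -
        have "exp ((real k)\<^sup>2 / (2 * real (m h))) = exp (real (m h) * (1/2))"
          using 2 h by (simp add: power2_eq_square)
        also have "\<dots> = exp (1/2) ^ m h" by (rule exp_of_nat_mult)
        also have "\<dots> \<le> 2 ^ m h" by (intro power_mono) (use exp_half_le2 in auto)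
        finally show ?thesis by (simp add: exp_minus field_simps)
      qed
      finally show ?thesis .
    next
      case 3
      hence "b j h = 0" unfolding b_def k_def[symmetric] by simp
      thus ?thesis by simp
    qed
    also have "\<dots> \<le> exp (- (1 / (2 * t)) * real (Suc j))"
    proof -
      have "real (Suc j) \<le> (real (Suc j))\<^sup>2" by (intro self_le_power) auto
      also have "\<dots> = t * ((real k)\<^sup>2 / (t * (L h)\<^sup>2))" using L1[of h] t by (simp add: kL power_mult_distrib)
      also have "\<dots> \<le> t * ((real k)\<^sup>2 / real (m h))"
        using m_le[of h] h t by (intro mult_left_mono divide_left_mono) auto
      finally have "real (Suc j) / (2 * t) \<le> (real k)\<^sup>2 / (2 * real (m h))" using t h by (simp add: field_simps)
      thus ?thesis by simp
    qed
    finally show ?thesis by (simp add: b_def)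
  qed
  have S2: "(\<lambda>h. \<Sum>j. b j h) \<longlonglongrightarrow> (\<Sum>j. exp (- (pi * (real (Suc j))\<^sup>2 * (1 / x))))"
  proof -
    have "eventually (\<lambda>h. m h > 0) sequentially"
      using mbig
    proof eventually_elim
      case (elim h)
      have "m h \<noteq> 0"
      proof
        assume "m h = 0"
        thus False using elim t by simp
      qed
      thus ?case by simp
    qed
    hence "eventually (\<lambda>h. \<forall>j. norm (b j h) \<le> exp (- (1 / (2 * t)) * real (Suc j))) sequentially"
      by eventually_elim (use b_bound in auto)
    hence "eventually (\<lambda>(k, n). norm (b k n) \<le> exp (- (1 / (2 * t)) * real (Suc k))) (at_top \<times>\<^sub>F sequentially)"
      unfolding eventually_prod_filter by (intro exI[of _ "\<lambda>_. True"] exI conjI) auto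
    from tannerys_theorem[OF b_lim this summable_exp_neg_linear] t show ?thesis by simp
  qed
  have m_top: "filterlim m at_top sequentially"
  proof -
    have "filterlim (\<lambda>h. t * (L h)\<^sup>2 - 1) at_top sequentially"
      unfolding L_def using t by real_asymp
    hence "filterlim (\<lambda>h. real (m h)) at_top sequentially"
      by (rule filterlim_at_top_mono) (use m_ge in auto)
    thus ?thesis by (simp add: filterlim_sequentially_iff_filterlim_real)
  qed
  have const: "(\<lambda>h. L h * real (2 * m h choose m h) / 4 ^ m h) \<longlonglongrightarrow> 1 / sqrt x"
  proof -
    have "(\<lambda>h. sqrt (real (m h)) * real (2 * m h choose m h) / 4 ^ m h) \<longlonglongrightarrow> 1 / sqrt pi"
      using filterlim_compose[OF central_binomial_asymptotics m_top] by simp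
    moreover have "(\<lambda>h. 1 / sqrt (real (m h) / (L h)\<^sup>2)) \<longlonglongrightarrow> 1 / sqrt t"
      using t by (intro tendsto_intros mL) auto
    ultimately have "(\<lambda>h. 1 / sqrt (real (m h) / (L h)\<^sup>2) * (sqrt (real (m h)) * real (2 * m h choose m h) / 4 ^ m h))
        \<longlonglongrightarrow> 1 / sqrt t * (1 / sqrt pi)"
      by (intro tendsto_mult)
    also have "1 / sqrt t * (1 / sqrt pi) = 1 / sqrt x" using x by (simp add: t_def flip: real_sqrt_mult)
    finally show ?thesis
    proof (rule Lim_transform_eventually)
      show "\<forall>\<^sub>F h in sequentially. 1 / sqrt (real (m h) / (L h)\<^sup>2) * (sqrt (real (m h)) * real (2 * m h choose m h) / 4 ^ m h) =
        L h * real (2 * m h choose m h) / 4 ^ m h"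
        using mbig
      proof eventually_elim
        case (elim h)
        have "m h \<noteq> 0"
        proof
          assume "m h = 0"
          thus False using elim t by simp
        qed
        hence "sqrt (real (m h)) \<noteq> 0" by simp
        thus ?case using L1[of h] by (simp add: real_sqrt_divide)
      qed
    qed
  qed
  have "(\<lambda>h. 1 + 2 * (\<Sum>\<nu>. a \<nu> h)) \<longlonglongrightarrow> theta x" unfolding theta_def by (intro tendsto_intros S1)
  moreover have "(\<lambda>h. 1 + 2 * (\<Sum>\<nu>. a \<nu> h)) \<longlonglongrightarrow> 1 / sqrt x * theta (1 / x)"
    unfolding id theta_def by (intro tendsto_intros S2 const)
  ultimately have "theta x = 1 / sqrt x * theta (1 / x)" by (rule LIMSEQ_unique)
  thus ?thesis using x by (simp add: field_simps)
qed

section \<open>The Mellin transform of the theta function\<close>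

definition gauss :: "nat \<Rightarrow> real \<Rightarrow> real" where
  "gauss n u = exp (- (pi * (real (Suc n))\<^sup>2 * exp (2 * u)))"

definition theta_tail :: "real \<Rightarrow> real" where
  "theta_tail u = (\<Sum>n. gauss n u)"

text \<open>The factor 4 exp (u / 2) comes from 2 exp (s u) + 2 exp ((1 - s) u) = 4 exp (u / 2) cosh
  ((s - 1/2) u).\<close>

definition xi_kernel :: "nat \<Rightarrow> real \<Rightarrow> real" where
  "xi_kernel n u = 4 * exp (u / 2) * gauss n u"

lemma gauss_pos: "gauss n u > 0"
  by (simp add: gauss_def)

lemma gauss_le: "gauss n u \<le> exp (- (pi * exp (2 * u)) * real (Suc n))"
proof -
  have "real (Suc n) \<le> (real (Suc n))\<^sup>2" by (intro self_le_power) auto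
  hence "pi * exp (2 * u) * real (Suc n) \<le> pi * exp (2 * u) * (real (Suc n))\<^sup>2" by (intro mult_left_mono) auto
  thus ?thesis by (simp add: gauss_def mult_ac)
qed

lemma summable_gauss: "summable (\<lambda>n. gauss n u)"
  by (rule summable_comparison_test'[OF summable_exp_neg_linear[of "pi * exp (2 * u)"]])
    (use gauss_le[of _ u] gauss_pos[of _ u] in \<open>auto simp: less_imp_le abs_of_pos\<close>)

lemma measurable_gauss [measurable]: "gauss n \<in> borel_measurable borel"
  unfolding gauss_def by (intro borel_measurable_continuous_onI continuous_intros)

lemma measurable_xi_kernel [measurable]: "xi_kernel n \<in> borel_measurable borel"
  unfolding xi_kernel_def by measurable

lemma measurable_theta_tail [measurable]: "theta_tail \<in> borel_measurable borel"
  unfolding theta_tail_def by measurable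

lemma theta_tail_nonneg: "theta_tail u \<ge> 0"
  unfolding theta_tail_def by (intro suminf_nonneg summable_gauss less_imp_le gauss_pos)

lemma theta_exp: "theta (exp (2 * u)) = 1 + 2 * theta_tail u"
  by (simp add: theta_def theta_tail_def gauss_def)

text \<open>The additive term, left over from the constant 1 in \<open>theta\<close>, later
  integrates to the pole part 1 / (s (s - 1)).\<close>

lemma theta_tail_uminus: "theta_tail (- u) = exp u * theta_tail u + (exp u - 1) / 2"
proof -
  have "theta (1 / exp (2 * u)) = sqrt (exp (2 * u)) * theta (exp (2 * u))" by (rule theta_transform) simp
  moreover have "sqrt (exp (2 * u)) = exp u" by (rule real_sqrt_unique) (simp_all flip: exp_of_nat_mult)
  moreover have "1 / exp (2 * u) = exp (2 * (- u))" by (simp add: exp_minus inverse_eq_divide)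
  ultimately have "1 + 2 * theta_tail (- u) = exp u * (1 + 2 * theta_tail u)" by (simp only: theta_exp)
  thus ?thesis by (simp add: field_simps)
qed

text \<open>Euler's integral for Gamma (s / 2) under the substitution t = pi (n + 1)^2 exp (2 u). A
  nonnegative integral allows summation over n without an integrability condition.\<close>

lemma mellin_gauss:
  assumes s: "s > 0"
  shows "(\<integral>\<^sup>+u. ennreal (2 * exp (s * u) * gauss n u) \<partial>lborel) =
    ennreal (pi powr (- s / 2) * Gamma (s / 2) * real (Suc n) powr (- s))"
proof -
  define a where "a = pi * (real (Suc n))\<^sup>2"
  have a: "a > 0" by (simp add: a_def)
  define f where "f t = t powr (s / 2 - 1) / exp t" for t :: real
  define g where "g u = a * exp (2 * u)" for u
  have "(f has_integral Gamma (s / 2)) {0..}" unfolding f_def using s by (intro Gamma_integral_real) auto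
  hence "(f has_integral Gamma (s / 2)) {0<..}"
    by (subst has_integral_spike_set_eq[of "{0<..}" "{0..}"]) (auto intro: negligible_subset[OF negligible_sing[of 0]])
  hence "f absolutely_integrable_on {0<..} \<and> integral {0<..} f = Gamma (s / 2)"
    by (auto intro!: nonnegative_absolutely_integrable_1 simp: f_def integral_unique has_integral_integrable)
  moreover have "{0<..} = g ` UNIV"
  proof (intro equalityI subsetI)
    fix y assume "y \<in> {0::real<..}"
    hence "y = g (ln (y / a) / 2)" using a by (simp add: g_def)
    thus "y \<in> g ` UNIV" by blast
  qed (use a in \<open>auto simp: g_def\<close>)
  ultimately have "(\<lambda>u. \<bar>2 * g u\<bar> * f (g u)) absolutely_integrable_on UNIV \<and>
      integral UNIV (\<lambda>u. \<bar>2 * g u\<bar> * f (g u)) = Gamma (s / 2)"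
  proof (subst has_absolute_integral_change_of_variables_1'[of UNIV g "\<lambda>u. 2 * g u" f])
    show "(g has_field_derivative 2 * g x) (at x within UNIV)" for x
      unfolding g_def by (auto intro!: derivative_eq_intros)
    show "inj g" using a by (auto simp: g_def inj_on_def)
  qed auto
  hence "((\<lambda>u. \<bar>2 * g u\<bar> * f (g u)) has_integral Gamma (s / 2)) UNIV"
    by (metis has_integral_integral set_lebesgue_integral_eq_integral(1))
  moreover have "\<bar>2 * g u\<bar> * f (g u) = a powr (s / 2) * (2 * exp (s * u) * gauss n u)" for u
  proof -
    have gp: "g u > 0" using a by (simp add: g_def)
    have "\<bar>2 * g u\<bar> * f (g u) = 2 * (g u powr 1 * g u powr (s / 2 - 1)) * exp (- g u)"
      unfolding f_def exp_minus using gp by (simp add: field_simps)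
    also have "g u powr 1 * g u powr (s / 2 - 1) = g u powr (s / 2)" by (simp only: powr_add[symmetric]) simp
    also have "\<dots> = a powr (s / 2) * exp (s * u)"
    proof -
      have "ln (g u) = ln a + 2 * u" using a by (simp add: g_def ln_mult)
      thus ?thesis using a gp by (simp add: powr_def algebra_simps flip: exp_add)
    qed
    finally show ?thesis by (simp add: gauss_def g_def a_def mult_ac)
  qed
  ultimately have "((\<lambda>u. a powr (s / 2) * (2 * exp (s * u) * gauss n u)) has_integral Gamma (s / 2)) UNIV" by simp
  hence "((\<lambda>u. a powr (- s / 2) * (a powr (s / 2) * (2 * exp (s * u) * gauss n u))) has_integral a powr (- s / 2) * Gamma (s / 2)) UNIV"
    by (rule has_integral_mult_right)
  moreover have cancel: "a powr (- s / 2) * (a powr (s / 2) * x) = x" for x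
    using a by (simp flip: powr_add mult.assoc)
  moreover have "a powr (- s / 2) = pi powr (- s / 2) * real (Suc n) powr (- s)"
  proof -
    have "((real (Suc n))\<^sup>2) powr (- s / 2) = real (Suc n) powr (2 * (- s / 2))"
      by (simp add: powr_def ln_realpow)
    thus ?thesis by (simp add: a_def powr_mult)
  qed
  ultimately have "((\<lambda>u. 2 * exp (s * u) * gauss n u) has_integral (pi powr (- s / 2) * real (Suc n) powr (- s) * Gamma (s / 2))) UNIV"
    by (simp only:)
  hence "((\<lambda>u. 2 * exp (s * u) * gauss n u) has_integral (pi powr (- s / 2) * Gamma (s / 2) * real (Suc n) powr (- s))) UNIV"
    by (simp only: mult.assoc mult.commute[of "real (Suc n) powr (- s)"])
  thus ?thesis by (intro nn_integral_has_integral_lborel) (simp_all add: less_imp_le[OF gauss_pos])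
qed

section \<open>Even moments of the theta kernel\<close>

definition moment_term :: "nat \<Rightarrow> nat \<Rightarrow> ennreal" where
  "moment_term n j = (\<integral>\<^sup>+u. ennreal (xi_kernel n u * u ^ (2 * j) / fact (2 * j)) * indicator {0..} u \<partial>lborel)"

text \<open>Kept in \<open>ennreal\<close>: finiteness is derived later from the convergence of the
  Dirichlet series at s = 2.\<close>

definition moment_nn :: "nat \<Rightarrow> ennreal" where
  "moment_nn j = (\<Sum>n. moment_term n j)"

lemma nn_integral_exp_atLeast:
  assumes "c > 0"
  shows "(\<integral>\<^sup>+u. ennreal (exp (- c * u)) * indicator {0..} u \<partial>lborel) = ennreal (1 / c)"
proof -
  have "((\<lambda>u. - exp (- c * u) / c) \<longlongrightarrow> 0) at_top" using assms by real_asymp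
  hence "(\<integral>\<^sup>+u. ennreal (exp (- c * u)) * indicator {0..} u \<partial>lborel) = 0 - - exp (- c * 0) / c"
    using assms by (intro nn_integral_FTC_atLeast) (auto intro!: derivative_eq_intros)
  thus ?thesis by simp
qed

lemma nn_integral_exp_diff:
  assumes s: "s > 1"
  shows "(\<integral>\<^sup>+u. ennreal (exp (- s * u) * (exp u - 1)) * indicator {0..} u \<partial>lborel) = ennreal (1 / (s * (s - 1)))"
proof -
  have lim: "((\<lambda>u. exp (- c * u)) \<longlongrightarrow> 0) at_top" if "c > 0" for c :: real using that by real_asymp
  have "((\<lambda>u. exp (- s * u) / s - exp (- (s - 1) * u) / (s - 1)) \<longlongrightarrow> 0 / s - 0 / (s - 1)) at_top"
    using s by (intro tendsto_intros lim) auto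
  hence "((\<lambda>u. exp (- s * u) / s - exp ((1 - s) * u) / (s - 1)) \<longlongrightarrow> 0) at_top" by (simp only: minus_diff_eq) simp
  hence "(\<integral>\<^sup>+u. ennreal (exp (- s * u) * (exp u - 1)) * indicator {0..} u \<partial>lborel) =
      0 - (exp (- s * 0) / s - exp ((1 - s) * 0) / (s - 1))"
  proof (intro nn_integral_FTC_atLeast)
    fix u :: real
    have "((\<lambda>u. exp (- s * u) / s - exp ((1 - s) * u) / (s - 1)) has_real_derivative
      (exp (- s * u) * - s) / s - (exp ((1 - s) * u) * (1 - s)) / (s - 1)) (at u)"
      by (intro derivative_intros DERIV_cdivide) (auto intro!: derivative_eq_intros)
    also have "(exp (- s * u) * - s) / s - (exp ((1 - s) * u) * (1 - s)) / (s - 1) = exp (- s * u) * (exp u - 1)"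
    proof -
      have "exp ((1 - s) * u) = exp (- s * u) * exp u" by (simp add: algebra_simps flip: exp_add)
      thus ?thesis using s by (simp add: divide_simps) (simp add: algebra_simps)
    qed
    finally show "((\<lambda>u. exp (- s * u) / s - exp ((1 - s) * u) / (s - 1)) has_real_derivative exp (- s * u) * (exp u - 1)) (at u)" .
  qed (use s in auto)
  also have "0 - (exp (- s * 0) / s - exp ((1 - s) * 0) / (s - 1)) = 1 / (s * (s - 1))"
    using s by (simp add: field_simps)
  finally show ?thesis .
qed

text \<open>The power series of cosh has only even powers and nonnegative terms, so it can be
  integrated termwise. This is the source of the expansion in (s - 1/2)^2.\<close>

lemma moment_series:
  "(\<Sum>j. ennreal (z ^ (2 * j)) * moment_nn j) =
    (\<integral>\<^sup>+u. ennreal (4 * exp (u / 2) * theta_tail u * cosh (z * u)) * indicator {0..} u \<partial>lborel)"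
proof -
  have th: "ennreal (theta_tail u) = (\<Sum>n. ennreal (gauss n u))" for u
    unfolding theta_tail_def by (intro suminf_ennreal2[symmetric] summable_gauss less_imp_le gauss_pos)
  have ch: "ennreal (cosh (z * u)) = (\<Sum>j. ennreal (z ^ (2 * j) * u ^ (2 * j) / fact (2 * j)))" for u
  proof -
    have "(\<lambda>n. if even n then (z * u) ^ n /\<^sub>R fact n else 0) sums cosh (z * u)"
      by (rule cosh_converges)
    moreover have "(\<lambda>n. if even n then (z * u) ^ n /\<^sub>R fact n else 0) = (\<lambda>n. if n \<in> range (\<lambda>j. 2 * j) then (z * u) ^ n / fact n else 0)"
      by (auto simp: fun_eq_iff divide_inverse mult.commute elim: evenE)
    ultimately have "(\<lambda>j. (z * u) ^ (2 * j) / fact (2 * j)) sums cosh (z * u)"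
      by (subst (asm) sums_mono_reindex[of "\<lambda>j. 2 * j", symmetric]) (auto simp: strict_mono_def divide_inverse mult.commute)
    hence "(\<lambda>j. z ^ (2 * j) * u ^ (2 * j) / fact (2 * j)) sums cosh (z * u)" by (simp add: power_mult_distrib)
    thus ?thesis by (subst suminf_ennreal2) (auto simp: sums_iff)
  qed
  have "(\<Sum>j. ennreal (z ^ (2 * j)) * moment_nn j) =
    (\<Sum>j. \<Sum>n. \<integral>\<^sup>+u. ennreal (z ^ (2 * j)) * (ennreal (xi_kernel n u * u ^ (2 * j) / fact (2 * j)) * indicator {0..} u) \<partial>lborel)"
    unfolding moment_nn_def moment_term_def by (simp add: ennreal_suminf_cmult nn_integral_cmult)
  also have "\<dots> = (\<integral>\<^sup>+u. (\<Sum>j. \<Sum>n. ennreal (z ^ (2 * j)) * (ennreal (xi_kernel n u * u ^ (2 * j) / fact (2 * j)) * indicator {0..} u)) \<partial>lborel)"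
  proof -
    have "(\<Sum>n. \<integral>\<^sup>+u. ennreal (z ^ (2 * j)) * (ennreal (xi_kernel n u * u ^ (2 * j) / fact (2 * j)) * indicator {0..} u) \<partial>lborel) =
      (\<integral>\<^sup>+u. (\<Sum>n. ennreal (z ^ (2 * j)) * (ennreal (xi_kernel n u * u ^ (2 * j) / fact (2 * j)) * indicator {0..} u)) \<partial>lborel)" for j
      by (rule nn_integral_suminf[symmetric]) measurable
    thus ?thesis by (simp only:) (rule nn_integral_suminf[symmetric], measurable)
  qed
  also have "\<dots> = (\<integral>\<^sup>+u. ennreal (4 * exp (u / 2) * theta_tail u * cosh (z * u)) * indicator {0..} u \<partial>lborel)"
  proof (intro nn_integral_cong)
    fix u
    have "ennreal (z ^ (2 * j)) * (ennreal (xi_kernel n u * u ^ (2 * j) / fact (2 * j)) * indicator {0..} u)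
      = (ennreal (4 * exp (u / 2)) * ennreal (z ^ (2 * j) * u ^ (2 * j) / fact (2 * j)) * indicator {0..} u) * ennreal (gauss n u)" for n j
      using gauss_pos[of n u] by (simp add: xi_kernel_def mult_ac flip: ennreal_mult' ennreal_mult'' split: split_indicator)
    hence "(\<Sum>j. \<Sum>n. ennreal (z ^ (2 * j)) * (ennreal (xi_kernel n u * u ^ (2 * j) / fact (2 * j)) * indicator {0..} u))
      = (\<Sum>j. (ennreal (4 * exp (u / 2)) * indicator {0..} u * ennreal (theta_tail u)) * ennreal (z ^ (2 * j) * u ^ (2 * j) / fact (2 * j)))"
      by (simp add: ennreal_suminf_cmult th mult_ac)
    also have "\<dots> = ennreal (4 * exp (u / 2)) * indicator {0..} u * ennreal (theta_tail u) * ennreal (cosh (z * u))"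
      by (simp only: ennreal_suminf_cmult ch)
    also have "\<dots> = ennreal (4 * exp (u / 2) * theta_tail u * cosh (z * u)) * indicator {0..} u"
      by (simp add: ennreal_mult theta_tail_nonneg mult_ac split: split_indicator)
    finally show "(\<Sum>j. \<Sum>n. ennreal (z ^ (2 * j)) * (ennreal (xi_kernel n u * u ^ (2 * j) / fact (2 * j)) * indicator {0..} u))
      = ennreal (4 * exp (u / 2) * theta_tail u * cosh (z * u)) * indicator {0..} u" .
  qed
  finally show ?thesis .
qed

text \<open>Riemann's argument: the Mellin integral is split at u = 0, the negative half is
  reflected, and the theta transformation turns it into the s -> 1 - s counterpart of the positive
  half plus the pole term.\<close>

lemma completed_zeta_nn:
  assumes s: "s > 1"
  shows "(\<Sum>n. ennreal (pi powr (- s / 2) * Gamma (s / 2) * real (Suc n) powr (- s))) =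
    (\<Sum>j. ennreal ((s - 1 / 2) ^ (2 * j)) * moment_nn j) + ennreal (1 / (s * (s - 1)))"
proof -
  let ?I = "\<lambda>f. (\<integral>\<^sup>+u. ennreal (f u) * indicator {0..} u \<partial>lborel)"
  have "(\<Sum>n. ennreal (pi powr (- s / 2) * Gamma (s / 2) * real (Suc n) powr (- s))) =
      (\<Sum>n. \<integral>\<^sup>+u. ennreal (2 * exp (s * u) * gauss n u) \<partial>lborel)"
    using s by (simp add: mellin_gauss)
  also have "\<dots> = (\<integral>\<^sup>+u. (\<Sum>n. ennreal (2 * exp (s * u) * gauss n u)) \<partial>lborel)"
    by (subst nn_integral_suminf) auto
  also have "(\<lambda>u. \<Sum>n. ennreal (2 * exp (s * u) * gauss n u)) = (\<lambda>u. ennreal (2 * exp (s * u) * theta_tail u))"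
    unfolding theta_tail_def
    by (intro ext, subst suminf_ennreal2) (auto intro!: summable_mult summable_gauss less_imp_le gauss_pos mult_pos_pos simp: suminf_mult summable_gauss)
  also have "(\<integral>\<^sup>+u. ennreal (2 * exp (s * u) * theta_tail u) \<partial>lborel) =
     (\<integral>\<^sup>+u. (ennreal (2 * exp (s * u) * theta_tail u) * indicator {0..} u + ennreal (2 * exp (s * u) * theta_tail u) * indicator {..<0} u) \<partial>lborel)"
    by (intro nn_integral_cong) (auto split: split_indicator)
  also have "\<dots> = ?I (\<lambda>u. 2 * exp (s * u) * theta_tail u) + (\<integral>\<^sup>+u. ennreal (2 * exp (s * u) * theta_tail u) * indicator {..<0} u \<partial>lborel)"
    by (rule nn_integral_add) auto
  also have "(\<integral>\<^sup>+u. ennreal (2 * exp (s * u) * theta_tail u) * indicator {..<0} u \<partial>lborel)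
     = (\<integral>\<^sup>+u. ennreal (2 * exp (s * (- u)) * theta_tail (- u)) * indicator {..<0} (- u) \<partial>lborel)"
    using nn_integral_real_affine[of "\<lambda>u. ennreal (2 * exp (s * u) * theta_tail u) * indicator {..<0} u" "-1" 0] by simp
  also have "\<dots> = ?I (\<lambda>u. 2 * exp (s * (- u)) * theta_tail (- u))"
    \<comment> \<open>The reflected negative half-line lacks the point 0, a null set.\<close>
    by (rule nn_integral_cong_AE, rule AE_mp[OF AE_lborel_singleton[of 0]], rule AE_I2) (auto split: split_indicator)
  also have "\<dots> = (\<integral>\<^sup>+u. (ennreal (2 * exp ((1 - s) * u) * theta_tail u) * indicator {0..} u + ennreal (exp (- s * u) * (exp u - 1)) * indicator {0..} u) \<partial>lborel)"
  proof (intro nn_integral_cong)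
    fix u :: real
    have "2 * exp (s * (- u)) * theta_tail (- u) = 2 * exp ((1 - s) * u) * theta_tail u + exp (- s * u) * (exp u - 1)"
      unfolding theta_tail_uminus by (simp add: algebra_simps exp_diff exp_minus) (simp add: field_simps)
    thus "ennreal (2 * exp (s * (- u)) * theta_tail (- u)) * indicator {0..} u =
      ennreal (2 * exp ((1 - s) * u) * theta_tail u) * indicator {0..} u + ennreal (exp (- s * u) * (exp u - 1)) * indicator {0..} u"
      using theta_tail_nonneg[of u] by (auto simp: ennreal_plus split: split_indicator)
  qed
  also have "\<dots> = ?I (\<lambda>u. 2 * exp ((1 - s) * u) * theta_tail u) + ennreal (1 / (s * (s - 1)))"
    by (subst nn_integral_add) (auto simp: nn_integral_exp_diff[OF s, simplified])
  also have "?I (\<lambda>u. 2 * exp (s * u) * theta_tail u) + (?I (\<lambda>u. 2 * exp ((1 - s) * u) * theta_tail u) + ennreal (1 / (s * (s - 1))))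
    = (?I (\<lambda>u. 2 * exp (s * u) * theta_tail u) + ?I (\<lambda>u. 2 * exp ((1 - s) * u) * theta_tail u)) + ennreal (1 / (s * (s - 1)))"
    by (simp add: add.assoc)
  also have "?I (\<lambda>u. 2 * exp (s * u) * theta_tail u) + ?I (\<lambda>u. 2 * exp ((1 - s) * u) * theta_tail u) =
    ?I (\<lambda>u. 4 * exp (u / 2) * theta_tail u * cosh ((s - 1 / 2) * u))"
  proof (subst nn_integral_add[symmetric])
    have "2 * exp (s * u) * theta_tail u + 2 * exp ((1 - s) * u) * theta_tail u = 4 * exp (u / 2) * theta_tail u * cosh ((s - 1 / 2) * u)" for u
    proof -
      have "exp (s * u) = exp (u / 2) * exp ((s - 1 / 2) * u)" "exp ((1 - s) * u) = exp (u / 2) * exp (- ((s - 1 / 2) * u))"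
        by (simp_all add: algebra_simps flip: exp_add)
      thus ?thesis by (simp add: cosh_field_def algebra_simps)
    qed
    thus "(\<integral>\<^sup>+u. ennreal (2 * exp (s * u) * theta_tail u) * indicator {0..} u + ennreal (2 * exp ((1 - s) * u) * theta_tail u) * indicator {0..} u \<partial>lborel) =
      ?I (\<lambda>u. 4 * exp (u / 2) * theta_tail u * cosh ((s - 1 / 2) * u))"
      using theta_tail_nonneg by (intro nn_integral_cong) (auto simp flip: ennreal_plus split: split_indicator)
  qed auto
  finally show ?thesis by (simp add: moment_series)
qed

text \<open>Integration by parts as an inequality: over [0, N] the boundary term W N - W 0 is
  nonnegative, and N tends to infinity by monotone convergence. Neither decay of W nor finiteness of
  the integrals enters.\<close>

lemma nn_integral_le_of_primitive:
  fixes f g w W :: "real \<Rightarrow> real"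
  assumes cont: "continuous_on UNIV f" "continuous_on UNIV g"
    and nonneg: "\<And>u. u \<ge> 0 \<Longrightarrow> 0 \<le> f u" "\<And>u. u \<ge> 0 \<Longrightarrow> 0 \<le> g u"
    and W: "\<And>u. (W has_real_derivative w u) (at u)" "\<And>u. u \<ge> 0 \<Longrightarrow> w u \<le> f u - g u" "\<And>u. u \<ge> 0 \<Longrightarrow> W u \<ge> W 0"
  shows "(\<integral>\<^sup>+u. ennreal (g u) * indicator {0..} u \<partial>lborel) \<le> (\<integral>\<^sup>+u. ennreal (f u) * indicator {0..} u \<partial>lborel)"
proof -
  let ?I = "\<lambda>h A. (\<integral>\<^sup>+u. ennreal (h u) * indicator A u \<partial>lborel)"
  have meas [measurable]: "f \<in> borel_measurable borel" "g \<in> borel_measurable borel"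
    using cont by (auto intro: borel_measurable_continuous_onI)
  have le: "?I g {0..real N} \<le> ?I f {0..}" for N
  proof -
    have int: "f integrable_on {0..real N}" "g integrable_on {0..real N}"
      using cont by (auto intro!: integrable_continuous_real intro: continuous_on_subset)
    have "(w has_integral (W (real N) - W 0)) {0..real N}"
      using W(1) by (intro fundamental_theorem_of_calculus) (auto simp: has_real_derivative_iff_has_vector_derivative[symmetric] intro: has_field_derivative_at_within)
    moreover have "((\<lambda>u. f u - g u) has_integral (integral {0..real N} f - integral {0..real N} g)) {0..real N}"
      using int by (intro has_integral_diff integrable_integral)
    ultimately have "W (real N) - W 0 \<le> integral {0..real N} f - integral {0..real N} g"
      by (rule has_integral_le) (use W in auto)
    hence "integral {0..real N} g \<le> integral {0..real N} f" using W(3)[of "real N"] by simp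
    hence "?I g {0..real N} \<le> ?I f {0..real N}"
      using int nonneg by (subst (1 2) nn_integral_has_integral_lebesgue'[OF _ integrable_integral]) (auto intro: ennreal_leI)
    also have "\<dots> \<le> ?I f {0..}" by (intro nn_integral_mono) (auto split: split_indicator)
    finally show ?thesis .
  qed
  have "(SUP N. ennreal (g u) * indicator {0..real N} u) = ennreal (g u) * indicator {0..} u" for u
  proof (cases "u \<ge> 0")
    case True
    obtain N where "u \<le> real N" using real_arch_simple by blast
    show ?thesis
    proof (rule antisym)
      show "(SUP N. ennreal (g u) * indicator {0..real N} u) \<le> ennreal (g u) * indicator {0..} u"
        by (intro SUP_least) (auto split: split_indicator)
      have "ennreal (g u) * indicator {0..} u = ennreal (g u) * indicator {0..real N} u"
        using True \<open>u \<le> real N\<close> by simp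
      also have "\<dots> \<le> (SUP N. ennreal (g u) * indicator {0..real N} u)" by (rule SUP_upper) simp
      finally show "ennreal (g u) * indicator {0..} u \<le> (SUP N. ennreal (g u) * indicator {0..real N} u)" .
    qed
  qed simp
  hence "?I g {0..} = (\<integral>\<^sup>+u. (SUP N. ennreal (g u) * indicator {0..real N} u) \<partial>lborel)" by simp
  also have "\<dots> = (SUP N. ?I g {0..real N})"
    by (rule nn_integral_monotone_convergence_SUP) (auto simp: incseq_def le_fun_def split: split_indicator)
  also have "\<dots> \<le> ?I f {0..}" by (intro SUP_least le)
  finally show ?thesis .
qed

definition rate :: "nat \<Rightarrow> real \<Rightarrow> real" where
  "rate n u = pi * (real (Suc n))\<^sup>2 * exp (2 * u)"

lemma rate_gt: "u \<ge> 0 \<Longrightarrow> rate n u > 3"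
proof -
  assume "u \<ge> 0"
  hence "1 * 1 \<le> (real (Suc n))\<^sup>2 * exp (2 * u)" by (intro mult_mono) (auto simp: one_le_power)
  hence "pi * 1 \<le> pi * ((real (Suc n))\<^sup>2 * exp (2 * u))" by (intro mult_left_mono) auto
  hence "pi \<le> rate n u" by (simp add: rate_def mult.assoc)
  thus ?thesis using pi_gt3 by simp
qed

lemma DERIV_rate: "(rate n has_real_derivative 2 * rate n u) (at u)"
  unfolding rate_def by (auto intro!: derivative_eq_intros)

lemma DERIV_xi_kernel: "(xi_kernel n has_real_derivative (1 / 2 - 2 * rate n u) * xi_kernel n u) (at u)"
  unfolding xi_kernel_def gauss_def rate_def[symmetric]
  by (auto intro!: derivative_eq_intros DERIV_rate simp: algebra_simps)

lemma xi_kernel_pos: "xi_kernel n u > 0"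
  by (simp add: xi_kernel_def gauss_pos)

text \<open>Two integrations by parts, since \<open>k'' = (1/4 + 4 \<rho>\<^sup>2 - 6 \<rho>) k\<close> for the kernel \<open>k\<close> and its rate \<open>\<rho> > 3\<close>.\<close>
lemma moment_term_Suc_le: "ennreal (5 / 4) * moment_term n (Suc j) \<le> moment_term n j"
proof -
  let ?k = "xi_kernel n" and ?r = "rate n"
  \<comment> \<open>With e_m = u^m / m! this is k e_(2j+1) - k' e_(2j+2), so that W' = k e_(2j) -
    k'' e_(2j+2), which is w.\<close>
  define W where "W u = ?k u * (u ^ (2 * j + 1) / fact (2 * j + 1)) + (2 * ?r u - 1 / 2) * ?k u * (u ^ (2 * j + 2) / fact (2 * j + 2))" for u
  define w where "w u = ?k u * (u ^ (2 * j) / fact (2 * j)) - ((2 * ?r u - 1 / 2)\<^sup>2 - 4 * ?r u) * ?k u * (u ^ (2 * j + 2) / fact (2 * j + 2))" for u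
  have D: "((\<lambda>u. u ^ Suc m / fact (Suc m)) has_real_derivative u ^ m / fact m) (at u)" for m and u :: real
  proof -
    have "((\<lambda>u. u ^ Suc m / fact (Suc m)) has_real_derivative (real (Suc m) * u ^ m) / fact (Suc m)) (at u)"
      by (rule DERIV_cdivide) (rule DERIV_cong[OF DERIV_pow], simp)
    thus ?thesis by (simp only: fact_Suc of_nat_mult) (simp del: of_nat_Suc)
  qed
  have "(W has_real_derivative w u) (at u)" for u
  proof -
    have "(W has_real_derivative (1 / 2 - 2 * ?r u) * ?k u * (u ^ (2 * j + 1) / fact (2 * j + 1)) + u ^ (2 * j) / fact (2 * j) * ?k u +
      ((2 * (2 * ?r u) * ?k u + (1 / 2 - 2 * ?r u) * ?k u * (2 * ?r u - 1 / 2)) * (u ^ (2 * j + 2) / fact (2 * j + 2)) +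
       u ^ (2 * j + 1) / fact (2 * j + 1) * ((2 * ?r u - 1 / 2) * ?k u))) (at u)"
    proof -
      have D1: "((\<lambda>u. u ^ (2 * j + 1) / fact (2 * j + 1)) has_real_derivative u ^ (2 * j) / fact (2 * j)) (at u)"
        and D2: "((\<lambda>u. u ^ (2 * j + 2) / fact (2 * j + 2)) has_real_derivative u ^ (2 * j + 1) / fact (2 * j + 1)) (at u)"
        using D[of "2 * j" u] D[of "2 * j + 1" u] by (simp_all only: Suc_eq_plus1 add.assoc one_add_one)
      have D3: "((\<lambda>u. (2 * ?r u - 1 / 2) * ?k u) has_real_derivative 2 * (2 * ?r u) * ?k u + (1 / 2 - 2 * ?r u) * ?k u * (2 * ?r u - 1 / 2)) (at u)"
        by (intro DERIV_mult DERIV_xi_kernel) (auto intro!: derivative_eq_intros DERIV_rate)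
      show ?thesis unfolding W_def by (intro DERIV_add DERIV_mult D1 D2 D3 DERIV_xi_kernel)
    qed
    thus ?thesis
      by (rule DERIV_cong) (simp only: w_def power2_eq_square ring_distribs, simp add: algebra_simps)
  qed
  moreover have "w u \<le> ?k u * u ^ (2 * j) / fact (2 * j) - 5 / 4 * (?k u * u ^ (2 * Suc j) / fact (2 * Suc j))" if u: "u \<ge> 0" for u
  proof -
    \<comment> \<open>This makes k'' at least 18 k; the constant 5/4 is far from sharp, since
      positivity of the Taylor coefficients only asks for more than 1/4.\<close>
    have "2 * ?r u * (2 * ?r u - 3) \<ge> 6 * 3" using rate_gt[OF u, of n] by (intro mult_mono) auto
    hence "5 / 4 \<le> (2 * ?r u - 1 / 2)\<^sup>2 - 4 * ?r u" by (simp add: power2_eq_square algebra_simps)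
    hence "5 / 4 * (?k u * (u ^ (2 * j + 2) / fact (2 * j + 2))) \<le> ((2 * ?r u - 1 / 2)\<^sup>2 - 4 * ?r u) * (?k u * (u ^ (2 * j + 2) / fact (2 * j + 2)))"
      using xi_kernel_pos[of n u] u by (intro mult_right_mono) auto
    thus ?thesis by (simp add: w_def mult.assoc)
  qed
  moreover have "W u \<ge> W 0" if u: "u \<ge> 0" for u
    using u rate_gt[OF u, of n] xi_kernel_pos[of n u] by (auto simp: W_def intro!: add_nonneg_nonneg mult_nonneg_nonneg)
  moreover have "continuous_on UNIV ?k"
    using DERIV_xi_kernel by (intro continuous_at_imp_continuous_on ballI DERIV_isCont) blast
  ultimately have "(\<integral>\<^sup>+u. ennreal (5 / 4 * (?k u * u ^ (2 * Suc j) / fact (2 * Suc j))) * indicator {0..} u \<partial>lborel)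
      \<le> (\<integral>\<^sup>+u. ennreal (?k u * u ^ (2 * j) / fact (2 * j)) * indicator {0..} u \<partial>lborel)"
    by (intro nn_integral_le_of_primitive[where W = W and w = w])
      (auto intro!: continuous_intros divide_nonneg_nonneg mult_nonneg_nonneg simp: less_imp_le[OF xi_kernel_pos])
  also have "(\<integral>\<^sup>+u. ennreal (5 / 4 * (?k u * u ^ (2 * Suc j) / fact (2 * Suc j))) * indicator {0..} u \<partial>lborel) =
    (\<integral>\<^sup>+u. ennreal (5 / 4) * (ennreal (?k u * u ^ (2 * Suc j) / fact (2 * Suc j)) * indicator {0..} u) \<partial>lborel)"
  proof -
    have "ennreal (5 / 4 * y) = ennreal (5 / 4) * ennreal y" for y by (rule ennreal_mult') simp
    thus ?thesis by (simp only: mult.assoc)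
  qed
  also have "\<dots> = ennreal (5 / 4) * moment_term n (Suc j)"
    unfolding moment_term_def by (rule nn_integral_cmult) measurable
  finally show ?thesis by (simp only: moment_term_def)
qed

lemma moment_nn_Suc_le: "ennreal (5 / 4) * moment_nn (Suc j) \<le> moment_nn j"
  unfolding moment_nn_def ennreal_suminf_cmult[symmetric] by (intro suminf_le moment_term_Suc_le) auto

text \<open>A rough bound that makes the constant Taylor coefficient 1/2 - \<open>moment 0\<close> /
  8 positive. It uses pi (n + 1)^2 exp (2 u) >= 3 (n + 1) (1 + 2 u).\<close>

lemma moment_nn_0_le: "moment_nn 0 \<le> 1"
proof -
  have "moment_term n 0 \<le> ennreal (exp (- 1 * real (Suc n)))" for n
  proof -
    have "moment_term n 0 = (\<integral>\<^sup>+u. ennreal (xi_kernel n u) * indicator {0..} u \<partial>lborel)" by (simp add: moment_term_def)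
    also have "\<dots> \<le> (\<integral>\<^sup>+u. ennreal (4 * exp (- (3 * real (Suc n)))) * (ennreal (exp (- 4 * u)) * indicator {0..} u) \<partial>lborel)"
    proof (intro nn_integral_mono)
      fix u :: real
      have "xi_kernel n u \<le> 4 * exp (- (3 * real (Suc n))) * exp (- 4 * u)" if u: "u \<ge> 0"
      proof -
        have "3 * (real (Suc n) * (1 + 2 * u)) \<le> pi * ((real (Suc n))\<^sup>2 * exp (2 * u))"
          using pi_gt3 u exp_ge_add_one_self[of "2 * u"] self_le_power[of "real (Suc n)" 2] by (intro mult_mono) auto
        moreover have "6 * u \<le> 6 * u * real (Suc n)" using u mult_left_mono[of 1 "real (Suc n)" "6 * u"] by simp
        moreover have "3 * (real (Suc n) * (1 + 2 * u)) = 3 * real (Suc n) + 6 * u * real (Suc n)" by (simp add: algebra_simps)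
        moreover have "pi * ((real (Suc n))\<^sup>2 * exp (2 * u)) = pi * (real (Suc n))\<^sup>2 * exp (2 * u)" by simp
        ultimately have "u / 2 - pi * (real (Suc n))\<^sup>2 * exp (2 * u) \<le> - (3 * real (Suc n)) - 4 * u"
          using u by linarith
        hence "exp (u / 2 - pi * (real (Suc n))\<^sup>2 * exp (2 * u)) \<le> exp (- (3 * real (Suc n)) - 4 * u)" by simp
        moreover have "xi_kernel n u = 4 * exp (u / 2 - pi * (real (Suc n))\<^sup>2 * exp (2 * u))"
          unfolding xi_kernel_def gauss_def by (simp only: mult.assoc exp_add[symmetric] add_uminus_conv_diff)
        moreover have "4 * exp (- (3 * real (Suc n))) * exp (- 4 * u) = 4 * exp (- (3 * real (Suc n)) - 4 * u)"
          by (simp only: mult.assoc exp_add[symmetric] add_uminus_conv_diff mult_minus_left)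
        ultimately show ?thesis by linarith
      qed
      thus "ennreal (xi_kernel n u) * indicator {0..} u \<le> ennreal (4 * exp (- (3 * real (Suc n)))) * (ennreal (exp (- 4 * u)) * indicator {0..} u)"
        by (auto simp flip: ennreal_mult' intro!: ennreal_leI split: split_indicator)
    qed
    also have "\<dots> = ennreal (4 * exp (- (3 * real (Suc n)))) * ennreal (1 / 4)"
      by (subst nn_integral_cmult) (use nn_integral_exp_atLeast[of 4] in auto)
    also have "\<dots> = ennreal (exp (- (3 * real (Suc n))))" by (simp flip: ennreal_mult')
    also have "\<dots> \<le> ennreal (exp (- 1 * real (Suc n)))" by (intro ennreal_leI) simp
    finally show ?thesis .
  qed
  hence "moment_nn 0 \<le> (\<Sum>n. ennreal (exp (- 1 * real (Suc n))))" unfolding moment_nn_def by (intro suminf_le) auto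
  also have "\<dots> = ennreal (\<Sum>n. exp (- 1 * real (Suc n)))"
    by (intro suminf_ennreal2 summable_exp_neg_linear) auto
  also have "(\<Sum>n. exp (- 1 * real (Suc n))) = (\<Sum>n. exp (-1) * exp (-1) ^ n)"
    by (intro suminf_cong) (simp add: exp_of_nat_mult[symmetric] exp_add[symmetric] algebra_simps)
  also have "\<dots> = exp (-1) / (1 - exp (-1) :: real)" by (subst suminf_mult) (auto simp: suminf_geometric intro!: summable_geometric)
  also have "\<dots> \<le> 1" using exp_ge_add_one_self[of "1::real"] by (simp add: exp_minus field_simps)
  finally show ?thesis by (simp add: ennreal_leI one_ennreal.rep_eq)
qed

lemma moment_nn_pos: "moment_nn j > 0"
proof -
  \<comment> \<open>A lower bound of the integrand on [1, 2]: \<open>gauss 0\<close> decreases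
    there, and the division by 4 >= e compensates for exp (u / 2).\<close>
  define c where "c = xi_kernel 0 2 / 4 / fact (2 * j)"
  have c: "c > 0" by (simp add: c_def xi_kernel_pos)
  have "xi_kernel 0 u * u ^ (2 * j) / fact (2 * j) \<ge> c" if "u \<in> {1..2}" for u
  proof -
    have "xi_kernel 0 2 / 4 \<le> xi_kernel 0 u"
    proof -
      have "gauss 0 2 \<le> gauss 0 u" using that by (simp add: gauss_def)
      moreover have "exp (2 / 2) / 4 \<le> exp (u / 2 :: real)"
      proof -
        have "exp (1::real) \<le> 4" using exp_le by simp
        hence "exp (1::real) / 4 \<le> 1" by simp
        also have "\<dots> \<le> exp (u / 2)" using that by simp
        finally show ?thesis by simp
      qed
      ultimately have "exp (2 / 2) / 4 * gauss 0 2 \<le> exp (u / 2) * gauss 0 u"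
        using gauss_pos[of 0 2] by (intro mult_mono) (auto simp: less_imp_le)
      thus ?thesis by (simp add: xi_kernel_def)
    qed
    moreover have "1 \<le> u ^ (2 * j)" using that by (intro one_le_power) auto
    ultimately have "xi_kernel 0 2 / 4 * 1 \<le> xi_kernel 0 u * u ^ (2 * j)"
      using xi_kernel_pos[of 0 u] by (intro mult_mono) auto
    thus ?thesis unfolding c_def by (intro divide_right_mono) auto
  qed
  hence "(\<integral>\<^sup>+u. ennreal c * indicator {1..2::real} u \<partial>lborel) \<le> moment_term 0 j"
    unfolding moment_term_def by (intro nn_integral_mono) (auto split: split_indicator intro: ennreal_leI)
  hence "ennreal c \<le> moment_term 0 j" by (simp add: nn_integral_cmult_indicator)
  moreover have "0 < ennreal c" using c by simp
  ultimately have "0 < moment_term 0 j" by (rule less_le_trans[rotated])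
  also have "\<dots> = (\<Sum>n<1. moment_term n j)" by simp
  also have "\<dots> \<le> moment_nn j" unfolding moment_nn_def by (rule sum_le_suminf) auto
  finally show ?thesis .
qed

section \<open>The zeta and xi functions\<close>

definition moment :: "nat \<Rightarrow> real" where
  "moment j = enn2real (moment_nn j)"

definition zeta_real :: "real \<Rightarrow> real" where
  "zeta_real s = (\<Sum>n. real (Suc n) powr (- s))"

lemma summable_zeta_real: "s > 1 \<Longrightarrow> summable (\<lambda>n. real (Suc n) powr (- s))"
  using summable_real_powr_iff[of "- s"] summable_Suc_iff[of "\<lambda>n. real n powr (- s)"] by simp

lemma zeta_real_nonneg: "zeta_real s \<ge> 0" if "s > 1"
  unfolding zeta_real_def by (intro suminf_nonneg summable_zeta_real that) auto

lemma completed_zeta_nn':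
  assumes s: "s > 1"
  shows "(\<Sum>j. ennreal ((s - 1 / 2) ^ (2 * j)) * moment_nn j) + ennreal (1 / (s * (s - 1))) =
    ennreal (pi powr (- s / 2) * Gamma (s / 2) * zeta_real s)"
proof -
  have G: "Gamma (s / 2) > 0" using s by (intro Gamma_real_pos) auto
  have "(\<Sum>n. ennreal (pi powr (- s / 2) * Gamma (s / 2) * real (Suc n) powr (- s))) =
    ennreal (\<Sum>n. pi powr (- s / 2) * Gamma (s / 2) * real (Suc n) powr (- s))"
    using G by (intro suminf_ennreal2 summable_mult summable_zeta_real s) auto
  also have "(\<Sum>n. pi powr (- s / 2) * Gamma (s / 2) * real (Suc n) powr (- s)) = pi powr (- s / 2) * Gamma (s / 2) * zeta_real s"
    unfolding zeta_real_def by (intro suminf_mult summable_zeta_real s)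
  finally show ?thesis using completed_zeta_nn[OF s] by simp
qed

text \<open>At s = 2 the whole series is at most a finite number, so each term is finite, and its
  weight (3/2)^(2j) is positive.\<close>

lemma moment_nn_eq: "moment_nn j = ennreal (moment j)"
proof -
  have "ennreal ((2 - 1 / 2) ^ (2 * j)) * moment_nn j \<le> (\<Sum>j. ennreal ((2 - 1 / 2) ^ (2 * j)) * moment_nn j)"
    using sum_le_suminf[of "\<lambda>j. ennreal ((2 - 1 / 2) ^ (2 * j)) * moment_nn j" "{j}"] by simp
  also have "\<dots> \<le> ennreal (pi powr (- 2 / 2) * Gamma (2 / 2) * zeta_real 2)"
    by (subst completed_zeta_nn'[of 2, symmetric]) auto
  also have "\<dots> < top" by simp
  finally have "moment_nn j \<noteq> top" by (auto simp: ennreal_mult_top)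
  thus ?thesis by (simp add: moment_def less_top)
qed

lemma moment_pos: "moment j > 0"
  using moment_nn_pos[of j] by (simp add: moment_nn_eq)

lemma moment_Suc_less: "moment (Suc j) / 4 < moment j"
proof -
  have "ennreal (5 / 4 * moment (Suc j)) \<le> ennreal (moment j)"
  proof -
    have "ennreal (5 / 4 * moment (Suc j)) = ennreal (5 / 4) * ennreal (moment (Suc j))" by (rule ennreal_mult') simp
    thus ?thesis using moment_nn_Suc_le[of j] by (simp only: moment_nn_eq)
  qed
  hence "5 / 4 * moment (Suc j) \<le> moment j" using moment_pos[of j] by (subst (asm) ennreal_le_iff) auto
  thus ?thesis using moment_pos[of "Suc j"] by simp
qed

lemma moment_0_le: "moment 0 \<le> 1"
  using moment_nn_0_le moment_pos[of 0] by (simp add: moment_nn_eq flip: ennreal_1)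

lemma moment_sums:
  assumes s: "s > 1"
  shows "(\<lambda>j. moment j * ((s - 1 / 2)\<^sup>2) ^ j) sums (pi powr (- s / 2) * Gamma (s / 2) * zeta_real s - 1 / (s * (s - 1)))"
proof -
  define f where "f j = (s - 1 / 2) ^ (2 * j) * moment j" for j
  have f0: "f j \<ge> 0" for j using s moment_pos[of j] by (simp add: f_def)
  let ?L = "pi powr (- s / 2) * Gamma (s / 2) * zeta_real s"
  have L: "?L \<ge> 0" using s Gamma_real_pos[of "s / 2"] zeta_real_nonneg[OF s] by simp
  have eq: "(\<Sum>j. ennreal (f j)) + ennreal (1 / (s * (s - 1))) = ennreal ?L"
    using completed_zeta_nn'[OF s] moment_pos s by (simp add: moment_nn_eq f_def ennreal_mult' less_imp_le)
  hence "(\<Sum>j. ennreal (f j)) \<noteq> top" by (metis ennreal_add_eq_top ennreal_neq_top)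
  hence sm: "summable f" using f0 by (intro summable_suminf_not_top) auto
  hence "(\<Sum>j. ennreal (f j)) = ennreal (suminf f)" using f0 by (intro suminf_ennreal2) auto
  hence "ennreal (suminf f + 1 / (s * (s - 1))) = ennreal ?L"
    using eq s suminf_nonneg[OF sm f0] by (subst ennreal_plus) auto
  hence "suminf f + 1 / (s * (s - 1)) = ?L" using L s suminf_nonneg[OF sm f0] by (subst (asm) ennreal_inj) auto
  hence "suminf f = ?L - 1 / (s * (s - 1))" by linarith
  with sm have "f sums (?L - 1 / (s * (s - 1)))" by (simp add: sums_iff)
  moreover have "f = (\<lambda>j. moment j * ((s - 1 / 2)\<^sup>2) ^ j)" by (simp add: f_def fun_eq_iff power_mult)
  ultimately show ?thesis by (simp only:)
qed

lemma summable_moment: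
  assumes "r \<ge> 0"
  shows "summable (\<lambda>j. moment j * r ^ j)"
proof -
  \<comment> \<open>Then s > 1 and (s - 1/2)^2 = (sqrt r + 1)^2 >= r, so the convergent series at s
    dominates.\<close>
  define s where "s = sqrt r + 3 / 2"
  have s: "s > 1" using real_sqrt_ge_zero[OF assms] unfolding s_def by linarith
  have "r = (sqrt r)\<^sup>2" using assms by simp
  also have "\<dots> \<le> (s - 1 / 2)\<^sup>2" using assms by (intro power_mono) (auto simp: s_def)
  finally have r: "r \<le> (s - 1 / 2)\<^sup>2" .
  show ?thesis
  proof (rule summable_comparison_test'[OF sums_summable[OF moment_sums[OF s]]])
    fix j
    have "r ^ j \<le> ((s - 1 / 2)\<^sup>2) ^ j" using r assms by (intro power_mono)
    thus "norm (moment j * r ^ j) \<le> moment j * ((s - 1 / 2)\<^sup>2) ^ j"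
      using moment_pos[of j] assms by (simp add: abs_mult mult_left_mono)
  qed
qed

text \<open>Coefficients of 1/2 + (w - 1/4) / 2 times the moment series. Their positivity for
  positive index is the inequality between consecutive moments.\<close>

definition taylor :: "nat \<Rightarrow> real" where
  "taylor j = (case j of 0 \<Rightarrow> 1 / 2 - moment 0 / 8 | Suc i \<Rightarrow> (moment i - moment (Suc i) / 4) / 2)"

lemma taylor_pos: "taylor j > 0"
  using moment_0_le moment_Suc_less by (auto simp: taylor_def split: nat.split)

text \<open>The function F of the overview: with w = (s - 1/2)^2 one has s (s - 1) = w - 1/4, and
  the summand 1/2 comes from the pole term 1 / (s (s - 1)).\<close>

definition xi_sq :: "complex \<Rightarrow> complex" where
  "xi_sq w = 1 / 2 + (w - 1 / 4) / 2 * (\<Sum>j. of_real (moment j) * w ^ j)"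

lemma moment_complex_summable: "summable (\<lambda>j. norm (of_real (moment j) * w ^ j :: complex))"
proof -
  have "norm (of_real (moment j) * w ^ j :: complex) = moment j * cmod w ^ j" for j
    using moment_pos[of j] by (simp add: norm_mult norm_power)
  thus ?thesis using summable_moment[of "cmod w"] by simp
qed

lemma xi_sq_sums: "(\<lambda>j. of_real (taylor j) * w ^ j) sums xi_sq w"
proof -
  define S where "S = (\<Sum>j. of_real (moment j) * w ^ j)"
  have S: "(\<lambda>j. of_real (moment j) * w ^ j) sums S"
    unfolding S_def by (intro summable_sums summable_norm_cancel[OF moment_complex_summable])
  have "(\<lambda>j. of_real (moment (Suc j)) * w ^ Suc j) sums (S - of_real (moment 0))"
    using S by (subst sums_Suc_iff) simp
  hence "(\<lambda>j. (w * (of_real (moment j) * w ^ j) - of_real (moment (Suc j)) * w ^ Suc j / 4) / 2) sums ((w * S - (S - of_real (moment 0)) / 4) / 2)"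
    by (intro sums_divide sums_diff sums_mult S)
  moreover have "(w * (of_real (moment j) * w ^ j) - of_real (moment (Suc j)) * w ^ Suc j / 4) / 2 = of_real (taylor (Suc j)) * w ^ Suc j" for j
    by (simp add: taylor_def field_simps)
  ultimately have "(\<lambda>j. of_real (taylor (Suc j)) * w ^ Suc j) sums ((w * S - (S - of_real (moment 0)) / 4) / 2)" by simp
  hence "(\<lambda>j. of_real (taylor j) * w ^ j) sums ((w * S - (S - of_real (moment 0)) / 4) / 2 + of_real (taylor 0) * w ^ 0)"
    by (subst (asm) sums_Suc_iff) simp
  also have "(w * S - (S - of_real (moment 0)) / 4) / 2 + of_real (taylor 0) * w ^ 0 = xi_sq w"
    by (simp add: xi_sq_def S_def taylor_def field_simps)
  finally show ?thesis .
qed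

lemma holomorphic_xi_sq: "xi_sq holomorphic_on A"
  using xi_sq_sums by (rule entire_power_series)

definition xi_entire :: "complex \<Rightarrow> complex" where
  "xi_entire s = xi_sq ((s - 1 / 2)\<^sup>2)"

lemma holomorphic_xi_entire [holomorphic_intros]: "xi_entire holomorphic_on A"
  unfolding xi_entire_def
  by (intro holomorphic_on_compose_gen[OF _ holomorphic_xi_sq, unfolded o_def, where t = UNIV] holomorphic_intros) auto

lemma xi_entire_reflect: "xi_entire (1 - s) = xi_entire s"
  by (simp add: xi_entire_def power2_eq_square algebra_simps)

lemma xi_entire_real:
  assumes s: "s > 1"
  shows "xi_entire (of_real s) = of_real (s * (s - 1) / 2 * (pi powr (- s / 2) * Gamma (s / 2) * zeta_real s))"
proof -
  define L where "L = pi powr (- s / 2) * Gamma (s / 2) * zeta_real s"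
  have "(\<lambda>j. complex_of_real (moment j * ((s - 1 / 2)\<^sup>2) ^ j)) sums of_real (L - 1 / (s * (s - 1)))"
    unfolding sums_of_real_iff L_def by (rule moment_sums[OF s])
  hence "(\<Sum>j. of_real (moment j) * (of_real ((s - 1 / 2)\<^sup>2)) ^ j) = complex_of_real (L - 1 / (s * (s - 1)))"
    by (simp add: sums_iff)
  hence "xi_sq (of_real ((s - 1 / 2)\<^sup>2)) = of_real (1 / 2 + ((s - 1 / 2)\<^sup>2 - 1 / 4) / 2 * (L - 1 / (s * (s - 1))))"
    by (simp only: xi_sq_def) simp
  also have "1 / 2 + ((s - 1 / 2)\<^sup>2 - 1 / 4) / 2 * (L - 1 / (s * (s - 1))) = s * (s - 1) / 2 * L"
  proof -
    have "(s - 1 / 2)\<^sup>2 - 1 / 4 = s * (s - 1)" by (simp add: power2_eq_square algebra_simps)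
    moreover have "s * (s - 1) \<noteq> 0" using s by simp
    ultimately show ?thesis by (simp only: right_diff_distrib) simp
  qed
  finally show ?thesis by (simp add: xi_entire_def L_def)
qed

text \<open>Solving the defining relation of \<xi> for zeta, with (s / 2) Gamma (s / 2) = Gamma (s /
  2 + 1). The reciprocal Gamma function is entire, so the only exceptional point is 1, where
  division by zero yields the prescribed value 0.\<close>

definition zeta_cont :: "complex \<Rightarrow> complex" where
  "zeta_cont s = xi_entire s / (s - 1) * (of_real pi powr (s / 2) * rGamma (s / 2 + 1))"

lemma zeta_cont_holomorphic: "zeta_cont holomorphic_on (- {1})"
  unfolding zeta_cont_def by (intro holomorphic_intros) auto

lemma zeta_cont_real:
  assumes s: "s > 1"
  shows "zeta_cont (of_real s) = of_real (zeta_real s)"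
proof -
  have "(of_real pi :: complex) powr (of_real s / 2) = of_real (pi powr (s / 2))"
    using powr_of_real[of pi "s / 2"] by simp
  moreover have "rGamma (of_real s / 2 + 1 :: complex) = of_real (rGamma (s / 2 + 1))"
    using rGamma_complex_of_real[of "s / 2 + 1"] by simp
  ultimately have "zeta_cont (of_real s) = of_real (s * (s - 1) / 2 * (pi powr (- s / 2) * Gamma (s / 2) * zeta_real s) / (s - 1) *
      (pi powr (s / 2) * rGamma (s / 2 + 1)))"
    unfolding zeta_cont_def xi_entire_real[OF s] by simp
  also have "s * (s - 1) / 2 * (pi powr (- s / 2) * Gamma (s / 2) * zeta_real s) / (s - 1) * (pi powr (s / 2) * rGamma (s / 2 + 1))
    = (pi powr (- s / 2) * pi powr (s / 2)) * (Gamma (s / 2) * (s / 2 * rGamma (s / 2 + 1))) * zeta_real s"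
    using s by (simp add: divide_simps)
  also have "pi powr (- s / 2) * pi powr (s / 2) = 1" by (simp flip: powr_add)
  also have "s / 2 * rGamma (s / 2 + 1) = rGamma (s / 2)" by (rule rGamma_plus1)
  also have "Gamma (s / 2) * rGamma (s / 2) = 1"
  proof -
    have "Gamma (s / 2) > 0" using s by (intro Gamma_real_pos) auto
    thus ?thesis by (simp add: rGamma_inverse_Gamma)
  qed
  finally show ?thesis by simp
qed

section \<open>Identification of \<open>riemann_zeta\<close>, \<open>riemann_xi\<close> and
  \<open>xi_coeff\<close>\<close>

lemma norm_dirichlet_term: "cmod (1 / of_nat n powr s) = real n powr (- Re s)"
proof (cases "n = 0")
  case False
  hence "cmod (of_nat n powr s) = real n powr Re s"
    using norm_powr_real_powr[of "of_nat n" s] by simp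
  thus ?thesis by (simp add: norm_divide powr_minus inverse_eq_divide)
qed simp

text \<open>Both sides are holomorphic for Re s > 1 and agree on the real interval (1, 3), which
  accumulates at 2.\<close>

lemma zeta_cont_sums:
  assumes s: "Re s > 1"
  shows "(\<lambda>n. 1 / of_nat (Suc n) powr s) sums zeta_cont s"
proof -
  define S where "S = {s. Re s > 1}"
  have S: "open S" "connected S"
    unfolding S_def by (auto intro!: open_halfspace_Re_gt convex_connected convex_halfspace_Re_gt)
  have D: "((\<lambda>s. 1 / of_nat (Suc n) powr s) has_field_derivative - ln (of_nat (Suc n)) / of_nat (Suc n) powr s) (at s)" for n and s :: complex
    by (auto intro!: derivative_eq_intros simp: field_simps power2_eq_square powr_def exp_not_eq_zero simp del: of_nat_Suc)
  have "\<exists>g g'. \<forall>x\<in>S. (\<lambda>n. 1 / of_nat (Suc n) powr x) sums g x \<and>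
      (\<lambda>n. - ln (of_nat (Suc n)) / of_nat (Suc n) powr x) sums g' x \<and> (g has_field_derivative g' x) (at x)"
  proof (rule series_and_derivative_comparison_complex[OF S(1) D])
    fix x assume "x \<in> S"
    hence x: "Re x > 1" by (simp add: S_def)
    \<comment> \<open>Halfway between 1 and Re x: on the ball of radius (Re x - 1) / 2 real parts
      stay at least \<sigma> > 1, giving one summable majorant.\<close>
    define \<sigma> where "\<sigma> = (1 + Re x) / 2"
    define h where "h n = complex_of_real (real (Suc n) powr (- \<sigma>))" for n
    have "summable h" unfolding h_def summable_complex_of_real by (rule summable_zeta_real) (use x in \<open>simp add: \<sigma>_def\<close>)
    moreover have "range h \<subseteq> \<real>\<^sub>\<ge>\<^sub>0" by (auto simp: h_def)
    moreover have "cmod (1 / of_nat (Suc n) powr y) \<le> cmod (h n)" if "y \<in> ball x ((Re x - 1) / 2)" for n y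
    proof -
      have "Re x - Re y \<le> cmod (x - y)" using complex_Re_le_cmod[of "x - y"] by simp
      hence "\<sigma> \<le> Re y" using that by (simp add: dist_norm \<sigma>_def field_simps)
      thus ?thesis unfolding norm_dirichlet_term h_def by (auto intro: powr_mono)
    qed
    ultimately show "\<exists>d h. 0 < d \<and> summable h \<and> range h \<subseteq> \<real>\<^sub>\<ge>\<^sub>0 \<and>
        (\<forall>\<^sub>F n in sequentially. \<forall>y\<in>ball x d \<inter> S. cmod (1 / of_nat (Suc n) powr y) \<le> cmod (h n))"
      using x by (intro exI[of _ "(Re x - 1) / 2"] exI[of _ h]) auto
  qed
  then obtain g g' where g: "\<And>x. x \<in> S \<Longrightarrow> (\<lambda>n. 1 / of_nat (Suc n) powr x) sums g x"
    and g': "\<And>x. x \<in> S \<Longrightarrow> (g has_field_derivative g' x) (at x)" by blast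
  have "zeta_cont s - g s = 0"
  proof (rule analytic_continuation[of "\<lambda>s. zeta_cont s - g s" S "of_real ` {1<..<3}" "of_real 2"])
    have "g holomorphic_on S" using g' S by (auto simp: holomorphic_on_open)
    moreover have "zeta_cont holomorphic_on S"
      by (rule holomorphic_on_subset[OF zeta_cont_holomorphic]) (auto simp: S_def)
    ultimately show "(\<lambda>s. zeta_cont s - g s) holomorphic_on S" by (intro holomorphic_intros)
    show "of_real 2 islimpt (of_real ` {1<..<3} :: complex set)"
    proof (rule islimpt_isCont_image)
      show "2 islimpt {1<..<3::real}" by (rule interior_limit_point) simp
      show "\<forall>\<^sub>F y in at 2. complex_of_real y \<noteq> of_real 2"
        unfolding of_real_eq_iff eventually_at_filter by simp
    qed auto
    fix z :: complex assume "z \<in> of_real ` {1<..<3}"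
    then obtain x where x: "z = of_real x" "x > 1" by auto
    have "(\<lambda>n. complex_of_real (real (Suc n) powr (- x))) sums of_real (zeta_real x)"
      unfolding sums_of_real_iff zeta_real_def by (intro summable_sums summable_zeta_real x)
    moreover have "complex_of_real (real (Suc n) powr (- x)) = 1 / of_nat (Suc n) powr z" for n
      using powr_of_real[of "real (Suc n)" x] by (simp add: x powr_minus divide_inverse del: of_nat_Suc)
    ultimately have "(\<lambda>n. 1 / of_nat (Suc n) powr z) sums of_real (zeta_real x)" by simp
    moreover have "(\<lambda>n. 1 / of_nat (Suc n) powr z) sums g z" using x by (intro g) (simp add: S_def)
    ultimately have "g z = of_real (zeta_real x)" by (rule sums_unique2[rotated])
    thus "zeta_cont z - g z = 0" using zeta_cont_real[OF x(2)] x(1) by simp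
  qed (use s S in \<open>auto simp: S_def\<close>)
  thus ?thesis using g[of s] s by (simp add: S_def)
qed

lemma riemann_zeta_eq: "riemann_zeta = zeta_cont"
  unfolding riemann_zeta_def
proof (rule the_equality)
  show "zeta_cont holomorphic_on - {1} \<and> (\<forall>s. 1 < Re s \<longrightarrow> (\<lambda>n. 1 / of_nat (Suc n) powr s) sums zeta_cont s) \<and> zeta_cont 1 = 0"
    using zeta_cont_holomorphic zeta_cont_sums by (auto simp: zeta_cont_def)
next
  fix f assume f: "f holomorphic_on - {1} \<and> (\<forall>s. 1 < Re s \<longrightarrow> (\<lambda>n. 1 / of_nat (Suc n) powr s) sums f s) \<and> f 1 = 0"
  have "f s = zeta_cont s" if "s \<noteq> 1" for s
  proof (rule analytic_continuation_open[of "{s. Re s > 1}" "- {1}" f zeta_cont])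
    show "connected (- {1 :: complex})" by (rule connected_punctured_universe) simp
    show "{s. 1 < Re s} \<noteq> {}" by (auto intro!: exI[of _ 2])
    show "f z = zeta_cont z" if "z \<in> {s. 1 < Re s}" for z
    proof -
      from that have z: "1 < Re z" by simp
      hence "(\<lambda>n. 1 / of_nat (Suc n) powr z) sums f z" using f by blast
      thus ?thesis using zeta_cont_sums[OF z] by (rule sums_unique2)
    qed
  qed (use f zeta_cont_holomorphic that in \<open>auto intro: open_halfspace_Re_gt\<close>)
  moreover have "f 1 = zeta_cont 1" using f by (simp add: zeta_cont_def)
  ultimately have "f s = zeta_cont s" for s by (cases "s = 1") auto
  thus "f = zeta_cont" by (rule ext)
qed

lemma xi_formula:
  assumes "s \<noteq> 1" "s / 2 \<notin> \<int>\<^sub>\<le>\<^sub>0"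
  shows "1 / 2 * s * (s - 1) * of_real pi powr (- s / 2) * Gamma (s / 2) * zeta_cont s = xi_entire s"
proof -
  have "of_real pi powr (- s / 2) * of_real pi powr (s / 2) = (1 :: complex)" by (simp flip: powr_add)
  moreover have "Gamma (s / 2) * (s / 2 * rGamma (s / 2 + 1)) = 1"
    unfolding rGamma_plus1 using assms by (simp add: rGamma_inverse_Gamma Gamma_eq_zero_iff)
  moreover have "1 / 2 * s * (s - 1) * of_real pi powr (- s / 2) * Gamma (s / 2) * zeta_cont s =
    (of_real pi powr (- s / 2) * of_real pi powr (s / 2)) * (Gamma (s / 2) * (s / 2 * rGamma (s / 2 + 1))) * xi_entire s"
    using assms by (simp add: zeta_cont_def divide_simps)
  ultimately show ?thesis by simp
qed

text \<open>The exceptional points 1, 0, -2, -4, ... are isolated, so near any s the raw product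
  equals \<open>xi_entire\<close> off s, and \<open>remove_sings\<close> returns the limit.\<close>

lemma riemann_xi_eq: "riemann_xi = xi_entire"
proof
  fix s :: complex
  have "eventually (\<lambda>w. w \<noteq> 1 \<and> w / 2 \<notin> \<int>\<^sub>\<le>\<^sub>0) (at s)"
  proof (intro eventually_conj)
    show "eventually (\<lambda>w. w \<noteq> 1) (at s)"
      using islimpt_finite[of "{1}" s] by (simp add: islimpt_conv_frequently_at frequently_def)
    have "eventually (\<lambda>w. w \<in> ball s 1 - {s}) (at s)" by (intro eventually_at_in_open) auto
    moreover have "finite {w. w \<in> ball s 1 \<and> w / 2 \<in> \<int>\<^sub>\<le>\<^sub>0}"
    proof (rule finite_subset)
      show "{w. w \<in> ball s 1 \<and> w / 2 \<in> \<int>\<^sub>\<le>\<^sub>0} \<subseteq> (\<lambda>i. 2 * of_int i) ` {\<lfloor>- (cmod s + 1)\<rfloor>..0}"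
      proof
        fix w assume "w \<in> {w. w \<in> ball s 1 \<and> w / 2 \<in> \<int>\<^sub>\<le>\<^sub>0}"
        then obtain i where i: "w / 2 = of_int i" "i \<le> 0" "cmod (s - w) < 1" by (auto elim!: nonpos_Ints_cases simp: dist_norm)
        have "real_of_int (- i) * 2 = cmod w"
        proof -
          have "w = of_real (2 * real_of_int i)" using i(1) by (simp add: field_simps)
          thus ?thesis using i(2) by (simp only: norm_of_real)
        qed
        also have "\<dots> \<le> cmod s + 1" using norm_triangle_ineq2[of w s] i(3) by (simp add: norm_minus_commute)
        finally have "- (cmod s + 1) \<le> real_of_int i" using i(2) by simp
        hence "\<lfloor>- (cmod s + 1)\<rfloor> \<le> i" by linarith
        thus "w \<in> (\<lambda>i. 2 * of_int i) ` {\<lfloor>- (cmod s + 1)\<rfloor>..0}"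
          using i by (intro image_eqI[of _ _ i]) (auto simp: field_simps)
      qed
    qed simp
    hence "eventually (\<lambda>w. w \<notin> {w. w \<in> ball s 1 \<and> w / 2 \<in> \<int>\<^sub>\<le>\<^sub>0}) (at s)"
      using islimpt_finite[of "{w. w \<in> ball s 1 \<and> w / 2 \<in> \<int>\<^sub>\<le>\<^sub>0}" s]
      by (simp add: islimpt_conv_frequently_at frequently_def)
    ultimately show "eventually (\<lambda>w. w / 2 \<notin> \<int>\<^sub>\<le>\<^sub>0) (at s)" by eventually_elim auto
  qed
  hence ev: "eventually (\<lambda>w. 1 / 2 * w * (w - 1) * of_real pi powr (- w / 2) * Gamma (w / 2) * riemann_zeta w = xi_entire w) (at s)"
    by eventually_elim (use xi_formula riemann_zeta_eq in auto)
  have "xi_entire \<midarrow>s\<rightarrow> xi_entire s"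
    using holomorphic_on_imp_continuous_on[OF holomorphic_xi_entire[of UNIV]] by (simp add: continuous_on_def)
  hence "(\<lambda>w. 1 / 2 * w * (w - 1) * of_real pi powr (- w / 2) * Gamma (w / 2) * riemann_zeta w) \<midarrow>s\<rightarrow> xi_entire s"
    by (rule Lim_transform_eventually) (use ev in \<open>simp add: eq_commute\<close>)
  thus "riemann_xi s = xi_entire s" unfolding riemann_xi_def by (rule remove_sings_eqI)
qed

lemma xi_coeff_eq: "xi_coeff j = fact j * taylor j"
proof -
  have sums: "(\<lambda>j. of_real (g j) / fact j * z ^ (2 * j)) sums riemann_xi (1 / 2 + z) \<longleftrightarrow>
    (\<lambda>j. of_real (g j / fact j) * (z\<^sup>2) ^ j) sums xi_sq (z\<^sup>2)" for g z
    by (simp add: riemann_xi_eq xi_entire_def power_mult)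
  have "xi_coeff = (\<lambda>j. fact j * taylor j)"
    unfolding xi_coeff_def sums
  proof (rule the_equality)
    show "\<forall>z. (\<lambda>j. complex_of_real (fact j * taylor j / fact j) * (z\<^sup>2) ^ j) sums xi_sq (z\<^sup>2)"
      using xi_sq_sums by simp
    fix g :: "nat \<Rightarrow> real" assume g: "\<forall>z. (\<lambda>j. complex_of_real (g j / fact j) * (z\<^sup>2) ^ j) sums xi_sq (z\<^sup>2)"
    show "g = (\<lambda>j. fact j * taylor j)"
    proof
      fix j
      have "cmod (of_real (g j / fact j) - of_real (taylor j)) \<le> 0"
      \<comment> \<open>Uniqueness of coefficients as Cauchy's estimate with bound 0; every w is a
        square, so the series in z^2 determines the series in w.\<close>
      proof (rule power_series_coeff_bound[where f = "\<lambda>_. 0" and b = "\<lambda>j. of_real (g j / fact j) - of_real (taylor j)"])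
        fix w :: complex
        have "(\<lambda>j. complex_of_real (g j / fact j) * w ^ j) sums xi_sq w"
          using g[rule_format, of "csqrt w"] by (simp only: power2_csqrt)
        from sums_diff[OF this xi_sq_sums[of w]] show "(\<lambda>j. (complex_of_real (g j / fact j) - of_real (taylor j)) * w ^ j) sums 0"
          by (simp only: left_diff_distrib diff_self)
      qed simp
      hence "complex_of_real (g j / fact j) = of_real (taylor j)" by simp
      hence "g j / fact j = taylor j" by (simp only: of_real_eq_iff)
      thus "g j = fact j * taylor j" by (simp add: field_simps)
    qed
  qed
  thus ?thesis by (rule fun_cong)
qed

text \<open>Sieving out the primes one after another multiplies the value of the Dirichlet series by
  \<open>1 - p powr (- s)\<close>, while the sieved series tends to its first term \<open>1\<close>.\<close>
lemma zeta_cont_nonzero: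
  assumes s: "Re s > 1"
  shows "zeta_cont s \<noteq> 0"
proof
  assume zero: "zeta_cont s = 0"
  define f where "f n = 1 / of_nat n powr s" for n :: nat
  define h where "h n = real n powr (- Re s)" for n
  define A where "A N = {n. n > 0 \<and> (\<forall>p. prime p \<longrightarrow> p \<le> N \<longrightarrow> \<not> p dvd n)}" for N :: nat
  have nf: "norm (f n) = h n" for n unfolding f_def h_def by (rule norm_dirichlet_term)
  have sh: "summable h" unfolding h_def using s summable_real_powr_iff[of "- Re s"] by simp
  have f_on: "f summable_on X" for X
    by (rule summable_on_subset_banach[OF norm_summable_imp_summable_on]) (use nf sh in auto)
  have h_on: "h summable_on X" for X
    by (rule summable_on_subset_banach[OF norm_summable_imp_summable_on]) (use sh in \<open>simp_all add: h_def [abs_def]\<close>)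
  have fmult: "f (m * n) = f m * f n" for m n
    by (simp add: f_def powr_times_real)
  \<comment> \<open>When p = N + 1 is prime, A N splits into A (N + 1) and p times A N, so the sum
    over A (N + 1) is 1 - f p times the sum over A N and stays 0.\<close>
  have S: "infsum f (A N) = 0" for N
  proof (induction N)
    case 0
    \<comment> \<open>The index 0 is harmless, because \<open>f 0\<close> is 0 through division by
      zero.\<close>
    have "f sums zeta_cont s" using zeta_cont_sums[OF s] sums_Suc_iff[of f "zeta_cont s"] by (simp add: f_def)
    hence "(f has_sum 0) UNIV" using norm_summable_imp_has_sum[of f] nf sh zero by simp
    hence "(f has_sum 0) (A 0)"
      by (rule has_sum_cong_neutral[THEN iffD1, rotated -1]) (auto simp: A_def f_def dest: prime_gt_0_nat)
    thus ?case by (rule infsumI)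
  next
    case (Suc N)
    show ?case
    proof (cases "prime (Suc N)")
      case False
      hence "A (Suc N) = A N" by (auto simp: A_def le_Suc_eq)
      thus ?thesis using Suc by simp
    next
      case True
      have "A N = A (Suc N) \<union> (\<lambda>m. Suc N * m) ` A N"
      proof (intro equalityI subsetI)
        fix n assume n: "n \<in> A N"
        show "n \<in> A (Suc N) \<union> (\<lambda>m. Suc N * m) ` A N"
        proof (cases "Suc N dvd n")
          case True
          then obtain m where "n = Suc N * m" by auto
          moreover from this have "m \<in> A N" using n by (auto simp: A_def dvd_mult simp del: mult_Suc)
          ultimately show ?thesis by blast
        qed (use n in \<open>auto simp: A_def le_Suc_eq\<close>)
      next
        fix n assume "n \<in> A (Suc N) \<union> (\<lambda>m. Suc N * m) ` A N"
        thus "n \<in> A N"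
        proof
          assume "n \<in> (\<lambda>m. Suc N * m) ` A N"
          then obtain m where m: "m \<in> A N" "n = Suc N * m" by blast
          have "\<not> p dvd n" if p: "prime p" "p \<le> N" for p
          proof
            assume "p dvd n"
            hence "p dvd Suc N \<or> p dvd m" using p m by (simp only: prime_dvd_mult_iff)
            moreover have "\<not> p dvd Suc N" using primes_dvd_imp_eq[OF p(1) True] p(2) by auto
            ultimately show False using m p by (auto simp: A_def)
          qed
          thus ?thesis using m by (auto simp: A_def)
        qed (auto simp: A_def)
      qed
      moreover have "A (Suc N) \<inter> (\<lambda>m. Suc N * m) ` A N = {}"
      proof -
        have "\<not> Suc N dvd n" if "n \<in> A (Suc N)" for n using True that by (auto simp: A_def)
        thus ?thesis using dvd_triv_left by blast
      qed
      ultimately have "infsum f (A N) = infsum f (A (Suc N)) + infsum f ((\<lambda>m. Suc N * m) ` A N)"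
        using infsum_Un_disjoint[OF f_on f_on] by metis
      moreover have "infsum f ((\<lambda>m. Suc N * m) ` A N) = f (Suc N) * infsum f (A N)"
        by (subst infsum_reindex) (auto simp: inj_on_def o_def fmult infsum_cmult_right' simp del: mult_Suc)
      ultimately show ?thesis using Suc by simp
    qed
  qed
  \<comment> \<open>Apart from 1, elements of A N exceed N, so their total has norm below 1 and
    cannot cancel f 1 = 1.\<close>
  obtain N where N: "\<And>n. n \<ge> N \<Longrightarrow> norm (\<Sum>i. h (i + n)) < 1"
    using suminf_exist_split[of 1 h] sh by auto
  have A: "A N = {1} \<union> (A N - {1})" by (auto simp: A_def dest: prime_gt_1_nat)
  have "infsum f (A N) = infsum f {1} + infsum f (A N - {1})"
    by (subst A, rule infsum_Un_disjoint[OF f_on f_on]) auto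
  hence "1 = norm (infsum f (A N - {1}))" using S[of N] by (simp add: f_def add_eq_0_iff)
  also have "\<dots> \<le> infsum h (A N - {1})"
    using norm_infsum_bound[of f "A N - {1}"] h_on by (simp add: nf)
  also have "\<dots> \<le> infsum h {N..}"
  proof (rule infsum_mono2[OF h_on h_on])
    show "A N - {1} \<subseteq> {N..}"
    proof
      fix n assume n: "n \<in> A N - {1}"
      then obtain p where p: "prime p" "p dvd n" using prime_factor_nat[of n] by auto
      hence "\<not> p \<le> N" using n by (auto simp: A_def)
      moreover have "p \<le> n" using p n by (auto simp: A_def intro: dvd_imp_le)
      ultimately show "n \<in> {N..}" by simp
    qed
  qed (simp add: h_def)
  also have "infsum h {N..} = infsum (\<lambda>i. h (i + N)) UNIV"
  proof -
    have "{N..} = (\<lambda>i. i + N) ` UNIV" by (auto simp: image_iff) (metis le_iff_add add.commute)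
    thus ?thesis by (simp add: infsum_reindex o_def)
  qed
  also have "\<dots> = (\<Sum>i. h (i + N))"
  proof (rule infsumI, rule norm_summable_imp_has_sum)
    have "norm (h n) = h n" for n by (simp add: h_def)
    thus "summable (\<lambda>n. norm (h (n + N)))" using sh summable_iff_shift[of h N] by (simp only:)
    show "(\<lambda>i. h (i + N)) sums (\<Sum>i. h (i + N))"
      using sh summable_iff_shift[of h N] by (intro summable_sums) (simp only:)
  qed
  also have "\<dots> < 1" using N[of N] by auto
  finally show False by simp
qed

section \<open>Location of the zeros and order of growth\<close>

lemma xi_entire_zero_strip:
  assumes "xi_entire s = 0"
  shows "0 \<le> Re s" "Re s \<le> 1"
proof -
  have *: "Re s \<le> 1" if "xi_entire s = 0" for s
  proof (rule ccontr)
    assume "\<not> Re s \<le> 1"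
    thus False using zeta_cont_nonzero[of s] that by (simp add: zeta_cont_def)
  qed
  show "Re s \<le> 1" using * assms .
  show "0 \<le> Re s" using *[of "1 - s"] assms by (simp add: xi_entire_reflect)
qed

text \<open>Positive coefficients reduce the bound to real arguments: the moment series at |w| is
  dominated by its value at a real s of size about 2 sqrt |w|, where Gamma (s / 2) is at most N^N
  with N about sqrt |w|. This is below exp (\<epsilon> |w|) for large w.\<close>

lemma xi_sq_growth:
  assumes \<epsilon>: "\<epsilon> > 0"
  shows "\<exists>C. \<forall>w. cmod (xi_sq w) \<le> C * exp (\<epsilon> * cmod w)"
proof -
  define K where "K = zeta_real 2"
  have K: "K \<ge> 0" unfolding K_def by (rule zeta_real_nonneg) simp
  define a where "a N = (1 + (real N)\<^sup>2) * (1 + K * real N powr real N) * exp (- \<epsilon> * (real N - 1)\<^sup>2)" for N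
  have "a \<longlonglongrightarrow> 0" unfolding a_def using \<epsilon> by real_asymp
  hence "Bseq a" using convergentI convergent_imp_Bseq by blast
  then obtain C where C: "\<And>N. norm (a N) \<le> C" unfolding Bseq_def by blast
  have "cmod (xi_sq w) \<le> C * exp (\<epsilon> * cmod w)" for w
  proof -
    define r where "r = sqrt (cmod w)"
    define N where "N = Suc (nat \<lfloor>r\<rfloor>)"
    have r0: "r \<ge> 0" "cmod w = r\<^sup>2" by (simp_all add: r_def)
    have N: "r \<le> real N" "real N - 1 \<le> r" "N \<ge> 1" using r0(1) unfolding N_def by linarith+
    \<comment> \<open>This makes Gamma (s / 2) = N! and gives s - 1/2 >= N >= r.\<close>
    define s where "s = 2 * real N + 2"
    define H where "H = (\<Sum>j. moment j * (cmod w) ^ j)"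
    have s1: "s > 1" by (simp add: s_def)
    have wN: "cmod w \<le> (real N)\<^sup>2" unfolding r0(2) using N r0 by (intro power_mono)
    have H0: "H \<ge> 0" unfolding H_def
      by (intro suminf_nonneg summable_moment mult_nonneg_nonneg less_imp_le[OF moment_pos]) auto
    have "H \<le> (\<Sum>j. moment j * ((s - 1 / 2)\<^sup>2) ^ j)" unfolding H_def
    proof (rule suminf_le)
      fix j
      have "cmod w \<le> (s - 1 / 2)\<^sup>2" unfolding r0(2) using N r0 by (intro power_mono) (auto simp: s_def)
      thus "moment j * cmod w ^ j \<le> moment j * ((s - 1 / 2)\<^sup>2) ^ j"
        using moment_pos[of j] by (intro mult_left_mono power_mono) auto
    qed (auto intro: summable_moment)
    also have "\<dots> = pi powr (- s / 2) * Gamma (s / 2) * zeta_real s - 1 / (s * (s - 1))"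
      using moment_sums[OF s1] by (simp add: sums_iff)
    also have "\<dots> \<le> pi powr (- s / 2) * Gamma (s / 2) * zeta_real s" using s1 by simp
    also have "\<dots> \<le> 1 * (real N powr real N) * K"
    proof (intro mult_mono)
      have "pi powr (- s / 2) \<le> pi powr 0" using s1 pi_gt3 by (intro powr_mono) auto
      thus "pi powr (- s / 2) \<le> 1" by simp
      have "Gamma (s / 2) = fact N" using Gamma_fact[of N, where 'a = real] by (simp add: s_def add_divide_distrib add.commute)
      also have "\<dots> \<le> real N ^ N" using fact_le_power[of N, where 'a = real] by simp
      also have "\<dots> = real N powr real N" using N by (simp add: powr_realpow)
      finally show "Gamma (s / 2) \<le> real N powr real N" .
      show "zeta_real s \<le> K" unfolding K_def zeta_real_def
      proof (intro suminf_le summable_zeta_real)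
        show "real (Suc n) powr - s \<le> real (Suc n) powr - 2" for n
          by (intro powr_mono) (auto simp: s_def)
      qed (use s1 in auto)
      show "0 \<le> zeta_real s" using s1 by (rule zeta_real_nonneg)
      show "0 \<le> Gamma (s / 2)" using s1 Gamma_real_pos[of "s / 2"] by simp
    qed auto
    finally have H: "H \<le> K * real N powr real N" by (simp add: mult.commute)
    have "cmod (\<Sum>j. of_real (moment j) * w ^ j) \<le> H"
    proof -
      have "cmod (\<Sum>j. of_real (moment j) * w ^ j) \<le> (\<Sum>j. cmod (of_real (moment j) * w ^ j))"
        by (rule summable_norm[OF moment_complex_summable])
      also have "(\<lambda>j. cmod (of_real (moment j) * w ^ j)) = (\<lambda>j. moment j * cmod w ^ j)"
        using moment_pos by (auto simp: norm_mult norm_power less_imp_le abs_of_pos)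
      finally show ?thesis by (simp add: H_def)
    qed
    moreover have "cmod (w - 1 / 4) \<le> cmod w + 1 / 4" using norm_triangle_ineq4[of w "1 / 4"] by simp
    ultimately have "cmod ((w - 1 / 4) * (\<Sum>j. of_real (moment j) * w ^ j)) \<le> (cmod w + 1 / 4) * H"
      unfolding norm_mult by (intro mult_mono) auto
    hence "cmod ((w - 1 / 4) * (\<Sum>j. of_real (moment j) * w ^ j) / 2) \<le> (cmod w + 1 / 4) * H / 2"
      unfolding norm_divide by simp
    moreover have "xi_sq w = 1 / 2 + (w - 1 / 4) * (\<Sum>j. of_real (moment j) * w ^ j) / 2" by (simp add: xi_sq_def)
    ultimately have "cmod (xi_sq w) \<le> cmod (1 / 2 :: complex) + (cmod w + 1 / 4) * H / 2"
      using norm_triangle_mono[OF order_refl] by metis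
    also have "cmod (1 / 2 :: complex) = 1 / 2" by simp
    also have "1 / 2 + (cmod w + 1 / 4) * H / 2 \<le> (1 + (real N)\<^sup>2) * (1 + K * real N powr real N)"
    proof -
      have "(cmod w + 1 / 4) * H \<le> (1 + (real N)\<^sup>2) * (K * real N powr real N)"
        using wN H H0 by (intro mult_mono) auto
      moreover have "(cmod w + 1 / 4) * H / 2 \<le> (cmod w + 1 / 4) * H" using H0 by simp
      ultimately have "(cmod w + 1 / 4) * H / 2 \<le> (1 + (real N)\<^sup>2) * (K * real N powr real N)" by (rule order_trans[rotated])
      moreover have "1 / 2 \<le> 1 + (real N)\<^sup>2" using zero_le_power2[of "real N"] by linarith
      ultimately have "1 / 2 + (cmod w + 1 / 4) * H / 2 \<le> (1 + (real N)\<^sup>2) + (1 + (real N)\<^sup>2) * (K * real N powr real N)"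
        by (intro add_mono)
      thus ?thesis by (simp only: distrib_left mult_1_right)
    qed
    also have "\<dots> = a N * exp (\<epsilon> * (real N - 1)\<^sup>2)" by (simp add: a_def mult.assoc flip: exp_add)
    also have "\<dots> \<le> C * exp (\<epsilon> * cmod w)"
    proof (intro mult_mono)
      show "a N \<le> C" "0 \<le> C" using C[of N] norm_ge_zero[of "a N"] by (simp_all add: abs_le_iff)
      have "(real N - 1)\<^sup>2 \<le> r\<^sup>2" using N r0 by (intro power_mono) auto
      thus "exp (\<epsilon> * (real N - 1)\<^sup>2) \<le> exp (\<epsilon> * cmod w)" using \<epsilon> by (simp add: r0(2))
    qed auto
    finally show ?thesis .
  qed
  thus ?thesis by blast
qed

text \<open>For y = |Im z| > T >= k + 1 one has |Im w| <= y, while - Re w >= y^2 - 1/4 >= k y + y -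
  1/4 >= k y.\<close>

lemma xi_sq_zero_in_sector:
  assumes Platt: "\<And>\<rho>. riemann_xi \<rho> = 0 \<Longrightarrow> \<bar>Im \<rho>\<bar> \<le> T \<Longrightarrow> Re \<rho> = 1 / 2"
    and k: "0 \<le> k" "k + 1 \<le> T" and w: "xi_sq w = 0"
  shows "w \<in> neg_sector k"
proof -
  define z where "z = csqrt w"
  have wz: "w = z\<^sup>2" by (simp add: z_def)
  have Re_w: "Re w = (Re z)\<^sup>2 - (Im z)\<^sup>2" and Im_w: "Im w = 2 * Re z * Im z"
    by (simp_all add: wz Re_power2 Im_power2)
  have zero: "xi_entire (1 / 2 + z) = 0" using w by (simp add: xi_entire_def wz)
  have x: "\<bar>Re z\<bar> \<le> 1 / 2" using xi_entire_zero_strip[OF zero] by auto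
  show ?thesis
  proof (cases "\<bar>Im z\<bar> \<le> T")
    case True
    hence Rz: "Re z = 0" using Platt[of "1 / 2 + z"] zero by (simp add: riemann_xi_eq)
    \<comment> \<open>On the critical line w = - (Im z)^2; positivity of the constant coefficient
      rules out w = 0, which the sector excludes.\<close>
    have "xi_sq 0 = of_real (taylor 0)" using xi_sq_sums[of 0] powser_sums_zero_iff[of "\<lambda>j. of_real (taylor j)" "xi_sq 0"] by simp
    hence "w \<noteq> 0" using w taylor_pos[of 0] by auto
    hence "Im z \<noteq> 0" using Rz by (auto simp: wz complex_eq_iff)
    thus ?thesis by (simp add: neg_sector_def Re_w Im_w Rz)
  next
    case False
    define y where "y = \<bar>Im z\<bar>"
    have y: "y > T" "y > 1" using False k by (simp_all add: y_def)
    have "(Re z)\<^sup>2 \<le> (1 / 2)\<^sup>2" using x by (intro abs_le_square_iff[THEN iffD1]) simp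
    hence x2: "(Re z)\<^sup>2 \<le> 1 / 4" by (simp add: power2_eq_square)
    have "y * (k + 1) \<le> y * y" using y k by (intro mult_left_mono) auto
    hence yk: "k * y + y \<le> (Im z)\<^sup>2" by (simp add: y_def power2_eq_square algebra_simps)
    have "\<bar>Im w\<bar> = (2 * \<bar>Re z\<bar>) * y" by (simp add: Im_w y_def abs_mult)
    also have "\<dots> \<le> 1 * y" using x y by (intro mult_right_mono) auto
    finally have "k * \<bar>Im w\<bar> \<le> k * y" using k by (intro mult_left_mono) auto
    moreover have "0 \<le> k * y" using k y by simp
    ultimately show ?thesis using x2 yk y by (simp add: neg_sector_def Re_w)
  qed
qed

lemma poly_reversed_jensen:
  fixes c :: "nat \<Rightarrow> complex"
  assumes "z \<noteq> 0"
  shows "z ^ d * poly (\<Sum>j\<le>d. monom (c j) (d - j)) (1 / z) = (\<Sum>j\<le>d. c j * z ^ j)"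
proof -
  have "z ^ d * (c j * (1 / z) ^ (d - j)) = c j * z ^ j" if "j \<le> d" for j
  proof -
    have "z ^ d = z ^ (d - j) * z ^ j" using that by (simp flip: power_add)
    thus ?thesis using assms by (simp add: power_one_over)
  qed
  hence "(\<Sum>j\<le>d. z ^ d * (c j * (1 / z) ^ (d - j))) = (\<Sum>j\<le>d. c j * z ^ j)" by (intro sum.cong) auto
  thus ?thesis by (simp only: poly_sum poly_monom sum_distrib_left)
qed

theorem hyperbolic_jensen_poly:
  assumes Platt: "\<And>\<rho>. riemann_xi \<rho> = 0 \<Longrightarrow> \<bar>Im \<rho>\<bar> \<le> T \<Longrightarrow> Re \<rho> = 1 / 2"
    and T: "T \<ge> 1" and d: "real d \<le> (T - 1)\<^sup>2"
  shows "hyperbolic (jensen_poly d n)"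
proof -
  obtain P :: "nat \<Rightarrow> complex poly"
    where P: "\<And>N. map_poly cnj (P N) = P N" "\<And>N r. poly (P N) r = 0 \<Longrightarrow> xi_sq r = 0"
      "\<And>j. (\<lambda>N. coeff (P N) j) \<longlonglongrightarrow> of_real (taylor j) / of_real (taylor 0)"
  proof (rule polynomial_approximation_of_entire[OF xi_sq_sums])
    show "complex_of_real (taylor 0) \<noteq> 0" using taylor_pos[of 0] by simp
    show "complex_of_real (taylor j) \<in> \<real>" for j by simp
  qed (use xi_sq_growth in blast)+
  \<comment> \<open>The approximants converge to F / F(0), so the Jensen coefficients appear divided
    by \<open>taylor 0\<close>.\<close>
  define c where "c j = (of_nat (d choose j) * (fact (n + j) * (of_real (taylor (n + j)) / of_real (taylor 0))) :: complex)" for j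
  have rr: "real_rooted (\<Sum>j\<le>d. monom (c j) (d - j))" unfolding c_def
  proof (rule real_rooted_reversed_jensen[OF P(1) _ P(3)])
    show "r \<in> neg_sector (T - 1)" if "poly (P N) r = 0" for N r
      by (rule xi_sq_zero_in_sector[OF Platt]) (use T P(2)[OF that] in auto)
    show "complex_of_real (taylor n) / complex_of_real (taylor 0) \<noteq> 0"
      using taylor_pos[of n] taylor_pos[of 0] by simp
  qed (use d T in auto)
  show ?thesis unfolding hyperbolic_def
  proof (intro allI impI)
    fix z :: complex assume z: "poly (map_poly of_real (jensen_poly d n)) z = 0"
    show "z \<in> \<real>"
    \<comment> \<open>Reversal exchanges z and 1 / z, so only nonzero roots are reached through it;
      the root 0 is real.\<close>
    proof (cases "z = 0")
      case False
      have "poly (map_poly of_real (jensen_poly d n)) z = (\<Sum>j\<le>d. of_real (real (d choose j) * xi_coeff (n + j)) * z ^ j)"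
      proof -
        have "degree (jensen_poly d n) \<le> d" unfolding jensen_poly_def
          by (intro degree_sum_le) (auto intro: order_trans[OF degree_monom_le])
        hence "degree (map_poly complex_of_real (jensen_poly d n)) \<le> d" by (simp add: degree_map_poly)
        moreover have "coeff (jensen_poly d n) i = real (d choose i) * xi_coeff (n + i)" if "i \<le> d" for i
          using that by (simp add: jensen_poly_def coeff_sum)
        ultimately show ?thesis by (simp add: poly_eq_sum_atMost coeff_map_poly)
      qed
      also have "\<dots> = of_real (taylor 0) * (\<Sum>j\<le>d. c j * z ^ j)"
        using taylor_pos[of 0] by (simp add: xi_coeff_eq c_def sum_distrib_left mult.assoc)
      finally have "(\<Sum>j\<le>d. c j * z ^ j) = 0" using z taylor_pos[of 0] by simp
      hence "poly (\<Sum>j\<le>d. monom (c j) (d - j)) (1 / z) = 0"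
        using poly_reversed_jensen[OF False, of d c] False by simp
      hence "1 / z \<in> \<real>" using rr by (auto simp: real_rooted_def)
      thus ?thesis using Reals_inverse[of "1 / z"] by simp
    qed simp
  qed
qed

theorem corollary1p3:
  fixes d n :: nat
  assumes Platt: "\<And>\<rho>::complex. riemann_xi \<rho> = 0 \<Longrightarrow> \<bar>Im \<rho>\<bar> \<le> 3.06 * 10 ^ 10 \<Longrightarrow> Re \<rho> = 1 / 2"
    and "real d \<le> 9.36 * 10 ^ 20"
  shows "hyperbolic (jensen_poly d n)"
proof (rule hyperbolic_jensen_poly[OF Platt])
  \<comment> \<open>The square of 3.06 * 10^10 is 9.3636 * 10^20; the loss of about 6 * 10^10 from
    subtracting 1 is negligible against the margin 3.6 * 10^17.\<close>
  have "(9.36 * 10 ^ 20 :: real) \<le> (3.06 * 10 ^ 10 - 1)\<^sup>2" by (simp add: power2_eq_square)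
  with assms(2) show "real d \<le> (3.06 * 10 ^ 10 - 1)\<^sup>2" by (rule order_trans)
qed simp_all

end
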